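(* Let $K$ be an algebraically closed field, $A=KQ/I$ a finite-dimensional $K$-algebra given by a finite quiver $Q$ with vertices $1,\dots,n$ and an admissible ideal $I$, and let $k$ be a vertex of $Q$ without loops. Write $r^-_k=r^-_k(Q)$ and $r^+_k=r^+_k(Q)$ for the matrices defined in the context, and $C_A$ for the Cartan matrix of $A$. (a) If the negative mutation $\mu^-_k(A)$ is defined, then $C_{\mu^-_k(A)}=r^-_k\cdot C_A\cdot (r^-_k)^T$. (b) If the positive mutation $\mu^+_k(A)$ is defined, then $C_{\mu^+_k(A)}=r^+_k\cdot C_A\cdot (r^+_k)^T$.
   Context: For an arrow $\alpha$ of $Q$, $s(\alpha)$ and $t(\alpha)$ denote its start and end vertices; paths compose left to right. Modules are finite-dimensional right modules. $P_i$ is the indecomposable projective at vertex $i$, spanned by the (non-zero) paths starting at $i$; an arrow $\alpha$ induces a map $P_{t(\alpha)}\to P_{s(\alpha)}$ (left multiplication by $\alpha$). $L_k$ is the complex $P_k\to\bigoplus_{\alpha:\,t(\alpha)=k}P_{s(\alpha)}$ with $P_k$ in degree $-1$ and map induced by all arrows ending at $k$; $R_k$ is the complex $\bigoplus_{\beta:\,s(\beta)=k}P_{t(\beta)}\to P_k$ with $P_k$ in degree $1$ and map induced by all arrows starting at $k$. $T^-_k=L_k\oplus\bigoplus_{i\neq k}P_i$ and $T^+_k=R_k\oplus\bigoplus_{i\neq k}P_i$. The negative mutation $\mu^-_k(A)=\operatorname{End}_{\mathcal{D}^b(A)}(T^-_k)$ is said to be defined if $T^-_k$ is a tilting complex; the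 positive mutation $\mu^+_k(A)=\operatorname{End}_{\mathcal{D}^b(A)}(T^+_k)$ is said to be defined if $T^+_k$ is a tilting complex. The indecomposable projectives of these algebras are numbered by $1,\dots,n$ according to the summands: $k$ corresponds to $L_k$ (resp. $R_k$) and $i\neq k$ to $P_i$. (A tilting complex is a perfect complex $T$ with $\operatorname{Hom}(T,T[r])=0$ for $r\ne0$ whose summands generate $\operatorname{per}A$.) The Cartan matrix of an algebra $A$ with indecomposable projectives $P_1,\dots,P_n$ is $(C_A)_{ij}=\dim_K\operatorname{Hom}_A(P_i,P_j)$. The $n\times n$ matrices $r^\pm_k$ are given by: $(r^-_k)_{ij}=\delta_{ij}$ and $(r^+_k)_{ij}=\delta_{ij}$ if $i\neq k$, while $$(r^-_k)_{kj}=-\delta_{kj}+|\{\text{arrows } j\to k \text{ in } Q\}|,\qquad (r^+_k)_{kj}=-\delta_{kj}+|\{\text{arrows } k\to j\text{ in }Q\}|.$$ *)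

theory Defs
  imports
    "HOL-Computational_Algebra.Polynomial"
    "HOL-Analysis.Finite_Cartesian_Product"
    "HOL-Algebra.Ideal_Product"
    "HOL-Algebra.QuotRing"
    "Jordan_Normal_Form.Missing_VectorSpace"
    "Graph_Theory.Arc_Walk"
begin

hide_const (open) Polynomial.smult

text \<open>
  The ground field is a type of class \<^class>\<open>field\<close>, viewed as a ring record so that the
  locale \<^locale>\<open>vectorspace\<close> applies.  A \<open>K\<close>-algebra is a record of type \<open>('k, 'a) module\<close>
  (a ring together with a scalar multiplication).  In records that only carry a module structure
  the fields \<open>mult\<close> and \<open>one\<close> inherited from \<open>ring\<close> are irrelevant and left \<open>undefined\<close>.
\<close>

abbreviation scalars :: "'k::field ring" where
  "scalars \<equiv> \<lparr>carrier = UNIV, mult = (*), one = 1, zero = 0, add = (+)\<rparr>"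


section \<open>Right modules over an algebra\<close>

record ('k, 'a, 'm) rmod = "('k, 'm) module" +
  ract :: "'m \<Rightarrow> 'a \<Rightarrow> 'm"

locale right_module = vectorspace scalars M
  for A :: "('k::field, 'a) module" and M :: "('k, 'a, 'm) rmod" +
  assumes ract_closed:
      "x \<in> carrier M \<Longrightarrow> a \<in> carrier A \<Longrightarrow> ract M x a \<in> carrier M"
    and ract_add_left:
      "x \<in> carrier M \<Longrightarrow> y \<in> carrier M \<Longrightarrow> a \<in> carrier A \<Longrightarrow>
        ract M (x \<oplus>\<^bsub>M\<^esub> y) a = ract M x a \<oplus>\<^bsub>M\<^esub> ract M y a"
    and ract_add_right:
      "x \<in> carrier M \<Longrightarrow> a \<in> carrier A \<Longrightarrow> b \<in> carrier A \<Longrightarrow>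
        ract M x (a \<oplus>\<^bsub>A\<^esub> b) = ract M x a \<oplus>\<^bsub>M\<^esub> ract M x b"
    and ract_smult_left:
      "x \<in> carrier M \<Longrightarrow> a \<in> carrier A \<Longrightarrow> ract M (c \<odot>\<^bsub>M\<^esub> x) a = c \<odot>\<^bsub>M\<^esub> ract M x a"
    and ract_smult_right:
      "x \<in> carrier M \<Longrightarrow> a \<in> carrier A \<Longrightarrow> ract M x (c \<odot>\<^bsub>A\<^esub> a) = c \<odot>\<^bsub>M\<^esub> ract M x a"
    and ract_mult:
      "x \<in> carrier M \<Longrightarrow> a \<in> carrier A \<Longrightarrow> b \<in> carrier A \<Longrightarrow>
        ract M x (a \<otimes>\<^bsub>A\<^esub> b) = ract M (ract M x a) b"
    and ract_one:
      "x \<in> carrier M \<Longrightarrow> ract M x \<one>\<^bsub>A\<^esub> = x"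

definition fd_module :: "('k::field, 'a) module \<Rightarrow> ('k, 'a, 'm) rmod \<Rightarrow> bool" where
  "fd_module A M \<longleftrightarrow> right_module A M \<and> vectorspace.fin_dim scalars M"

text \<open>Maps are only relevant on the carrier of their source.\<close>

definition rhom ::
    "('k::field, 'a) module \<Rightarrow> ('k, 'a, 'm) rmod \<Rightarrow> ('k, 'a, 'n) rmod \<Rightarrow> ('m \<Rightarrow> 'n) set" where
  "rhom A M N = {f \<in> module_hom scalars M N.
     \<forall>x\<in>carrier M. \<forall>a\<in>carrier A. f (ract M x a) = ract N (f x) a}"

text \<open>The vector space \<open>Hom\<^sub>A(M, N)\<close>; its elements are made unique by extensionality.\<close>

definition hom_space ::
    "('k::field, 'a) module \<Rightarrow> ('k, 'a, 'm) rmod \<Rightarrow> ('k, 'a, 'n) rmod \<Rightarrow> ('k, 'm \<Rightarrow> 'n) module" where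
  "hom_space A M N =
    \<lparr>carrier = rhom A M N \<inter> extensional (carrier M),
     mult = undefined, one = undefined,
     zero = (\<lambda>x\<in>carrier M. \<zero>\<^bsub>N\<^esub>),
     add = (\<lambda>f g. \<lambda>x\<in>carrier M. f x \<oplus>\<^bsub>N\<^esub> g x),
     smult = (\<lambda>c f. \<lambda>x\<in>carrier M. c \<odot>\<^bsub>N\<^esub> f x)\<rparr>"

text \<open>The right module \<open>eA\<close> for an idempotent \<open>e\<close> of \<open>A\<close>.\<close>

definition idem_module :: "('k::field, 'a) module \<Rightarrow> 'a \<Rightarrow> ('k, 'a, 'a) rmod" where
  "idem_module A e =
    \<lparr>carrier = {e \<otimes>\<^bsub>A\<^esub> a | a. a \<in> carrier A},
     mult = undefined, one = undefined,
     zero = \<zero>\<^bsub>A\<^esub>, add = add A, smult = smult A, ract = mult A\<rparr>"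

definition cartan_matrix ::
    "('k::field, 'a) module \<Rightarrow> ('v::finite \<Rightarrow> ('k, 'a, 'm) rmod) \<Rightarrow> int^'v^'v" where
  "cartan_matrix A P = (\<chi> i j. int (vectorspace.dim scalars (hom_space A (P i) (P j))))"

definition dsum_module :: "'i set \<Rightarrow> ('i \<Rightarrow> ('k, 'a, 'm) rmod) \<Rightarrow> ('k, 'a, 'i \<Rightarrow> 'm) rmod" where
  "dsum_module S M =
    \<lparr>carrier = (\<Pi>\<^sub>E x\<in>S. carrier (M x)),
     mult = undefined, one = undefined,
     zero = (\<lambda>x\<in>S. \<zero>\<^bsub>M x\<^esub>),
     add = (\<lambda>f g. \<lambda>x\<in>S. f x \<oplus>\<^bsub>M x\<^esub> g x),
     smult = (\<lambda>c f. \<lambda>x\<in>S. c \<odot>\<^bsub>M x\<^esub> f x),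
     ract = (\<lambda>f a. \<lambda>x\<in>S. ract (M x) (f x) a)\<rparr>"

definition prod_module ::
    "('k, 'a, 'm) rmod \<Rightarrow> ('k, 'a, 'n) rmod \<Rightarrow> ('k, 'a, 'm \<times> 'n) rmod" where
  "prod_module M N =
    \<lparr>carrier = carrier M \<times> carrier N,
     mult = undefined, one = undefined,
     zero = (\<zero>\<^bsub>M\<^esub>, \<zero>\<^bsub>N\<^esub>),
     add = (\<lambda>(x, y) (x', y'). (x \<oplus>\<^bsub>M\<^esub> x', y \<oplus>\<^bsub>N\<^esub> y')),
     smult = (\<lambda>c (x, y). (c \<odot>\<^bsub>M\<^esub> x, c \<odot>\<^bsub>N\<^esub> y)),
     ract = (\<lambda>(x, y) a. (ract M x a, ract N y a))\<rparr>"


section \<open>The bounded derived category of finite-dimensional right modules\<close>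

text \<open>
  All objects of the category have their elements in one type \<open>'m\<close>.  Every finite-dimensional
  module is isomorphic to one with elements in \<open>'m\<close> as soon as \<open>'m\<close> contains a copy of each
  \<open>K\<^sup>d\<close>, and then the definitions below describe the full category \<open>D\<^sup>b(A)\<close>.  This is the case for
  the type at which they are used, whose elements are functions into sets of functions from
  paths to \<open>K\<close>.

  Complexes are cohomologically graded: \<open>cdiff X i\<close> maps degree \<open>i\<close> to degree \<open>i + 1\<close>.
\<close>

record ('k, 'a, 'm) cplx =
  cmod :: "int \<Rightarrow> ('k, 'a, 'm) rmod"
  cdiff :: "int \<Rightarrow> 'm \<Rightarrow> 'm"

definition bounded_complex :: "('k::field, 'a) module \<Rightarrow> ('k, 'a, 'm) cplx \<Rightarrow> bool" where
  "bounded_complex A X \<longleftrightarrow>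
     (\<forall>i. fd_module A (cmod X i)) \<and>
     (\<forall>i. cdiff X i \<in> rhom A (cmod X i) (cmod X (i + 1))) \<and>
     (\<forall>i. \<forall>x\<in>carrier (cmod X i). cdiff X (i + 1) (cdiff X i x) = \<zero>\<^bsub>cmod X (i + 1 + 1)\<^esub>) \<and>
     (\<exists>N. \<forall>i. \<bar>i\<bar> > N \<longrightarrow> carrier (cmod X i) = {\<zero>\<^bsub>cmod X i\<^esub>})"

definition chain_map ::
    "('k::field, 'a) module \<Rightarrow> ('k, 'a, 'm) cplx \<Rightarrow> ('k, 'a, 'n) cplx \<Rightarrow> (int \<Rightarrow> 'm \<Rightarrow> 'n) \<Rightarrow> bool" where
  "chain_map A X Y f \<longleftrightarrow>
     (\<forall>i. f i \<in> rhom A (cmod X i) (cmod Y i)) \<and>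
     (\<forall>i. \<forall>x\<in>carrier (cmod X i). f (i + 1) (cdiff X i x) = cdiff Y i (f i x))"

definition cid :: "int \<Rightarrow> 'm \<Rightarrow> 'm" where
  "cid = (\<lambda>i x. x)"

definition ccomp :: "(int \<Rightarrow> 'n \<Rightarrow> 'p) \<Rightarrow> (int \<Rightarrow> 'm \<Rightarrow> 'n) \<Rightarrow> int \<Rightarrow> 'm \<Rightarrow> 'p" where
  "ccomp g f = (\<lambda>i x. g i (f i x))"

definition homotopic ::
    "('k::field, 'a) module \<Rightarrow> ('k, 'a, 'm) cplx \<Rightarrow> ('k, 'a, 'n) cplx \<Rightarrow>
      (int \<Rightarrow> 'm \<Rightarrow> 'n) \<Rightarrow> (int \<Rightarrow> 'm \<Rightarrow> 'n) \<Rightarrow> bool" where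
  "homotopic A X Y f g \<longleftrightarrow>
     (\<exists>h. (\<forall>i. h i \<in> rhom A (cmod X i) (cmod Y (i - 1))) \<and>
          (\<forall>i. \<forall>x\<in>carrier (cmod X i).
             f i x = g i x \<oplus>\<^bsub>cmod Y i\<^esub>
               (cdiff Y (i - 1) (h i x) \<oplus>\<^bsub>cmod Y i\<^esub> h (i + 1) (cdiff X i x))))"

definition cocycles :: "('k, 'a, 'm) cplx \<Rightarrow> int \<Rightarrow> 'm set" where
  "cocycles X i = {x \<in> carrier (cmod X i). cdiff X i x = \<zero>\<^bsub>cmod X (i + 1)\<^esub>}"

definition coboundaries :: "('k, 'a, 'm) cplx \<Rightarrow> int \<Rightarrow> 'm set" where
  "coboundaries X i = cdiff X (i - 1) ` carrier (cmod X (i - 1))"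

definition cohomology :: "('k, 'a, 'm) cplx \<Rightarrow> int \<Rightarrow> 'm set set" where
  "cohomology X i = (\<lambda>x. coboundaries X i +>\<^bsub>cmod X i\<^esub> x) ` cocycles X i"

text \<open>On cohomology, \<open>f\<close> maps the coset \<open>C = B\<^sup>i(X) + x\<close> to \<open>B\<^sup>i(Y) + f C = B\<^sup>i(Y) + f x\<close>.\<close>

definition quasi_iso ::
    "('k::field, 'a) module \<Rightarrow> ('k, 'a, 'm) cplx \<Rightarrow> ('k, 'a, 'n) cplx \<Rightarrow> (int \<Rightarrow> 'm \<Rightarrow> 'n) \<Rightarrow> bool" where
  "quasi_iso A X Y f \<longleftrightarrow> chain_map A X Y f \<and>
     (\<forall>i. bij_betw (\<lambda>C. coboundaries Y i <+>\<^bsub>cmod Y i\<^esub> (f i ` C)) (cohomology X i) (cohomology Y i))"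

text \<open>
  \<open>D\<^sup>b(A)\<close> is the localisation of the homotopy category at the quasi-isomorphisms.  A morphism
  \<open>X \<rightarrow> Y\<close> is a class of roofs \<open>(Z, s, f)\<close> with a quasi-isomorphism \<open>s : Z \<rightarrow> X\<close> and a chain
  map \<open>f : Z \<rightarrow> Y\<close>; two roofs are equivalent if they become equal in the homotopy category
  on a common refinement \<open>W\<close>.
\<close>

type_synonym ('k, 'a, 'm) roof =
  "('k, 'a, 'm) cplx \<times> (int \<Rightarrow> 'm \<Rightarrow> 'm) \<times> (int \<Rightarrow> 'm \<Rightarrow> 'm)"

definition roofs ::
    "('k::field, 'a) module \<Rightarrow> ('k, 'a, 'm) cplx \<Rightarrow> ('k, 'a, 'm) cplx \<Rightarrow> ('k, 'a, 'm) roof set" where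
  "roofs A X Y = {(Z, s, f). bounded_complex A Z \<and> quasi_iso A Z X s \<and> chain_map A Z Y f}"

fun roof_equiv ::
    "('k::field, 'a) module \<Rightarrow> ('k, 'a, 'm) cplx \<Rightarrow> ('k, 'a, 'm) cplx \<Rightarrow>
      ('k, 'a, 'm) roof \<Rightarrow> ('k, 'a, 'm) roof \<Rightarrow> bool" where
  "roof_equiv A X Y (Z, s, f) (Z', s', f') \<longleftrightarrow>
     (\<exists>(W :: ('k, 'a, 'm) cplx) u v. bounded_complex A W \<and> chain_map A W Z u \<and> chain_map A W Z' v \<and>
        quasi_iso A W X (ccomp s u) \<and>
        homotopic A W X (ccomp s u) (ccomp s' v) \<and>
        homotopic A W Y (ccomp f u) (ccomp f' v))"

definition roof_class ::
    "('k::field, 'a) module \<Rightarrow> ('k, 'a, 'm) cplx \<Rightarrow> ('k, 'a, 'm) cplx \<Rightarrow>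
      ('k, 'a, 'm) roof \<Rightarrow> ('k, 'a, 'm) roof set" where
  "roof_class A X Y r = {r' \<in> roofs A X Y. roof_equiv A X Y r r'}"

definition D_of_chain_map ::
    "('k::field, 'a) module \<Rightarrow> ('k, 'a, 'm) cplx \<Rightarrow> ('k, 'a, 'm) cplx \<Rightarrow>
      (int \<Rightarrow> 'm \<Rightarrow> 'm) \<Rightarrow> ('k, 'a, 'm) roof set" where
  "D_of_chain_map A X Y f = roof_class A X Y (X, cid, f)"

text \<open>
  Sums are formed after bringing the two morphisms to a common denominator.  The unions
  below are over representatives, all of which give the same class.
\<close>

definition D_hom ::
    "('k::field, 'a) module \<Rightarrow> ('k, 'a, 'm) cplx \<Rightarrow> ('k, 'a, 'm) cplx \<Rightarrow>
      ('k, ('k, 'a, 'm) roof set) module" where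
  "D_hom A X Y =
    \<lparr>carrier = roof_class A X Y ` roofs A X Y,
     mult = undefined, one = undefined,
     zero = D_of_chain_map A X Y (\<lambda>i x. \<zero>\<^bsub>cmod Y i\<^esub>),
     add = (\<lambda>\<xi> \<eta>. \<Union>{roof_class A X Y (W, t, \<lambda>i x. f i x \<oplus>\<^bsub>cmod Y i\<^esub> g i x) | W t f g.
               (W, t, f) \<in> \<xi> \<and> (W, t, g) \<in> \<eta>}),
     smult = (\<lambda>c \<xi>. \<Union>{roof_class A X Y (W, t, \<lambda>i x. c \<odot>\<^bsub>cmod Y i\<^esub> f i x) | W t f.
               (W, t, f) \<in> \<xi>})\<rparr>"

text \<open>The composite \<open>X \<rightarrow> Y \<rightarrow> Y'\<close> of \<open>\<xi> : X \<rightarrow> Y\<close> and \<open>\<eta> : Y \<rightarrow> Y'\<close>.\<close>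

definition D_comp ::
    "('k::field, 'a) module \<Rightarrow> ('k, 'a, 'm) cplx \<Rightarrow> ('k, 'a, 'm) cplx \<Rightarrow> ('k, 'a, 'm) cplx \<Rightarrow>
      ('k, 'a, 'm) roof set \<Rightarrow> ('k, 'a, 'm) roof set \<Rightarrow> ('k, 'a, 'm) roof set" where
  "D_comp A X Y Y' \<eta> \<xi> =
     \<Union>{roof_class A X Y' (W, ccomp s u, ccomp g v) | W s u g v.
         \<exists>Z f Z' t. (Z, s, f) \<in> \<xi> \<and> (Z', t, g) \<in> \<eta> \<and> bounded_complex A W \<and>
           quasi_iso A W Z u \<and> chain_map A W Z' v \<and> homotopic A W Y (ccomp f u) (ccomp t v)}"

abbreviation D_id ::
    "('k::field, 'a) module \<Rightarrow> ('k, 'a, 'm) cplx \<Rightarrow> ('k, 'a, 'm) roof set" where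
  "D_id A X \<equiv> D_of_chain_map A X X cid"

text \<open>The product of the endomorphism algebra is composition of maps, \<open>\<eta> \<otimes> \<xi> = \<eta> \<circ> \<xi>\<close>.\<close>

definition D_End ::
    "('k::field, 'a) module \<Rightarrow> ('k, 'a, 'm) cplx \<Rightarrow> ('k, ('k, 'a, 'm) roof set) module" where
  "D_End A X = (D_hom A X X)\<lparr>mult := D_comp A X X X, one := D_id A X\<rparr>"

definition D_iso :: "('k::field, 'a) module \<Rightarrow> ('k, 'a, 'm) cplx \<Rightarrow> ('k, 'a, 'm) cplx \<Rightarrow> bool" where
  "D_iso A X Y \<longleftrightarrow>
     (\<exists>\<xi>\<in>carrier (D_hom A X Y). \<exists>\<eta>\<in>carrier (D_hom A Y X).
        D_comp A X Y X \<eta> \<xi> = D_id A X \<and> D_comp A Y X Y \<xi> \<eta> = D_id A Y)"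

text \<open>\<open>X\<close> is a direct summand of \<open>T\<close> in \<open>D\<^sup>b(A)\<close>: there is \<open>Y\<close> such that \<open>T\<close> is a biproduct of \<open>X\<close> and \<open>Y\<close>.\<close>

definition D_summand :: "('k::field, 'a) module \<Rightarrow> ('k, 'a, 'm) cplx \<Rightarrow> ('k, 'a, 'm) cplx \<Rightarrow> bool" where
  "D_summand A X T \<longleftrightarrow> bounded_complex A X \<and>
     (\<exists>Y. bounded_complex A Y \<and>
       (\<exists>\<iota>\<in>carrier (D_hom A X T). \<exists>\<pi>\<in>carrier (D_hom A T X).
        \<exists>\<iota>'\<in>carrier (D_hom A Y T). \<exists>\<pi>'\<in>carrier (D_hom A T Y).
          D_comp A X T X \<pi> \<iota> = D_id A X \<and>
          D_comp A Y T Y \<pi>' \<iota>' = D_id A Y \<and>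
          D_comp A T X T \<iota> \<pi> \<oplus>\<^bsub>D_hom A T T\<^esub> D_comp A T Y T \<iota>' \<pi>' = D_id A T))"

definition shift :: "int \<Rightarrow> ('k, 'a, 'm) cplx \<Rightarrow> ('k, 'a, 'm) cplx" where
  "shift r X =
    \<lparr>cmod = (\<lambda>i. cmod X (i + r)),
     cdiff = (\<lambda>i x. if even r then cdiff X (i + r) x
                   else \<ominus>\<^bsub>cmod X (i + r + 1)\<^esub> cdiff X (i + r) x)\<rparr>"

definition cone ::
    "('k, 'a, 'm) cplx \<Rightarrow> ('k, 'a, 'm) cplx \<Rightarrow> (int \<Rightarrow> 'm \<Rightarrow> 'm) \<Rightarrow> ('k, 'a, 'm \<times> 'm) cplx" where
  "cone X Y f =
    \<lparr>cmod = (\<lambda>i. prod_module (cmod X (i + 1)) (cmod Y i)),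
     cdiff = (\<lambda>i (x, y). (\<ominus>\<^bsub>cmod X (i + 1 + 1)\<^esub> cdiff X (i + 1) x,
                         f (i + 1) x \<oplus>\<^bsub>cmod Y (i + 1)\<^esub> cdiff Y i y))\<rparr>"

definition complex_iso ::
    "('k::field, 'a) module \<Rightarrow> ('k, 'a, 'm) cplx \<Rightarrow> ('k, 'a, 'n) cplx \<Rightarrow> bool" where
  "complex_iso A X Y \<longleftrightarrow>
     (\<exists>f. chain_map A X Y f \<and> (\<forall>i. bij_betw (f i) (carrier (cmod X i)) (carrier (cmod Y i))))"

text \<open>
  The triangulated subcategory of \<open>D\<^sup>b(A)\<close> generated by a set of objects (full, closed under
  isomorphisms, shifts and cones).  It suffices to take cones of chain maps, because the source of a
  morphism in \<open>D\<^sup>b(A)\<close> may be replaced by an isomorphic object.  The cone of \<open>f\<close> has elements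
  in \<open>'m \<times> 'm\<close>; \<open>Z\<close> is an isomorphic copy with elements in \<open>'m\<close>.
\<close>

inductive_set triang_gen ::
    "('k::field, 'a) module \<Rightarrow> ('k, 'a, 'm) cplx set \<Rightarrow> ('k, 'a, 'm) cplx set"
  for A :: "('k::field, 'a) module" and S :: "('k, 'a, 'm) cplx set" where
  base: "X \<in> S \<Longrightarrow> X \<in> triang_gen A S"
| iso: "X \<in> triang_gen A S \<Longrightarrow> bounded_complex A Y \<Longrightarrow> D_iso A X Y \<Longrightarrow> Y \<in> triang_gen A S"
| shift: "X \<in> triang_gen A S \<Longrightarrow> shift r X \<in> triang_gen A S"
| cone: "X \<in> triang_gen A S \<Longrightarrow> Y \<in> triang_gen A S \<Longrightarrow> chain_map A X Y f \<Longrightarrow>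
    bounded_complex A Z \<Longrightarrow> complex_iso A (cone X Y f) Z \<Longrightarrow> Z \<in> triang_gen A S"

definition projective_module :: "('k::field, 'a) module \<Rightarrow> ('k, 'a, 'm) rmod \<Rightarrow> bool" where
  "projective_module A P \<longleftrightarrow> fd_module A P \<and>
     (\<forall>(M :: ('k, 'a, 'm) rmod) (N :: ('k, 'a, 'm) rmod) g f.
        fd_module A M \<longrightarrow> fd_module A N \<longrightarrow> g \<in> rhom A M N \<longrightarrow> g ` carrier M = carrier N \<longrightarrow>
        f \<in> rhom A P N \<longrightarrow> (\<exists>h\<in>rhom A P M. \<forall>x\<in>carrier P. g (h x) = f x))"

definition perfect :: "('k::field, 'a) module \<Rightarrow> ('k, 'a, 'm) cplx \<Rightarrow> bool" where
  "perfect A X \<longleftrightarrow> bounded_complex A X \<and>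
     (\<exists>P. bounded_complex A P \<and> (\<forall>i. projective_module A (cmod P i)) \<and> D_iso A X P)"

definition tilting_complex :: "('k::field, 'a) module \<Rightarrow> ('k, 'a, 'm) cplx \<Rightarrow> bool" where
  "tilting_complex A T \<longleftrightarrow> perfect A T \<and>
     (\<forall>r. r \<noteq> 0 \<longrightarrow> carrier (D_hom A T (shift r T)) = {\<zero>\<^bsub>D_hom A T (shift r T)\<^esub>}) \<and>
     triang_gen A {X. D_summand A X T} = {X. perfect A X}"


section \<open>Bound quiver algebras\<close>

text \<open>
  A quiver is a \<open>pre_digraph\<close>, an arrow \<open>\<alpha>\<close> going from \<open>tail Q \<alpha>\<close> to \<open>head Q \<alpha>\<close>.  A path is its
  start vertex together with its list of arrows, so that \<open>(i, [])\<close> is the trivial path at \<open>i\<close>.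
\<close>

type_synonym ('v, 'e) qpath = "'v \<times> 'e list"

definition qpaths :: "('v, 'e) pre_digraph \<Rightarrow> ('v, 'e) qpath set" where
  "qpaths Q = {(u, p). \<exists>v. pre_digraph.awalk Q u p v}"

text \<open>
  Elements are the finitely supported functions on the set of paths.  Since paths compose left
  to right, the coefficient of \<open>f \<otimes> g\<close> at a path is the sum over all ways of cutting it into an
  initial and a final piece.
\<close>

definition path_algebra ::
    "('v, 'e) pre_digraph \<Rightarrow> ('k::field, ('v, 'e) qpath \<Rightarrow> 'k) module" where
  "path_algebra Q =
    \<lparr>carrier = {f. finite {w. f w \<noteq> 0} \<and> {w. f w \<noteq> 0} \<subseteq> qpaths Q},
     mult = (\<lambda>f g (u, p). \<Sum>m\<le>length p.
       f (u, take m p) * g (pre_digraph.awlast Q u (take m p), drop m p)),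
     one = (\<lambda>(u, p). if u \<in> verts Q \<and> p = [] then 1 else 0),
     zero = (\<lambda>w. 0),
     add = (\<lambda>f g w. f w + g w),
     smult = (\<lambda>c f w. c * f w)\<rparr>"

definition path_elem :: "('v, 'e) qpath \<Rightarrow> ('v, 'e) qpath \<Rightarrow> 'k::field" where
  "path_elem w = (\<lambda>w'. if w' = w then 1 else 0)"

definition arrow_ideal :: "('v, 'e) pre_digraph \<Rightarrow> (('v, 'e) qpath \<Rightarrow> 'k::field) set" where
  "arrow_ideal Q = Idl\<^bsub>path_algebra Q\<^esub> {path_elem (tail Q \<alpha>, [\<alpha>]) | \<alpha>. \<alpha> \<in> arcs Q}"

primrec ideal_power :: "('a, 'b) ring_scheme \<Rightarrow> 'a set \<Rightarrow> nat \<Rightarrow> 'a set" where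
  "ideal_power R J 0 = carrier R"
| "ideal_power R J (Suc m) = ideal_prod R (ideal_power R J m) J"

definition admissible_ideal ::
    "('v, 'e) pre_digraph \<Rightarrow> (('v, 'e) qpath \<Rightarrow> 'k::field) set \<Rightarrow> bool" where
  "admissible_ideal Q I \<longleftrightarrow> ideal I (path_algebra Q) \<and>
     (\<exists>m\<ge>2. ideal_power (path_algebra Q) (arrow_ideal Q) m \<subseteq> I) \<and>
     I \<subseteq> ideal_power (path_algebra Q) (arrow_ideal Q) 2"

definition bound_quiver_algebra ::
    "('v, 'e) pre_digraph \<Rightarrow> (('v, 'e) qpath \<Rightarrow> 'k::field) set \<Rightarrow>
      ('k, (('v, 'e) qpath \<Rightarrow> 'k) set) module" where
  "bound_quiver_algebra Q I = ring.extend (path_algebra Q Quot I)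
     (module.fields (\<lambda>c C. \<Union>f\<in>C. I +>\<^bsub>path_algebra Q\<^esub> (c \<odot>\<^bsub>path_algebra Q\<^esub> f)))"

definition path_class ::
    "('v, 'e) pre_digraph \<Rightarrow> (('v, 'e) qpath \<Rightarrow> 'k::field) set \<Rightarrow> ('v, 'e) qpath \<Rightarrow>
      (('v, 'e) qpath \<Rightarrow> 'k) set" where
  "path_class Q I w = I +>\<^bsub>path_algebra Q\<^esub> path_elem w"

text \<open>\<open>P\<^sub>i = e\<^sub>i A\<close> is spanned by the classes of the paths starting at \<open>i\<close>.\<close>

definition quiver_proj ::
    "('v, 'e) pre_digraph \<Rightarrow> (('v, 'e) qpath \<Rightarrow> 'k::field) set \<Rightarrow> 'v \<Rightarrow>
      ('k, (('v, 'e) qpath \<Rightarrow> 'k) set, (('v, 'e) qpath \<Rightarrow> 'k) set) rmod" where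
  "quiver_proj Q I i = idem_module (bound_quiver_algebra Q I) (path_class Q I (i, []))"


section \<open>The complexes defining the mutations\<close>

text \<open>
  All terms of \<open>L\<^sub>k\<close>, \<open>R\<^sub>k\<close> and of the stalk complexes \<open>P\<^sub>i\<close> are direct sums indexed by subsets of
  \<open>'e option\<close>: a single module is the direct sum indexed by \<open>{None}\<close>, and in the sums over arrows
  the summand of the arrow \<open>\<alpha>\<close> has index \<open>Some \<alpha>\<close>.
\<close>

type_synonym ('v, 'e, 'k) qalg_elem = "(('v, 'e) qpath \<Rightarrow> 'k) set"

type_synonym ('v, 'e, 'k) qcplx =
  "('k, ('v, 'e, 'k) qalg_elem, 'e option \<Rightarrow> ('v, 'e, 'k) qalg_elem) cplx"

type_synonym ('v, 'e, 'k) qcplx_sum =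
  "('k, ('v, 'e, 'k) qalg_elem, 'v \<Rightarrow> 'e option \<Rightarrow> ('v, 'e, 'k) qalg_elem) cplx"

definition stalk_module ::
    "('v, 'e) pre_digraph \<Rightarrow> (('v, 'e) qpath \<Rightarrow> 'k::field) set \<Rightarrow> 'v \<Rightarrow> int \<Rightarrow>
      ('k, ('v, 'e, 'k) qalg_elem, 'e option \<Rightarrow> ('v, 'e, 'k) qalg_elem) rmod" where
  "stalk_module Q I i d =
     dsum_module (if d = 0 then {None} else {}) (\<lambda>_. quiver_proj Q I i)"

definition stalk_complex ::
    "('v, 'e) pre_digraph \<Rightarrow> (('v, 'e) qpath \<Rightarrow> 'k::field) set \<Rightarrow> 'v \<Rightarrow> ('v, 'e, 'k) qcplx" where
  "stalk_complex Q I i =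
    \<lparr>cmod = stalk_module Q I i,
     cdiff = (\<lambda>d x. \<zero>\<^bsub>stalk_module Q I i (d + 1)\<^esub>)\<rparr>"

definition L_module ::
    "('v, 'e) pre_digraph \<Rightarrow> (('v, 'e) qpath \<Rightarrow> 'k::field) set \<Rightarrow> 'v \<Rightarrow> int \<Rightarrow>
      ('k, ('v, 'e, 'k) qalg_elem, 'e option \<Rightarrow> ('v, 'e, 'k) qalg_elem) rmod" where
  "L_module Q I k d =
    (if d = -1 then dsum_module {None} (\<lambda>_. quiver_proj Q I k)
     else if d = 0 then dsum_module (Some ` in_arcs Q k) (\<lambda>x. quiver_proj Q I (tail Q (the x)))
     else dsum_module {} (\<lambda>_. quiver_proj Q I k))"

definition L_complex ::
    "('v, 'e) pre_digraph \<Rightarrow> (('v, 'e) qpath \<Rightarrow> 'k::field) set \<Rightarrow> 'v \<Rightarrow> ('v, 'e, 'k) qcplx" where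
  "L_complex Q I k =
    \<lparr>cmod = L_module Q I k,
     cdiff = (\<lambda>d x.
       if d = -1 then
         (\<lambda>y\<in>Some ` in_arcs Q k.
            path_class Q I (tail Q (the y), [the y]) \<otimes>\<^bsub>bound_quiver_algebra Q I\<^esub> x None)
       else \<zero>\<^bsub>L_module Q I k (d + 1)\<^esub>)\<rparr>"

definition R_module ::
    "('v, 'e) pre_digraph \<Rightarrow> (('v, 'e) qpath \<Rightarrow> 'k::field) set \<Rightarrow> 'v \<Rightarrow> int \<Rightarrow>
      ('k, ('v, 'e, 'k) qalg_elem, 'e option \<Rightarrow> ('v, 'e, 'k) qalg_elem) rmod" where
  "R_module Q I k d =
    (if d = 1 then dsum_module {None} (\<lambda>_. quiver_proj Q I k)
     else if d = 0 then dsum_module (Some ` out_arcs Q k) (\<lambda>x. quiver_proj Q I (head Q (the x)))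
     else dsum_module {} (\<lambda>_. quiver_proj Q I k))"

definition R_complex ::
    "('v, 'e) pre_digraph \<Rightarrow> (('v, 'e) qpath \<Rightarrow> 'k::field) set \<Rightarrow> 'v \<Rightarrow> ('v, 'e, 'k) qcplx" where
  "R_complex Q I k =
    \<lparr>cmod = R_module Q I k,
     cdiff = (\<lambda>d x.
       if d = 0 then
         (\<lambda>y\<in>{None}. \<Oplus>\<^bsub>bound_quiver_algebra Q I\<^esub>\<beta>\<in>out_arcs Q k.
            path_class Q I (k, [\<beta>]) \<otimes>\<^bsub>bound_quiver_algebra Q I\<^esub> x (Some \<beta>))
       else \<zero>\<^bsub>R_module Q I k (d + 1)\<^esub>)\<rparr>"

definition dsum_complex :: "('v \<Rightarrow> ('k, 'a, 'm) cplx) \<Rightarrow> ('k, 'a, 'v::finite \<Rightarrow> 'm) cplx" where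
  "dsum_complex X =
    \<lparr>cmod = (\<lambda>d. dsum_module UNIV (\<lambda>i. cmod (X i) d)),
     cdiff = (\<lambda>d x i. cdiff (X i) d (x i))\<rparr>"

definition summand_proj :: "('v \<Rightarrow> ('k, 'a, 'm) cplx) \<Rightarrow> 'v::finite \<Rightarrow> int \<Rightarrow> ('v \<Rightarrow> 'm) \<Rightarrow> ('v \<Rightarrow> 'm)" where
  "summand_proj X i = (\<lambda>d x j. if j = i then x i else \<zero>\<^bsub>cmod (X j) d\<^esub>)"

text \<open>
  The endomorphism algebra \<open>B\<close> of \<open>\<Oplus>\<^sub>i X\<^sub>i\<close> in \<open>D\<^sup>b(A)\<close>, and its projective module \<open>e\<^sub>i B\<close>
  corresponding to the summand \<open>X\<^sub>i\<close>, where \<open>e\<^sub>i\<close> is the projection onto \<open>X\<^sub>i\<close>.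
\<close>

definition End_dsum ::
    "('k::field, 'a) module \<Rightarrow> ('v::finite \<Rightarrow> ('k, 'a, 'm) cplx) \<Rightarrow>
      ('k, ('k, 'a, 'v \<Rightarrow> 'm) roof set) module" where
  "End_dsum A X = D_End A (dsum_complex X)"

definition End_dsum_proj ::
    "('k::field, 'a) module \<Rightarrow> ('v::finite \<Rightarrow> ('k, 'a, 'm) cplx) \<Rightarrow> 'v \<Rightarrow>
      ('k, ('k, 'a, 'v \<Rightarrow> 'm) roof set, ('k, 'a, 'v \<Rightarrow> 'm) roof set) rmod" where
  "End_dsum_proj A X i = idem_module (End_dsum A X)
     (D_of_chain_map A (dsum_complex X) (dsum_complex X) (summand_proj X i))"

definition T_minus_summand ::
    "('v, 'e) pre_digraph \<Rightarrow> (('v, 'e) qpath \<Rightarrow> 'k::field) set \<Rightarrow> 'v \<Rightarrow> 'v \<Rightarrow> ('v, 'e, 'k) qcplx" where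
  "T_minus_summand Q I k i = (if i = k then L_complex Q I k else stalk_complex Q I i)"

definition T_plus_summand ::
    "('v, 'e) pre_digraph \<Rightarrow> (('v, 'e) qpath \<Rightarrow> 'k::field) set \<Rightarrow> 'v \<Rightarrow> 'v \<Rightarrow> ('v, 'e, 'k) qcplx" where
  "T_plus_summand Q I k i = (if i = k then R_complex Q I k else stalk_complex Q I i)"

definition T_minus ::
    "('v::finite, 'e) pre_digraph \<Rightarrow> (('v, 'e) qpath \<Rightarrow> 'k::field) set \<Rightarrow> 'v \<Rightarrow> ('v, 'e, 'k) qcplx_sum" where
  "T_minus Q I k = dsum_complex (T_minus_summand Q I k)"

definition T_plus ::
    "('v::finite, 'e) pre_digraph \<Rightarrow> (('v, 'e) qpath \<Rightarrow> 'k::field) set \<Rightarrow> 'v \<Rightarrow> ('v, 'e, 'k) qcplx_sum" where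
  "T_plus Q I k = dsum_complex (T_plus_summand Q I k)"

definition neg_mutation_defined ::
    "('v::finite, 'e) pre_digraph \<Rightarrow> (('v, 'e) qpath \<Rightarrow> 'k::field) set \<Rightarrow> 'v \<Rightarrow> bool" where
  "neg_mutation_defined Q I k \<longleftrightarrow> tilting_complex (bound_quiver_algebra Q I) (T_minus Q I k)"

definition pos_mutation_defined ::
    "('v::finite, 'e) pre_digraph \<Rightarrow> (('v, 'e) qpath \<Rightarrow> 'k::field) set \<Rightarrow> 'v \<Rightarrow> bool" where
  "pos_mutation_defined Q I k \<longleftrightarrow> tilting_complex (bound_quiver_algebra Q I) (T_plus Q I k)"

abbreviation neg_mutation where
  "neg_mutation Q I k \<equiv> End_dsum (bound_quiver_algebra Q I) (T_minus_summand Q I k)"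

abbreviation pos_mutation where
  "pos_mutation Q I k \<equiv> End_dsum (bound_quiver_algebra Q I) (T_plus_summand Q I k)"

abbreviation neg_mutation_proj where
  "neg_mutation_proj Q I k \<equiv> End_dsum_proj (bound_quiver_algebra Q I) (T_minus_summand Q I k)"

abbreviation pos_mutation_proj where
  "pos_mutation_proj Q I k \<equiv> End_dsum_proj (bound_quiver_algebra Q I) (T_plus_summand Q I k)"

definition r_minus :: "('v::finite, 'e) pre_digraph \<Rightarrow> 'v \<Rightarrow> int^'v^'v" where
  "r_minus Q k = (\<chi> i j.
     if i = k then - (if j = k then 1 else 0) + int (card {\<alpha> \<in> arcs Q. tail Q \<alpha> = j \<and> head Q \<alpha> = k})
     else if i = j then 1 else 0)"

definition r_plus :: "('v::finite, 'e) pre_digraph \<Rightarrow> 'v \<Rightarrow> int^'v^'v" where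
  "r_plus Q k = (\<chi> i j.
     if i = k then - (if j = k then 1 else 0) + int (card {\<beta> \<in> arcs Q. tail Q \<beta> = k \<and> head Q \<beta> = j})
     else if i = j then 1 else 0)"

end

theory Submission
  imports Defs
begin

text \<open>
  Let \<open>X\<^sub>i\<close> be the summands of the tilting complex \<open>T\<close> and \<open>B = End(T)\<close>.  All \<open>X\<^sub>i\<close> are complexes of sums of the
  \<open>P\<^sub>u\<close> in two fixed consecutive degrees, so the complex \<open>Hom(X\<^sub>i, X\<^sub>j)\<close> lives in the degrees \<open>-1\<close>, \<open>0\<close>, \<open>1\<close>.
  As the terms are projective, morphisms in \<open>D\<^sup>b(A)\<close> are homotopy classes of chain maps; hence the
  cohomology of \<open>Hom(X\<^sub>i, X\<^sub>j)\<close> is \<open>Hom(X\<^sub>i, X\<^sub>j[r])\<close>, which vanishes for \<open>r \<noteq> 0\<close> and is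
  \<open>e\<^sub>j B e\<^sub>i = Hom\<^sub>B(e\<^sub>i B, e\<^sub>j B)\<close> for \<open>r = 0\<close>.  So \<open>(C\<^sub>B)\<^sub>i\<^sub>j\<close> is the Euler characteristic of \<open>Hom(X\<^sub>i, X\<^sub>j)\<close>,
  which is bilinear in the classes of \<open>X\<^sub>i\<close> and \<open>X\<^sub>j\<close> in the Grothendieck group.  The matrices
  \<open>r\<^sup>\<plusminus>\<^sub>k\<close> are the coefficients of these classes with respect to the classes of the \<open>P\<^sub>u\<close>.
\<close>

section \<open>Dimensions of vector spaces\<close>

text \<open>The obstacle is that \<open>D_hom\<close> is built from roofs whose middle objects
  \<open>Z\<close> are arbitrary bounded complexes. What makes it computable is that a
  quasi-isomorphism from \<open>Z\<close> to a two-term complex \<open>X\<close> of projectives has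
  a section up to homotopy, and that this section is unique up to homotopy; a roof then becomes its
  right leg composed with the section. Both facts are diagram chases through two degrees in which
  the choices must be linear and satisfy several conditions at once. For this reason projectivity is
  used as lifting along a linear relation rather than along a surjection.

  The vanishing enters at the shifts 1 and -1: it makes the last differential of the three-term
  complex Hom(X_i, X_j) surjective and the first one injective. Rank-nullity then gives the
  dimension of the middle cohomology, and additivity of Hom over the summands leaves a count of the
  multiplicities of each \<open>P u\<close>.\<close>

lemma linear_mapI:
  assumes "vectorspace K V" "vectorspace K W" "T \<in> module_hom K V W"
  shows "linear_map K V W T"
proof -
  interpret V: vectorspace K V by fact
  interpret W: vectorspace K W by fact
  show ?thesis
    unfolding linear_map_def mod_hom_def mod_hom_axioms_def
    using assms V.module_axioms W.module_axioms by simp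
qed

text \<open>An independent subset of \<open>W\<close> stays independent in \<open>V\<close>, so its
  size is at most \<open>V.dim\<close>; hence a maximal one exists, and it is a basis.\<close>

lemma fin_dim_subspace:
  assumes "vectorspace K V" "vectorspace.fin_dim K V" "subspace K W V"
  shows "vectorspace.fin_dim K (V\<lparr>carrier := W\<rparr>)"
proof -
  interpret V: vectorspace K V by fact
  interpret W: vectorspace K "V\<lparr>carrier := W\<rparr>" by (rule V.subspace_is_vs[OF assms(3)])
  have sub: "submodule K W V" using assms(3) by simp
  have W: "W \<subseteq> carrier V" using sub by (simp add: submodule_def)
  have "\<exists>S. finite S \<and> maximal S (\<lambda>S. S \<subseteq> carrier (V\<lparr>carrier := W\<rparr>) \<and> W.lin_indpt S)"
  proof (rule maximal_exists[where N = "V.dim" and B = "{}"])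
    fix S assume S: "S \<subseteq> carrier (V\<lparr>carrier := W\<rparr>) \<and> W.lin_indpt S"
    then have "V.lin_indpt S" using V.span_li_not_depend(2)[OF _ sub, of S] by simp
    then show "finite S \<and> card S \<le> V.dim" using V.li_le_dim[OF assms(2), of S] S W by auto
  next
    show "{} \<subseteq> carrier (V\<lparr>carrier := W\<rparr>) \<and> W.lin_indpt {}"
      using W.finite_lin_indpt2[of "{}"] by auto
  qed
  then show ?thesis using W.max_li_is_basis unfolding W.fin_dim_def W.basis_def by blast
qed

lemma linear_iso_dim:
  assumes V: "vectorspace K V" and W: "vectorspace K W" and T: "T \<in> module_hom K V W"
    and bij: "bij_betw T (carrier V) (carrier W)" and fd: "vectorspace.fin_dim K V"
  shows "vectorspace.fin_dim K W" "vectorspace.dim K W = vectorspace.dim K V"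
proof -
  interpret linear_map K V W T by (rule linear_mapI[OF V W T])
  have "T ` carrier V = carrier W" "inj_on T (carrier V)" using bij by (auto simp: bij_betw_def)
  then show "vectorspace.fin_dim K W" "vectorspace.dim K W = vectorspace.dim K V"
    using surj_fin_dim fd dim_eq by auto
qed

lemma (in linear_map) dim_surj:
  assumes "V.fin_dim" "T ` carrier V = carrier W"
  shows "V.dim = W.dim + vectorspace.dim K (V.vs kerT)"
  using rank_nullity[OF assms(1)] surj_imp_imT_carrier[OF assms(2)] by simp

text \<open>Generators of the kernel together with preimages of generators of \<open>W\<close>
  generate \<open>V\<close>. Rank-nullity presupposes that the source has finite dimension; this
  lemma supplies it.\<close>

lemma (in linear_map) fin_dim_extension:
  assumes fdW: "W.fin_dim" and fdk: "vectorspace.fin_dim K (V.vs kerT)"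
    and surj: "T ` carrier V = carrier W"
  shows "V.fin_dim"
proof -
  interpret Ker: vectorspace K "V.vs kerT" by (rule V.subspace_is_vs[OF kerT_is_subspace])
  obtain A where A: "finite A" "A \<subseteq> kerT" "Ker.span A = kerT"
    using fdk unfolding Ker.fin_dim_def by auto
  obtain B where B: "finite B" "B \<subseteq> carrier W" "W.module.span B = carrier W"
    using fdW unfolding W.fin_dim_def by auto
  have "\<exists>v\<in>carrier V. T v = b" if "b \<in> B" for b
  proof -
    have "b \<in> T ` carrier V" using that B(2) unfolding surj by blast
    then show ?thesis by force
  qed
  then obtain s where s: "\<And>b. b \<in> B \<Longrightarrow> s b \<in> carrier V \<and> T (s b) = b" by metis
  let ?G = "A \<union> s ` B"
  have kerV: "kerT \<subseteq> carrier V" by (auto simp: ker_def)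
  have G: "?G \<subseteq> carrier V" using A(2) kerV s by auto
  have sub: "submodule K (V.module.span ?G) V" by (rule V.module.span_is_submodule[OF G])
  have subW: "submodule K (T ` V.module.span ?G) W"
  proof -
    interpret S: submodule K "V.module.span ?G" V by (rule sub)
    have in_car: "\<And>x. x \<in> V.module.span ?G \<Longrightarrow> x \<in> carrier V" using S.subset by blast
    show ?thesis
    proof (rule submodule.intro)
      show "module K W" by (rule W.module.module_axioms)
      show "T ` V.module.span ?G \<subseteq> carrier W" using in_car by auto
      show "\<zero>\<^bsub>W\<^esub> \<in> T ` V.module.span ?G" using S.zero_closed T0_is_0 by (metis imageI)
    next
      fix v w assume "v \<in> T ` V.module.span ?G" "w \<in> T ` V.module.span ?G"
      then show "v \<oplus>\<^bsub>W\<^esub> w \<in> T ` V.module.span ?G"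
        using S.m_closed in_car by (auto intro!: image_eqI[where f = T, OF T_add[symmetric]])
    next
      fix c v assume "c \<in> carrier K" "v \<in> T ` V.module.span ?G"
      then show "c \<odot>\<^bsub>W\<^esub> v \<in> T ` V.module.span ?G"
        using S.smult_closed in_car by (auto intro!: image_eqI[where f = T, OF T_smult[symmetric]])
    qed
  qed
  have "B \<subseteq> T ` V.module.span ?G"
  proof
    fix b assume b: "b \<in> B"
    then have "s b \<in> V.module.span ?G" using V.module.in_own_span[OF G] by blast
    then show "b \<in> T ` V.module.span ?G" using s[OF b] by force
  qed
  \<comment> \<open>The image of the span is a submodule containing the generators \<open>B\<close>.
    So every \<open>v\<close> agrees with an element of the span up to the kernel, which is also
    spanned.\<close>
  then have im: "carrier W \<subseteq> T ` V.module.span ?G" using W.module.span_is_subset[OF _ subW, of B] B(3) by blast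
  have kerU: "kerT \<subseteq> V.module.span ?G"
    using A V.module.span_li_not_depend(1)[OF A(2) V.is_module[OF kerT_is_subspace]]
      V.module.span_is_monotone[of A ?G] by auto
  have "carrier V \<subseteq> V.module.span ?G"
  proof
    fix v assume v: "v \<in> carrier V"
    then have "T v \<in> T ` V.module.span ?G" using im by (meson T_im subsetD)
    then obtain u where u: "u \<in> V.module.span ?G" "T u = T v" by force
    have uV: "u \<in> carrier V" using u(1) G by (rule V.span_closed[rotated])
    have "v \<ominus>\<^bsub>V\<^esub> u \<in> kerT" using u(2) v uV by (simp add: ker_def W.module.M.r_neg W.module.M.minus_eq)
    then have "v \<ominus>\<^bsub>V\<^esub> u \<in> V.module.span ?G" using kerU by blast
    then have "(v \<ominus>\<^bsub>V\<^esub> u) \<oplus>\<^bsub>V\<^esub> u \<in> V.module.span ?G" using u(1) sub by (simp add: submodule_def)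
    then show "v \<in> V.module.span ?G" using v uV by (simp add: V.module.M.minus_eq V.module.M.a_assoc V.module.M.l_neg)
  qed
  then have "V.module.span ?G = carrier V" using V.module.span_is_subset2[OF G] by auto
  then show ?thesis unfolding V.fin_dim_def using A(1) B(1) G
    by (intro exI[of _ ?G]) simp
qed

text \<open>The encoding of \<open>dsum_module\<close> without the action: elements are extensional
  on \<open>S\<close>, so that equal families are equal functions. It serves for Hom spaces of
  direct sums and for the degree 0 term of the Hom complex.\<close>

definition vprod :: "'i set \<Rightarrow> ('i \<Rightarrow> ('k, 'm, 'z) module_scheme) \<Rightarrow> ('k, 'i \<Rightarrow> 'm) module" where
  "vprod S V =
    \<lparr>carrier = (\<Pi>\<^sub>E x\<in>S. carrier (V x)),
     mult = undefined, one = undefined,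
     zero = (\<lambda>x\<in>S. \<zero>\<^bsub>V x\<^esub>),
     add = (\<lambda>f g. \<lambda>x\<in>S. f x \<oplus>\<^bsub>V x\<^esub> g x),
     smult = (\<lambda>c f. \<lambda>x\<in>S. c \<odot>\<^bsub>V x\<^esub> f x)\<rparr>"

lemma vprod_vectorspace:
  assumes K: "field K" and V: "\<And>x. x \<in> S \<Longrightarrow> vectorspace K (V x)"
  shows "vectorspace K (vprod S V)"
proof -
  have m: "module K (V x)" if "x \<in> S" for x using V[OF that] by (simp add: vectorspace_def)
  have g: "abelian_group (V x)" if "x \<in> S" for x using m[OF that] by (simp add: module_def)
  note a = abelian_group.axioms(1)[OF g] abelian_monoid.a_closed abelian_monoid.a_assoc abelian_monoid.a_comm
    abelian_monoid.zero_closed abelian_monoid.r_zero abelian_group.r_neg abelian_group.a_inv_closed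
  show ?thesis
  proof (rule vs_criteria[OF K], goal_cases)
    case 3
    show ?case
    proof
      fix v assume v: "v \<in> carrier (vprod S V)"
      show "\<exists>w\<in>carrier (vprod S V). v \<oplus>\<^bsub>vprod S V\<^esub> w = \<zero>\<^bsub>vprod S V\<^esub>"
        by (rule bexI[of _ "\<lambda>x\<in>S. \<ominus>\<^bsub>V x\<^esub> v x"])
          (use v in \<open>auto simp: vprod_def PiE_iff abelian_group.r_neg[OF g]
            abelian_group.a_inv_closed[OF g] intro!: restrict_ext\<close>)
    qed
  qed (auto simp: vprod_def PiE_iff extensional_def fun_eq_iff
      abelian_monoid.a_closed[OF abelian_group.axioms(1)[OF g]]
      abelian_monoid.a_assoc[OF abelian_group.axioms(1)[OF g]]
      abelian_monoid.r_zero[OF abelian_group.axioms(1)[OF g]]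
      abelian_monoid.zero_closed[OF abelian_group.axioms(1)[OF g]]
      module.smult_closed[OF m] module.smult_assoc1[OF m] module.smult_one[OF m]
      module.smult_l_distr[OF m] module.smult_r_distr[OF m]
      intro: abelian_monoid.a_comm[OF abelian_group.axioms(1)[OF g]])
qed

text \<open>Induction over \<open>S\<close>: evaluation at the new index \<open>x\<close> is onto
  \<open>V x\<close>, and its kernel is a copy of the product over the remaining indices.\<close>

lemma vprod_dim:
  assumes K: "field K" and "finite S" and "\<And>x. x \<in> S \<Longrightarrow> vectorspace K (V x)"
    and "\<And>x. x \<in> S \<Longrightarrow> vectorspace.fin_dim K (V x)"
  shows "vectorspace.fin_dim K (vprod S V) \<and>
    vectorspace.dim K (vprod S V) = (\<Sum>x\<in>S. vectorspace.dim K (V x))"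
  using assms(2-)
proof (induction S rule: finite_induct)
  case empty
  interpret E: vectorspace K "vprod {} V" by (rule vprod_vectorspace[OF K]) auto
  have c: "carrier (vprod {} V) = {\<zero>\<^bsub>vprod {} V\<^esub>}" by (simp add: vprod_def restrict_def)
  have "E.span {\<zero>\<^bsub>vprod {} V\<^esub>} = carrier (vprod {} V)"
    using E.span_is_subset2[of "{\<zero>\<^bsub>vprod {} V\<^esub>}"] E.in_own_span[of "{\<zero>\<^bsub>vprod {} V\<^esub>}"] c by auto
  then show ?case using E.dim0I E.fin_dim_def c
    by (metis finite.emptyI finite.insertI subset_refl sum.empty)
next
  case (insert x S)
  let ?P = "vprod (insert x S) V" and ?T = "\<lambda>f. f x"
  have V: "vectorspace K (V y)" if "y \<in> insert x S" for y using insert.prems that by blast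
  have m: "module K (V y)" if "y \<in> insert x S" for y using V[OF that] by (simp add: vectorspace_def)
  have g: "abelian_group (V y)" if "y \<in> insert x S" for y using m[OF that] by (simp add: module_def)
  have z: "\<zero>\<^bsub>V y\<^esub> \<in> carrier (V y)" if "y \<in> insert x S" for y
    using g[OF that] by (simp add: abelian_groupE(2))
  interpret Vx: vectorspace K "V x" using V by blast
  interpret L: linear_map K ?P "V x" ?T
    by (rule linear_mapI) (use V vprod_vectorspace[OF K, of "insert x S" V] in \<open>auto simp: module_hom_def vprod_def\<close>)
  have IH: "vectorspace.fin_dim K (vprod S V)"
    "vectorspace.dim K (vprod S V) = (\<Sum>y\<in>S. vectorspace.dim K (V y))"
    using insert by auto
  have surj: "?T ` carrier ?P = carrier (V x)"
  proof -
    have "\<exists>f\<in>carrier ?P. f x = v" if "v \<in> carrier (V x)" for v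
      by (rule bexI[of _ "\<lambda>y\<in>insert x S. if y = x then v else \<zero>\<^bsub>V y\<^esub>"])
        (use z that in \<open>auto simp: vprod_def\<close>)
    then have "carrier (V x) \<subseteq> ?T ` carrier ?P" by blast
    moreover have "?T ` carrier ?P \<subseteq> carrier (V x)" by (auto simp: vprod_def)
    ultimately show ?thesis by blast
  qed
  have ker: "L.kerT = {f \<in> carrier ?P. f x = \<zero>\<^bsub>V x\<^esub>}" by (rule L.ker_def)
  let ?Ker = "?P\<lparr>carrier := {f \<in> carrier ?P. f x = \<zero>\<^bsub>V x\<^esub>}\<rparr>"
  have kv: "vectorspace K ?Ker" unfolding ker[symmetric] by (rule L.V.subspace_is_vs[OF L.kerT_is_subspace])
  \<comment> \<open>The kernel of evaluation consists of functions extensional on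
    \<open>insert x S\<close>, so it is only isomorphic to \<open>vprod S V\<close>;
    \<open>?U\<close> fills in the missing value.\<close>
  let ?U = "\<lambda>f. f(x := \<zero>\<^bsub>V x\<^esub>)"
  have vS: "vectorspace K (vprod S V)" by (rule vprod_vectorspace[OF K]) (use V in auto)
  have U: "?U \<in> module_hom K (vprod S V) ?Ker"
    using insert.hyps Vx.module.M.r_zero
    by (auto simp: module_hom_def vprod_def PiE_iff extensional_def fun_eq_iff)
  have bij: "bij_betw ?U (carrier (vprod S V)) (carrier ?Ker)"
  proof (rule bij_betw_byWitness[where f' = "\<lambda>f. restrict f S"])
    show "\<forall>a\<in>carrier (vprod S V). restrict (?U a) S = a"
      using insert.hyps by (auto simp: vprod_def PiE_iff extensional_def fun_eq_iff)
    show "\<forall>a'\<in>carrier ?Ker. ?U (restrict a' S) = a'"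
      by (auto simp: vprod_def PiE_iff extensional_def fun_eq_iff)
    show "?U ` carrier (vprod S V) \<subseteq> carrier ?Ker"
      using U by (auto simp: module_hom_def)
    show "(\<lambda>f. restrict f S) ` carrier ?Ker \<subseteq> carrier (vprod S V)"
      by (auto simp: vprod_def)
  qed
  note iso = linear_iso_dim[OF vS kv U bij IH(1)]
  have fd: "L.V.fin_dim" by (rule L.fin_dim_extension[OF _ iso(1)[folded ker] surj]) (use insert.prems in blast)
  show ?case using L.dim_surj[OF fd surj] fd iso(2) IH(2) insert.hyps by (simp add: ker)
qed

text \<open>The maps \<open>f\<close> and \<open>g\<close> form a complex that is exact at both
  ends, and \<open>h\<close> presents \<open>W\<close> as its middle cohomology. Rank-nullity is
  applied to \<open>g\<close>, to \<open>h\<close> and to \<open>f\<close>. That \<open>f\<close>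
  lands in the kernel of \<open>g\<close> is part of \<open>hker\<close>.\<close>

lemma dim_middle_cohomology:
  assumes f: "linear_map K V1 V2 f" and g: "linear_map K V2 V3 g"
    and fd1: "vectorspace.fin_dim K V1" and fd2: "vectorspace.fin_dim K V2"
    and inj: "inj_on f (carrier V1)" and surj: "g ` carrier V2 = carrier V3"
    and h: "linear_map K (V2\<lparr>carrier := {v \<in> carrier V2. g v = \<zero>\<^bsub>V3\<^esub>}\<rparr>) W h"
    and hsurj: "h ` {v \<in> carrier V2. g v = \<zero>\<^bsub>V3\<^esub>} = carrier W"
    and hker: "{v \<in> carrier V2. g v = \<zero>\<^bsub>V3\<^esub> \<and> h v = \<zero>\<^bsub>W\<^esub>} = f ` carrier V1"
  shows "int (vectorspace.dim K W) =
    int (vectorspace.dim K V2) - int (vectorspace.dim K V3) - int (vectorspace.dim K V1)"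
proof -
  interpret F: linear_map K V1 V2 f by fact
  interpret G: linear_map K V2 V3 g by fact
  let ?Z = "V2\<lparr>carrier := {v \<in> carrier V2. g v = \<zero>\<^bsub>V3\<^esub>}\<rparr>"
  interpret H: linear_map K ?Z W h by fact
  have Z: "?Z = V2\<lparr>carrier := G.kerT\<rparr>" by (simp add: G.ker_def)
  have fdZ: "vectorspace.fin_dim K ?Z"
    unfolding Z by (rule fin_dim_subspace[OF F.W.vectorspace_axioms fd2 G.kerT_is_subspace])
  have "vectorspace.dim K V2 = vectorspace.dim K V3 + vectorspace.dim K ?Z" unfolding Z by (rule G.dim_surj[OF fd2 surj])
  moreover have "vectorspace.dim K ?Z = vectorspace.dim K W + vectorspace.dim K (V2\<lparr>carrier := f ` carrier V1\<rparr>)"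
    using H.dim_surj[OF fdZ] hsurj hker by (simp add: H.ker_def conj_assoc)
  moreover have "vectorspace.dim K (V2\<lparr>carrier := f ` carrier V1\<rparr>) = vectorspace.dim K V1"
    using F.rank_nullity[OF fd1] F.inj_imp_dim_ker0[OF inj] by (simp add: F.im_def)
  ultimately show ?thesis by simp
qed

section \<open>Homomorphisms of right modules\<close>

lemma field_scalars: "field (scalars :: 'k::field ring)"
proof (intro cring.cring_fieldI)
  show "cring (scalars :: 'k ring)"
    by (intro cringI abelian_groupI comm_monoidI)
      (auto simp: algebra_simps intro: exI[of _ "- x" for x])
  show "Units (scalars :: 'k ring) = carrier (scalars :: 'k ring) - {\<zero>\<^bsub>(scalars :: 'k ring)\<^esub>}"
    by (auto simp: Units_def) (metis mult.commute right_inverse)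
qed

text \<open>Meant for the zero space, which occurs as the kernel of an injective map.\<close>

lemma fin_dim_finite_carrier:
  assumes "vectorspace K V" "finite (carrier V)"
  shows "vectorspace.fin_dim K V"
proof -
  interpret vectorspace K V by fact
  have "span (carrier V) = carrier V"
    using span_is_subset2[of "carrier V"] in_own_span[of "carrier V"] by blast
  then show ?thesis unfolding fin_dim_def using assms(2) by blast
qed

context right_module
begin

lemma abelian_group: "abelian_group M"
  using module_axioms by (simp add: module_def)

lemmas add_closed = abelian_monoid.a_closed[OF abelian_group.axioms(1)[OF abelian_group]]
lemmas zero_mem = abelian_monoid.zero_closed[OF abelian_group.axioms(1)[OF abelian_group]]
lemmas neg_closed = abelian_group.a_inv_closed[OF abelian_group]
lemmas add_zero = abelian_monoid.r_zero[OF abelian_group.axioms(1)[OF abelian_group]]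
lemmas zero_add = abelian_monoid.l_zero[OF abelian_group.axioms(1)[OF abelian_group]]
lemmas add_neg = abelian_group.r_neg[OF abelian_group]
lemmas neg_add = abelian_group.l_neg[OF abelian_group]
lemmas neg_neg = abelian_group.minus_minus[OF abelian_group]
lemmas neg_sum = abelian_group.minus_add[OF abelian_group]
lemmas add_assoc = abelian_monoid.a_assoc[OF abelian_group.axioms(1)[OF abelian_group]]
lemmas add_commute = abelian_monoid.a_comm[OF abelian_group.axioms(1)[OF abelian_group]]
lemmas add_lcomm = abelian_monoid.a_lcomm[OF abelian_group.axioms(1)[OF abelian_group]]
lemma neg_zero: "\<ominus>\<^bsub>M\<^esub> \<zero>\<^bsub>M\<^esub> = \<zero>\<^bsub>M\<^esub>"
  by (rule abelian_group.minus_equality[OF abelian_group]) (simp_all add: zero_mem add_zero)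

lemmas add_neg2 = abelian_group.r_neg2[OF abelian_group]

lemma scale_closed: "x \<in> carrier M \<Longrightarrow> c \<odot>\<^bsub>M\<^esub> x \<in> carrier M"
  using smult_closed[of c x] by simp

lemma scale_zero: "c \<odot>\<^bsub>M\<^esub> \<zero>\<^bsub>M\<^esub> = \<zero>\<^bsub>M\<^esub>"
  using smult_r_null[of c] by simp

lemma scale_add: "x \<in> carrier M \<Longrightarrow> y \<in> carrier M \<Longrightarrow> c \<odot>\<^bsub>M\<^esub> (x \<oplus>\<^bsub>M\<^esub> y) = c \<odot>\<^bsub>M\<^esub> x \<oplus>\<^bsub>M\<^esub> c \<odot>\<^bsub>M\<^esub> y"
  using smult_r_distr[of c x y] by simp

lemma add_scale: "x \<in> carrier M \<Longrightarrow> (c + d) \<odot>\<^bsub>M\<^esub> x = c \<odot>\<^bsub>M\<^esub> x \<oplus>\<^bsub>M\<^esub> d \<odot>\<^bsub>M\<^esub> x"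
  using smult_l_distr[of c d x] by simp

lemma scale_scale: "x \<in> carrier M \<Longrightarrow> (c * d) \<odot>\<^bsub>M\<^esub> x = c \<odot>\<^bsub>M\<^esub> (d \<odot>\<^bsub>M\<^esub> x)"
  using smult_assoc1[of c d x] by simp

lemma one_scale: "x \<in> carrier M \<Longrightarrow> 1 \<odot>\<^bsub>M\<^esub> x = x"
  using smult_one[of x] by simp

lemma scale_neg: "x \<in> carrier M \<Longrightarrow> c \<odot>\<^bsub>M\<^esub> (\<ominus>\<^bsub>M\<^esub> x) = \<ominus>\<^bsub>M\<^esub> (c \<odot>\<^bsub>M\<^esub> x)"
  using smult_r_minus[of c x] by simp

lemma ract_zero: "a \<in> carrier A \<Longrightarrow> ract M \<zero>\<^bsub>M\<^esub> a = \<zero>\<^bsub>M\<^esub>"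
  using ract_smult_left[of "\<zero>\<^bsub>M\<^esub>" a 0] smult_l_null[of "\<zero>\<^bsub>M\<^esub>"]
    smult_l_null[of "ract M \<zero>\<^bsub>M\<^esub> a"] zero_mem ract_closed by simp

lemma ract_neg:
  assumes "x \<in> carrier M" "a \<in> carrier A"
  shows "ract M (\<ominus>\<^bsub>M\<^esub> x) a = \<ominus>\<^bsub>M\<^esub> (ract M x a)"
proof -
  have "ract M (\<ominus>\<^bsub>M\<^esub> x) a \<oplus>\<^bsub>M\<^esub> ract M x a = \<zero>\<^bsub>M\<^esub>"
    using assms by (simp add: ract_add_left[symmetric] neg_closed neg_add ract_zero)
  then show ?thesis
    using abelian_group.minus_equality[OF abelian_group] assms by (simp add: ract_closed neg_closed)
qed

end

section \<open>Module homomorphisms and the vector space they form\<close>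

lemma rhom_iff:
  "f \<in> rhom A M N \<longleftrightarrow>
    (\<forall>x\<in>carrier M. f x \<in> carrier N) \<and>
    (\<forall>x\<in>carrier M. \<forall>y\<in>carrier M. f (x \<oplus>\<^bsub>M\<^esub> y) = f x \<oplus>\<^bsub>N\<^esub> f y) \<and>
    (\<forall>c. \<forall>x\<in>carrier M. f (c \<odot>\<^bsub>M\<^esub> x) = c \<odot>\<^bsub>N\<^esub> f x) \<and>
    (\<forall>x\<in>carrier M. \<forall>a\<in>carrier A. f (ract M x a) = ract N (f x) a)"
  by (auto simp: rhom_def module_hom_def)

lemma rhom_closed: "f \<in> rhom A M N \<Longrightarrow> x \<in> carrier M \<Longrightarrow> f x \<in> carrier N"
  and rhom_add: "f \<in> rhom A M N \<Longrightarrow> x \<in> carrier M \<Longrightarrow> y \<in> carrier M \<Longrightarrow> f (x \<oplus>\<^bsub>M\<^esub> y) = f x \<oplus>\<^bsub>N\<^esub> f y"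
  and rhom_scale: "f \<in> rhom A M N \<Longrightarrow> x \<in> carrier M \<Longrightarrow> f (c \<odot>\<^bsub>M\<^esub> x) = c \<odot>\<^bsub>N\<^esub> f x"
  and rhom_ract: "f \<in> rhom A M N \<Longrightarrow> x \<in> carrier M \<Longrightarrow> a \<in> carrier A \<Longrightarrow> f (ract M x a) = ract N (f x) a"
  by (simp_all add: rhom_iff)

lemma rhom_zero:
  assumes "right_module A M" "right_module A N" "f \<in> rhom A M N"
  shows "f \<zero>\<^bsub>M\<^esub> = \<zero>\<^bsub>N\<^esub>"
proof -
  interpret M: right_module A M by fact
  interpret N: right_module A N by fact
  have "f \<zero>\<^bsub>M\<^esub> = f (0 \<odot>\<^bsub>M\<^esub> \<zero>\<^bsub>M\<^esub>)" by (simp add: M.scale_zero)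
  also have "\<dots> = 0 \<odot>\<^bsub>N\<^esub> f \<zero>\<^bsub>M\<^esub>" using assms(3) M.zero_mem by (rule rhom_scale)
  also have "\<dots> = \<zero>\<^bsub>N\<^esub>" using N.smult_l_null[of "f \<zero>\<^bsub>M\<^esub>"] rhom_closed[OF assms(3) M.zero_mem] by simp
  finally show ?thesis .
qed

lemma rhom_neg:
  assumes "right_module A M" "right_module A N" "f \<in> rhom A M N" "x \<in> carrier M"
  shows "f (\<ominus>\<^bsub>M\<^esub> x) = \<ominus>\<^bsub>N\<^esub> (f x)"
proof -
  interpret M: right_module A M by fact
  interpret N: right_module A N by fact
  have "f (\<ominus>\<^bsub>M\<^esub> x) \<oplus>\<^bsub>N\<^esub> f x = \<zero>\<^bsub>N\<^esub>"
    using assms rhom_zero[OF assms(1-3)] by (simp add: rhom_add[symmetric] M.neg_closed M.neg_add)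
  then show ?thesis
    using abelian_group.minus_equality[OF N.abelian_group] assms
    by (simp add: rhom_closed M.neg_closed)
qed

lemma rhom_comp:
  "f \<in> rhom A M N \<Longrightarrow> g \<in> rhom A N P \<Longrightarrow> (\<lambda>x. g (f x)) \<in> rhom A M P"
  by (simp add: rhom_iff)

lemma rhom_id: "(\<lambda>x. x) \<in> rhom A M M"
  by (simp add: rhom_iff)

lemma rhom_cong:
  assumes "right_module A M" "f \<in> rhom A M N" "\<And>x. x \<in> carrier M \<Longrightarrow> g x = f x"
  shows "g \<in> rhom A M N"
proof -
  interpret M: right_module A M by fact
  show ?thesis using assms(2,3)
    by (simp add: rhom_iff M.add_closed M.scale_closed M.ract_closed)
qed

lemma rhom_sum:
  assumes "right_module A N" "f \<in> rhom A M N" "g \<in> rhom A M N"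
  shows "(\<lambda>x. f x \<oplus>\<^bsub>N\<^esub> g x) \<in> rhom A M N"
proof -
  interpret N: right_module A N by fact
  show ?thesis using assms(2,3)
    by (auto simp: rhom_iff N.add_closed N.scale_add N.ract_add_left N.add_assoc N.add_lcomm)
qed

lemma rhom_smult:
  assumes "right_module A N" "f \<in> rhom A M N"
  shows "(\<lambda>x. c \<odot>\<^bsub>N\<^esub> f x) \<in> rhom A M N"
proof -
  interpret N: right_module A N by fact
  show ?thesis using assms(2)
    by (auto simp: rhom_iff N.scale_closed N.scale_add N.ract_smult_left N.scale_scale[symmetric] mult.commute)
qed

lemma rhom_uminus:
  assumes "right_module A N" "f \<in> rhom A M N"
  shows "(\<lambda>x. \<ominus>\<^bsub>N\<^esub> f x) \<in> rhom A M N"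
proof -
  interpret N: right_module A N by fact
  show ?thesis using assms(2)
    by (auto simp: rhom_iff N.neg_closed N.neg_sum N.scale_neg N.ract_neg)
qed

lemma rhom_zero_map:
  assumes "right_module A N"
  shows "(\<lambda>x. \<zero>\<^bsub>N\<^esub>) \<in> rhom A M N"
proof -
  interpret N: right_module A N by fact
  show ?thesis by (auto simp: rhom_iff N.zero_mem N.add_zero N.scale_zero N.ract_zero)
qed

lemma rhom_restrict:
  assumes "right_module A M" "f \<in> rhom A M N"
  shows "restrict f (carrier M) \<in> rhom A M N"
  by (rule rhom_cong[OF assms]) simp

lemma hom_space_simps [simp]:
  "carrier (hom_space A M N) = rhom A M N \<inter> extensional (carrier M)"
  "zero (hom_space A M N) = (\<lambda>x\<in>carrier M. \<zero>\<^bsub>N\<^esub>)"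
  "add (hom_space A M N) = (\<lambda>f g. \<lambda>x\<in>carrier M. f x \<oplus>\<^bsub>N\<^esub> g x)"
  "smult (hom_space A M N) = (\<lambda>c f. \<lambda>x\<in>carrier M. c \<odot>\<^bsub>N\<^esub> f x)"
  by (simp_all add: hom_space_def)

lemma hom_space_vectorspace:
  assumes M: "right_module A M" and N: "right_module A N"
  shows "vectorspace scalars (hom_space A M N)"
proof -
  interpret M: right_module A M by fact
  interpret N: right_module A N by fact
  show ?thesis
  proof (rule vs_criteria[OF field_scalars], goal_cases)
    case 3
    show ?case
    proof
      fix f assume f: "f \<in> carrier (hom_space A M N)"
      show "\<exists>g\<in>carrier (hom_space A M N). f \<oplus>\<^bsub>hom_space A M N\<^esub> g = \<zero>\<^bsub>hom_space A M N\<^esub>"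
        by (rule bexI[of _ "\<lambda>x\<in>carrier M. \<ominus>\<^bsub>N\<^esub> f x"])
          (use f in \<open>auto simp: rhom_closed N.add_neg intro!: restrict_ext rhom_restrict[OF M] rhom_uminus[OF N]\<close>)
    qed
  qed (auto simp: fun_eq_iff extensional_def rhom_closed N.add_closed N.zero_mem N.add_zero N.add_assoc N.scale_closed N.scale_scale
      N.one_scale N.add_scale N.scale_add
      intro!: rhom_restrict[OF M] rhom_sum[OF N] rhom_zero_map[OF N] rhom_smult[OF N] N.add_commute)
qed

section \<open>Finite direct sums\<close>

lemma dsum_module_simps [simp]:
  "carrier (dsum_module S P) = (\<Pi>\<^sub>E x\<in>S. carrier (P x))"
  "zero (dsum_module S P) = (\<lambda>x\<in>S. \<zero>\<^bsub>P x\<^esub>)"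
  "add (dsum_module S P) = (\<lambda>f g. \<lambda>x\<in>S. f x \<oplus>\<^bsub>P x\<^esub> g x)"
  "smult (dsum_module S P) = (\<lambda>c f. \<lambda>x\<in>S. c \<odot>\<^bsub>P x\<^esub> f x)"
  "ract (dsum_module S P) = (\<lambda>f a. \<lambda>x\<in>S. ract (P x) (f x) a)"
  by (simp_all add: dsum_module_def)

definition dsum_inj :: "'i set \<Rightarrow> ('i \<Rightarrow> ('k, 'a, 'm) rmod) \<Rightarrow> 'i \<Rightarrow> 'm \<Rightarrow> 'i \<Rightarrow> 'm" where
  "dsum_inj S P x p = (\<lambda>y\<in>S. if y = x then p else \<zero>\<^bsub>P y\<^esub>)"

lemma proj_rhom: "x \<in> S \<Longrightarrow> (\<lambda>p. p x) \<in> rhom A (dsum_module S P) (P x)"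
  by (auto simp: rhom_iff)

lemma dsum_inj_rhom:
  assumes "\<And>x. x \<in> S \<Longrightarrow> right_module A (P x)"
  shows "dsum_inj S P x \<in> rhom A (P x) (dsum_module S P)"
proof -
  note r = right_module.add_zero[OF assms] right_module.zero_mem[OF assms]
    right_module.scale_zero[OF assms] right_module.ract_zero[OF assms]
  show ?thesis by (auto simp: rhom_iff dsum_inj_def r fun_eq_iff)
qed

text \<open>Coordinates are switched on one at a time: \<open>F\<close> in the proof is the set of
  those already equal to the ones of \<open>p\<close>, all others being zero.\<close>

lemma dsum_induct:
  assumes S: "finite S" and P: "\<And>x. x \<in> S \<Longrightarrow> right_module A (P x)"
    and p: "p \<in> carrier (dsum_module S P)"
    and zero: "Q \<zero>\<^bsub>dsum_module S P\<^esub>"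
    and inj: "\<And>x p. x \<in> S \<Longrightarrow> p \<in> carrier (P x) \<Longrightarrow> Q (dsum_inj S P x p)"
    and add: "\<And>p q. p \<in> carrier (dsum_module S P) \<Longrightarrow> q \<in> carrier (dsum_module S P) \<Longrightarrow>
      Q p \<Longrightarrow> Q q \<Longrightarrow> Q (p \<oplus>\<^bsub>dsum_module S P\<^esub> q)"
  shows "Q p"
proof -
  note r = right_module.add_zero[OF P] right_module.zero_add[OF P] right_module.zero_mem[OF P]
  have "F \<subseteq> S \<Longrightarrow> Q (\<lambda>y\<in>S. if y \<in> F then p y else \<zero>\<^bsub>P y\<^esub>)" if "finite F" for F
    using that
  proof (induction F rule: finite_induct)
    case empty
    then show ?case using zero by (simp add: restrict_def)
  next
    case (insert x F)
    let ?q = "\<lambda>y\<in>S. if y \<in> F then p y else \<zero>\<^bsub>P y\<^esub>"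
    have x: "x \<in> S" "p x \<in> carrier (P x)" using insert p by auto
    have q: "?q \<in> carrier (dsum_module S P)" using insert p by (auto simp: r)
    have Qq: "Q ?q" using insert by blast
    have "Q (dsum_inj S P x (p x) \<oplus>\<^bsub>dsum_module S P\<^esub> ?q)"
      by (intro add inj q x Qq) (use x in \<open>auto simp: dsum_inj_def r\<close>)
    moreover have "dsum_inj S P x (p x) \<oplus>\<^bsub>dsum_module S P\<^esub> ?q = (\<lambda>y\<in>S. if y \<in> insert x F then p y else \<zero>\<^bsub>P y\<^esub>)"
      using insert p x by (auto simp: dsum_inj_def r fun_eq_iff PiE_iff)
    ultimately show ?case by (rule subst[rotated])
  qed
  from this[OF S] have "Q (\<lambda>y\<in>S. if y \<in> S then p y else \<zero>\<^bsub>P y\<^esub>)" by blast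
  moreover have "(\<lambda>y\<in>S. if y \<in> S then p y else \<zero>\<^bsub>P y\<^esub>) = p"
    using p by (auto simp: fun_eq_iff PiE_iff extensional_def)
  ultimately show ?thesis by (rule subst[rotated])
qed

lemma dsum_right_module:
  assumes P: "\<And>x. x \<in> S \<Longrightarrow> right_module A (P x)"
  shows "right_module A (dsum_module S P)"
proof -
  note rm = right_module.add_closed[OF P] right_module.zero_mem[OF P] right_module.add_zero[OF P]
    right_module.add_assoc[OF P] right_module.scale_closed[OF P]
    right_module.scale_scale[OF P] right_module.one_scale[OF P]
    right_module.add_scale[OF P] right_module.scale_add[OF P]
  note rm' = right_module.ract_closed[OF P] right_module.ract_add_left[OF P] right_module.ract_add_right[OF P]
    right_module.ract_smult_left[OF P] right_module.ract_smult_right[OF P] right_module.ract_mult[OF P] right_module.ract_one[OF P]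
  have "vectorspace scalars (dsum_module S P)"
  proof (rule vs_criteria[OF field_scalars], goal_cases)
    case 3
    show ?case
    proof
      fix f assume f: "f \<in> carrier (dsum_module S P)"
      show "\<exists>g\<in>carrier (dsum_module S P). f \<oplus>\<^bsub>dsum_module S P\<^esub> g = \<zero>\<^bsub>dsum_module S P\<^esub>"
        by (rule bexI[of _ "\<lambda>x\<in>S. \<ominus>\<^bsub>P x\<^esub> f x"])
          (use f in \<open>auto simp: PiE_iff right_module.add_neg[OF P] right_module.neg_closed[OF P] intro!: restrict_ext\<close>)
    qed
  qed (auto simp: PiE_iff fun_eq_iff extensional_def rm intro: right_module.add_commute[OF P])
  moreover have "right_module_axioms A (dsum_module S P)"
    by unfold_locales (auto simp: PiE_iff fun_eq_iff extensional_def rm')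
  ultimately show ?thesis by (simp add: right_module_def)
qed

lemma rhom_dsum_eqI:
  assumes S: "finite S" and P: "\<And>x. x \<in> S \<Longrightarrow> right_module A (P x)" and N: "right_module A N"
    and f: "f \<in> rhom A (dsum_module S P) N" and g: "g \<in> rhom A (dsum_module S P) N"
    and eq: "\<And>x p. x \<in> S \<Longrightarrow> p \<in> carrier (P x) \<Longrightarrow> f (dsum_inj S P x p) = g (dsum_inj S P x p)"
    and p: "p \<in> carrier (dsum_module S P)"
  shows "f p = g p"
proof (rule dsum_induct[OF S P p])
  have D: "right_module A (dsum_module S P)" by (rule dsum_right_module) (rule P)
  show "f \<zero>\<^bsub>dsum_module S P\<^esub> = g \<zero>\<^bsub>dsum_module S P\<^esub>" using rhom_zero[OF D N f] rhom_zero[OF D N g] by simp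
next
  fix p q assume "p \<in> carrier (dsum_module S P)" "q \<in> carrier (dsum_module S P)" "f p = g p" "f q = g q"
  then show "f (p \<oplus>\<^bsub>dsum_module S P\<^esub> q) = g (p \<oplus>\<^bsub>dsum_module S P\<^esub> q)"
    using rhom_add[OF f] rhom_add[OF g] by metis
qed (auto intro: eq)

text \<open>Existence half of the universal property of a direct sum; \<open>rhom_dsum_eqI\<close>
  is the uniqueness half. The map is assembled by adding one composite \<open>f y (p y)\<close> at a
  time.\<close>

lemma rhom_dsum_extend:
  assumes S: "finite S" and P: "\<And>x. x \<in> S \<Longrightarrow> right_module A (P x)" and N: "right_module A N"
    and f: "\<And>x. x \<in> S \<Longrightarrow> f x \<in> rhom A (P x) N"
  shows "\<exists>g\<in>rhom A (dsum_module S P) N. \<forall>x\<in>S. \<forall>p\<in>carrier (P x). g (dsum_inj S P x p) = f x p"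
proof -
  interpret N: right_module A N by fact
  have "F \<subseteq> S \<Longrightarrow> \<exists>g \<in> rhom A (dsum_module S P) N. \<forall>x\<in>S. \<forall>p\<in>carrier (P x).
      g (dsum_inj S P x p) = (if x \<in> F then f x p else \<zero>\<^bsub>N\<^esub>)" if "finite F" for F
    using that
  proof (induction F rule: finite_induct)
    case empty
    show ?case by (rule bexI[OF _ rhom_zero_map[OF N]]) simp
  next
    case (insert y F)
    then obtain g where g: "g \<in> rhom A (dsum_module S P) N" and
      gi: "\<And>x p. x \<in> S \<Longrightarrow> p \<in> carrier (P x) \<Longrightarrow> g (dsum_inj S P x p) = (if x \<in> F then f x p else \<zero>\<^bsub>N\<^esub>)"
      by auto
    have y: "y \<in> S" using insert by simp
    have fy: "(\<lambda>p. f y (p y)) \<in> rhom A (dsum_module S P) N"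
      by (rule rhom_comp[where f = "\<lambda>p. p y" and g = "f y", OF proj_rhom[OF y, of A P] f[OF y]])
    show ?case
    proof (rule bexI[OF _ rhom_sum[OF N g fy]], intro ballI)
      fix x p assume x: "x \<in> S" and p: "p \<in> carrier (P x)"
      have "f y \<zero>\<^bsub>P y\<^esub> = \<zero>\<^bsub>N\<^esub>" by (rule rhom_zero[OF P[OF y] N f[OF y]])
      moreover have "f x p \<in> carrier N" using rhom_closed[OF f[OF x] p] .
      ultimately show "g (dsum_inj S P x p) \<oplus>\<^bsub>N\<^esub> f y (dsum_inj S P x p y) = (if x \<in> insert y F then f x p else \<zero>\<^bsub>N\<^esub>)"
        unfolding gi[OF x p] using insert.hyps y by (auto simp: dsum_inj_def N.zero_add N.add_zero N.zero_mem)
    qed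
  qed
  from this[OF S] show ?thesis by auto
qed

text \<open>Restriction along the injections identifies maps out of the sum with families of maps
  out of the summands.\<close>

lemma hom_space_dsum_source:
  fixes P :: "'i \<Rightarrow> ('k::field, 'a, 'm) rmod" and N :: "('k, 'a, 'n) rmod"
  assumes S: "finite S" and P: "\<And>x. x \<in> S \<Longrightarrow> right_module A (P x)" and N: "right_module A N"
    and fd: "\<And>x. x \<in> S \<Longrightarrow> vectorspace.fin_dim scalars (hom_space A (P x) N)"
  shows "vectorspace.fin_dim scalars (hom_space A (dsum_module S P) N)"
    and "vectorspace.dim scalars (hom_space A (dsum_module S P) N) =
      (\<Sum>x\<in>S. vectorspace.dim scalars (hom_space A (P x) N))"
proof -
  interpret N: right_module A N by fact
  let ?D = "dsum_module S P"
  have D: "right_module A ?D" by (rule dsum_right_module) (rule P)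
  interpret D: right_module A ?D by fact
  let ?V = "vprod S (\<lambda>x. hom_space A (P x) N)"
  have hV: "vectorspace scalars (hom_space A (P x) N)" if "x \<in> S" for x
    by (rule hom_space_vectorspace[OF P[OF that] N])
  have V: "vectorspace scalars ?V" by (rule vprod_vectorspace[OF field_scalars hV])
  have H: "vectorspace scalars (hom_space A ?D N)" by (rule hom_space_vectorspace[OF D N])
  define T where "T = (\<lambda>f :: ('i \<Rightarrow> 'm) \<Rightarrow> 'n. \<lambda>x\<in>S. \<lambda>p\<in>carrier (P x). f (dsum_inj S P x p))"
  have ic: "dsum_inj S P x p \<in> carrier ?D" if "p \<in> carrier (P x)" for x p
    using rhom_closed[OF dsum_inj_rhom[of S A P x, OF P] that] .
  have T: "T \<in> module_hom scalars (hom_space A ?D N) ?V"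
    unfolding module_hom_def
    using ic by (auto simp: T_def vprod_def fun_eq_iff simp del: dsum_module_simps
        intro!: rhom_restrict[OF P] rhom_comp[OF dsum_inj_rhom[OF P]])
  have inj: "inj_on T (carrier (hom_space A ?D N))"
  proof (rule inj_onI)
    fix f g assume f: "f \<in> carrier (hom_space A ?D N)" and g: "g \<in> carrier (hom_space A ?D N)" and eq: "T f = T g"
    have "f (dsum_inj S P x p) = g (dsum_inj S P x p)" if "x \<in> S" "p \<in> carrier (P x)" for x p
      using fun_cong[OF fun_cong[OF eq, of x], of p] that by (simp add: T_def)
    then have "f p = g p" if "p \<in> carrier ?D" for p
      using rhom_dsum_eqI[OF S P N _ _ _ that, of f g] f g by simp
    then show "f = g" using f g
      by (intro extensionalityI[of f "carrier ?D" g]) (auto simp del: dsum_module_simps)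
  qed
  have surj: "T ` carrier (hom_space A ?D N) = carrier ?V"
  proof
    show "T ` carrier (hom_space A ?D N) \<subseteq> carrier ?V" using T by (auto simp: module_hom_def)
    show "carrier ?V \<subseteq> T ` carrier (hom_space A ?D N)"
    proof
      fix f assume f: "f \<in> carrier ?V"
      then have fr: "f x \<in> rhom A (P x) N" if "x \<in> S" for x using that by (auto simp: vprod_def PiE_iff)
      obtain g where g: "g \<in> rhom A ?D N" "\<And>x p. x \<in> S \<Longrightarrow> p \<in> carrier (P x) \<Longrightarrow> g (dsum_inj S P x p) = f x p"
        using rhom_dsum_extend[of S A P N f] S P N fr by auto
      have "T (restrict g (carrier ?D)) = f"
        using f ic g(2) by (fastforce simp: T_def vprod_def PiE_iff extensional_def fun_eq_iff simp del: dsum_module_simps)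
      then show "f \<in> T ` carrier (hom_space A ?D N)"
        by (intro image_eqI[of f T "restrict g (carrier ?D)"]) (use rhom_restrict[OF D g(1)] in simp_all)
    qed
  qed
  have dV: "vectorspace.fin_dim scalars ?V \<and>
      vectorspace.dim scalars ?V = (\<Sum>x\<in>S. vectorspace.dim scalars (hom_space A (P x) N))"
    by (rule vprod_dim[OF field_scalars S hV fd])
  have inv: "bij_betw T (carrier (hom_space A ?D N)) (carrier ?V)" using inj surj by (simp add: bij_betw_def)
  interpret L: linear_map scalars "hom_space A ?D N" ?V T by (rule linear_mapI[OF H V T])
  \<comment> \<open>\<open>linear_iso_dim\<close> carries finite dimension from source to target,
    but here it is known for the target \<open>?V\<close>; injectivity of \<open>T\<close> and
    \<open>fin_dim_extension\<close> bring it back to the source.\<close>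
  show fdH: "vectorspace.fin_dim scalars (hom_space A ?D N)"
  proof (rule L.fin_dim_extension[OF _ _ surj])
    show "vectorspace.fin_dim scalars ?V" using dV by blast
    have k: "vectorspace scalars (hom_space A ?D N\<lparr>carrier := L.kerT\<rparr>)" by (rule L.V.subspace_is_vs[OF L.kerT_is_subspace])
    have "L.kerT = {\<zero>\<^bsub>hom_space A ?D N\<^esub>}" using L.inj_imp_Ker0[OF inj] by simp
    then show "vectorspace.fin_dim scalars (hom_space A ?D N\<lparr>carrier := L.kerT\<rparr>)"
      by (intro fin_dim_finite_carrier[OF k]) simp
  qed
  show "vectorspace.dim scalars (hom_space A ?D N) = (\<Sum>x\<in>S. vectorspace.dim scalars (hom_space A (P x) N))"
    by (rule trans[OF linear_iso_dim(2)[OF H V T inv fdH, symmetric] conjunct2[OF dV]])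
qed

text \<open>Dual to \<open>hom_space_dsum_source\<close>. The isomorphism now starts at the product,
  where the dimension is known, so \<open>linear_iso_dim\<close> applies directly.\<close>

lemma hom_space_dsum_target:
  fixes P :: "'i \<Rightarrow> ('k::field, 'a, 'm) rmod" and M :: "('k, 'a, 'n) rmod"
  assumes S: "finite S" and P: "\<And>x. x \<in> S \<Longrightarrow> right_module A (P x)" and M: "right_module A M"
    and fd: "\<And>x. x \<in> S \<Longrightarrow> vectorspace.fin_dim scalars (hom_space A M (P x))"
  shows "vectorspace.fin_dim scalars (hom_space A M (dsum_module S P))"
    and "vectorspace.dim scalars (hom_space A M (dsum_module S P)) =
      (\<Sum>x\<in>S. vectorspace.dim scalars (hom_space A M (P x)))"
proof -
  interpret M: right_module A M by fact
  let ?D = "dsum_module S P"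
  have D: "right_module A ?D" by (rule dsum_right_module) (rule P)
  let ?V = "vprod S (\<lambda>x. hom_space A M (P x))"
  have hV: "vectorspace scalars (hom_space A M (P x))" if "x \<in> S" for x
    by (rule hom_space_vectorspace[OF M P[OF that]])
  have V: "vectorspace scalars ?V" by (rule vprod_vectorspace[OF field_scalars hV])
  have H: "vectorspace scalars (hom_space A M ?D)" by (rule hom_space_vectorspace[OF M D])
  define T where "T = (\<lambda>f :: 'i \<Rightarrow> 'n \<Rightarrow> 'm. \<lambda>m\<in>carrier M. \<lambda>x\<in>S. f x m)"
  have Tr: "T f \<in> rhom A M ?D" if "\<And>x. x \<in> S \<Longrightarrow> f x \<in> rhom A M (P x)" for f
    using that by (auto simp: rhom_iff T_def M.add_closed M.scale_closed M.ract_closed fun_eq_iff)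
  have T: "T \<in> module_hom scalars ?V (hom_space A M ?D)"
    unfolding module_hom_def
    using Tr by (auto simp: T_def vprod_def fun_eq_iff PiE_iff)
  have bij: "bij_betw T (carrier ?V) (carrier (hom_space A M ?D))"
  proof (rule bij_betw_byWitness[where f' = "\<lambda>f. \<lambda>x\<in>S. \<lambda>m\<in>carrier M. f m x"])
    show "\<forall>a\<in>carrier ?V. (\<lambda>x\<in>S. \<lambda>m\<in>carrier M. T a m x) = a"
      by (fastforce simp: T_def vprod_def PiE_iff extensional_def fun_eq_iff)
    show "\<forall>a\<in>carrier (hom_space A M ?D). T (\<lambda>x\<in>S. \<lambda>m\<in>carrier M. a m x) = a"
      by (fastforce simp: T_def rhom_iff PiE_iff extensional_def fun_eq_iff)
    show "T ` carrier ?V \<subseteq> carrier (hom_space A M ?D)" using T by (auto simp: module_hom_def)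
    show "(\<lambda>f. \<lambda>x\<in>S. \<lambda>m\<in>carrier M. f m x) ` carrier (hom_space A M ?D) \<subseteq> carrier ?V"
      by (auto simp: vprod_def rhom_iff PiE_iff M.add_closed M.scale_closed M.ract_closed)
  qed
  have dV: "vectorspace.fin_dim scalars ?V \<and>
      vectorspace.dim scalars ?V = (\<Sum>x\<in>S. vectorspace.dim scalars (hom_space A M (P x)))"
    by (rule vprod_dim[OF field_scalars S hV fd])
  show "vectorspace.fin_dim scalars (hom_space A M ?D)"
    and "vectorspace.dim scalars (hom_space A M ?D) = (\<Sum>x\<in>S. vectorspace.dim scalars (hom_space A M (P x)))"
    using linear_iso_dim[OF V H T bij] dV by auto
qed

text \<open>Each law for \<open>P x\<close> is coordinate \<open>x\<close> of the same law in the
  sum, applied to elements \<open>dsum_inj S P x p\<close>. A tilting complex is given through its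
  total terms, and this hands their module structure down to the summands.\<close>

lemma dsum_component:
  assumes D: "right_module A (dsum_module S P)" and x: "x \<in> S"
  shows "right_module A (P x)"
proof -
  interpret D: right_module A "dsum_module S P" by fact
  have z: "\<zero>\<^bsub>P y\<^esub> \<in> carrier (P y)" if "y \<in> S" for y
    using D.zero_mem that by auto
  let ?e = "dsum_inj S P x"
  have e: "?e p \<in> carrier (dsum_module S P)" if "p \<in> carrier (P x)" for p
    using that z by (auto simp: dsum_inj_def)
  have ex: "?e p x = p" for p using x by (simp add: dsum_inj_def)
  have vs: "vectorspace scalars (P x)"
  proof (rule vs_criteria[OF field_scalars], goal_cases)
    case 1
    show ?case using z x by blast
  next
    case 2
    show ?case using D.add_closed[OF e e] ex x by (fastforce simp: PiE_iff)
  next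
    case 3
    show ?case
    proof
      fix p assume p: "p \<in> carrier (P x)"
      show "\<exists>q\<in>carrier (P x). p \<oplus>\<^bsub>P x\<^esub> q = \<zero>\<^bsub>P x\<^esub>"
        using fun_cong[OF D.add_neg[OF e[OF p]], of x] D.neg_closed[OF e[OF p]] x
        by (intro bexI[of _ "(\<ominus>\<^bsub>dsum_module S P\<^esub> ?e p) x"]) (simp_all add: ex PiE_iff)
    qed
  next
    case 4
    show ?case using D.scale_closed[OF e] ex x by (fastforce simp: PiE_iff)
  next
    case 5
    show ?case using fun_cong[OF D.add_commute[OF e e], of _ _ x] x by (simp add: ex)
  next
    case 6
    show ?case using fun_cong[OF D.add_assoc[OF e e e], of _ _ _ x] x by (simp add: ex)
  next
    case 7
    show ?case using fun_cong[OF D.add_zero[OF e], of _ x] x by (simp add: ex)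
  next
    case 8
    show ?case using fun_cong[OF D.scale_scale[OF e], of _ _ _ x] x by (simp add: ex)
  next
    case 9
    show ?case using fun_cong[OF D.one_scale[OF e], of _ x] x by (simp add: ex)
  next
    case 10
    show ?case using fun_cong[OF D.add_scale[OF e], of _ _ _ x] x by (simp add: ex)
  next
    case 11
    show ?case using fun_cong[OF D.scale_add[OF e e], of _ _ _ x] x by (simp add: ex)
  qed
  have ax: "right_module_axioms A (P x)"
  proof (unfold_locales, goal_cases)
    case (1 p a)
    show ?case using D.ract_closed[OF e[OF 1(1)] 1(2)] x by (auto simp: ex PiE_iff)
  next
    case (2 p q a)
    show ?case using fun_cong[OF D.ract_add_left[OF e[OF 2(1)] e[OF 2(2)] 2(3)], of x] x by (simp add: ex)
  next
    case (3 p a b)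
    show ?case using fun_cong[OF D.ract_add_right[OF e[OF 3(1)] 3(2,3)], of x] x by (simp add: ex)
  next
    case (4 p a c)
    show ?case using fun_cong[OF D.ract_smult_left[OF e[OF 4(1)] 4(2), of c], of x] x by (simp add: ex)
  next
    case (5 p a c)
    show ?case using fun_cong[OF D.ract_smult_right[OF e[OF 5(1)] 5(2), of c], of x] x by (simp add: ex)
  next
    case (6 p a b)
    show ?case using fun_cong[OF D.ract_mult[OF e[OF 6(1)] 6(2,3)], of x] x by (simp add: ex)
  next
    case (7 p)
    show ?case using fun_cong[OF D.ract_one[OF e[OF 7]], of x] x by (simp add: ex)
  qed
  show ?thesis using vs ax by (simp add: right_module_def)
qed

lemma fd_dsum_component:
  assumes D: "fd_module A (dsum_module S P)" and x: "x \<in> S"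
  shows "fd_module A (P x)"
proof -
  have r: "right_module A (dsum_module S P)" using D by (simp add: fd_module_def)
  then have rx: "right_module A (P x)" using x by (rule dsum_component)
  interpret D: right_module A "dsum_module S P" by fact
  interpret Px: right_module A "P x" by fact
  interpret L: linear_map scalars "dsum_module S P" "P x" "\<lambda>p. p x"
    by (rule linear_mapI[OF D.vectorspace_axioms Px.vectorspace_axioms])
      (use x in \<open>auto simp: module_hom_def\<close>)
  have "(\<lambda>p. p x) ` carrier (dsum_module S P) = carrier (P x)"
  proof
    show "(\<lambda>p. p x) ` carrier (dsum_module S P) \<subseteq> carrier (P x)" using x by auto
    show "carrier (P x) \<subseteq> (\<lambda>p. p x) ` carrier (dsum_module S P)"
    proof
      fix p assume p: "p \<in> carrier (P x)"
      have "dsum_inj S P x p \<in> carrier (dsum_module S P)" using p D.zero_mem by (auto simp: dsum_inj_def)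
      moreover have "p = dsum_inj S P x p x" using x by (simp add: dsum_inj_def)
      ultimately show "p \<in> (\<lambda>p. p x) ` carrier (dsum_module S P)" by (rule image_eqI[where f = "\<lambda>p. p x", rotated])
    qed
  qed
  then show ?thesis using D rx L.surj_fin_dim by (simp add: fd_module_def)
qed

section \<open>Lifting along linear relations\<close>

text \<open>
  Projectivity of \<open>P\<close>, phrased for a submodule \<open>R\<close> of \<open>M \<times> P\<close> projecting onto \<open>P\<close>: lifting along
  \<open>g : M \<rightarrow> P\<close> is the case \<open>R m p \<longleftrightarrow> g m = p\<close>, and general \<open>R\<close> allow side conditions on the lift.
\<close>

definition liftable :: "('k::field, 'a) module \<Rightarrow> ('k, 'a, 'p) rmod \<Rightarrow> ('k, 'a, 'm) rmod \<Rightarrow> bool" where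
  "liftable A P M \<longleftrightarrow> (\<forall>R.
     R \<zero>\<^bsub>M\<^esub> \<zero>\<^bsub>P\<^esub> \<longrightarrow>
     (\<forall>m\<in>carrier M. \<forall>n\<in>carrier M. \<forall>p\<in>carrier P. \<forall>q\<in>carrier P.
        R m p \<longrightarrow> R n q \<longrightarrow> R (m \<oplus>\<^bsub>M\<^esub> n) (p \<oplus>\<^bsub>P\<^esub> q)) \<longrightarrow>
     (\<forall>m\<in>carrier M. \<forall>p\<in>carrier P. \<forall>a\<in>carrier A. R m p \<longrightarrow> R (ract M m a) (ract P p a)) \<longrightarrow>
     (\<forall>p\<in>carrier P. \<exists>m\<in>carrier M. R m p) \<longrightarrow>
     (\<exists>h\<in>rhom A P M. \<forall>p\<in>carrier P. R (h p) p))"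

lemma liftableD:
  assumes "liftable A P M" "R \<zero>\<^bsub>M\<^esub> \<zero>\<^bsub>P\<^esub>"
    and "\<And>m n p q. m \<in> carrier M \<Longrightarrow> n \<in> carrier M \<Longrightarrow> p \<in> carrier P \<Longrightarrow> q \<in> carrier P \<Longrightarrow>
      R m p \<Longrightarrow> R n q \<Longrightarrow> R (m \<oplus>\<^bsub>M\<^esub> n) (p \<oplus>\<^bsub>P\<^esub> q)"
    and "\<And>m p a. m \<in> carrier M \<Longrightarrow> p \<in> carrier P \<Longrightarrow> a \<in> carrier A \<Longrightarrow> R m p \<Longrightarrow>
      R (ract M m a) (ract P p a)"
    and "\<And>p. p \<in> carrier P \<Longrightarrow> \<exists>m\<in>carrier M. R m p"
  shows "\<exists>h\<in>rhom A P M. \<forall>p\<in>carrier P. R (h p) p"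
  using assms(1)[unfolded liftable_def, rule_format, of R] assms(2-) by blast

text \<open>The relation is pulled back along each injection and lifted there; the lifts are glued
  by \<open>rhom_dsum_extend\<close>, and additivity of \<open>R\<close> carries the relation from
  the summands to their sum.\<close>

lemma liftable_dsum:
  assumes S: "finite S" and P: "\<And>x. x \<in> S \<Longrightarrow> right_module A (P x)" and M: "right_module A M"
    and lift: "\<And>x. x \<in> S \<Longrightarrow> liftable A (P x) M"
  shows "liftable A (dsum_module S P) M"
  unfolding liftable_def
proof (intro allI impI)
  let ?D = "dsum_module S P"
  fix R
  assume z: "R \<zero>\<^bsub>M\<^esub> \<zero>\<^bsub>?D\<^esub>"
    and add: "\<forall>m\<in>carrier M. \<forall>n\<in>carrier M. \<forall>p\<in>carrier ?D. \<forall>q\<in>carrier ?D.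
        R m p \<longrightarrow> R n q \<longrightarrow> R (m \<oplus>\<^bsub>M\<^esub> n) (p \<oplus>\<^bsub>?D\<^esub> q)"
    and act: "\<forall>m\<in>carrier M. \<forall>p\<in>carrier ?D. \<forall>a\<in>carrier A. R m p \<longrightarrow> R (ract M m a) (ract ?D p a)"
    and tot: "\<forall>p\<in>carrier ?D. \<exists>m\<in>carrier M. R m p"
  have D: "right_module A ?D" by (rule dsum_right_module) (rule P)
  have ir: "dsum_inj S P x \<in> rhom A (P x) ?D" for x by (rule dsum_inj_rhom[OF P])
  have "\<exists>h\<in>rhom A (P x) M. \<forall>p\<in>carrier (P x). R (h p) (dsum_inj S P x p)" if x: "x \<in> S" for x
  proof (rule liftableD[OF lift[OF x], where R = "\<lambda>m p. R m (dsum_inj S P x p)"])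
    show "R \<zero>\<^bsub>M\<^esub> (dsum_inj S P x \<zero>\<^bsub>P x\<^esub>)" using z rhom_zero[OF P[OF x] D ir] by simp
  next
    fix m n p q assume "m \<in> carrier M" "n \<in> carrier M" "p \<in> carrier (P x)" "q \<in> carrier (P x)"
      "R m (dsum_inj S P x p)" "R n (dsum_inj S P x q)"
    then show "R (m \<oplus>\<^bsub>M\<^esub> n) (dsum_inj S P x (p \<oplus>\<^bsub>P x\<^esub> q))"
      unfolding rhom_add[OF ir \<open>p \<in> carrier (P x)\<close> \<open>q \<in> carrier (P x)\<close>]
      using add rhom_closed[OF ir] by blast
  next
    fix m p a assume "m \<in> carrier M" "p \<in> carrier (P x)" "a \<in> carrier A" "R m (dsum_inj S P x p)"
    then show "R (ract M m a) (dsum_inj S P x (ract (P x) p a))"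
      unfolding rhom_ract[OF ir \<open>p \<in> carrier (P x)\<close> \<open>a \<in> carrier A\<close>]
      using act rhom_closed[OF ir] by blast
  next
    fix p assume "p \<in> carrier (P x)"
    then show "\<exists>m\<in>carrier M. R m (dsum_inj S P x p)" using tot rhom_closed[OF ir] by blast
  qed
  then have "\<forall>x. \<exists>h. x \<in> S \<longrightarrow> h \<in> rhom A (P x) M \<and> (\<forall>p\<in>carrier (P x). R (h p) (dsum_inj S P x p))"
    by blast
  then obtain h where h: "\<And>x. x \<in> S \<Longrightarrow> h x \<in> rhom A (P x) M"
    and hR: "\<And>x p. x \<in> S \<Longrightarrow> p \<in> carrier (P x) \<Longrightarrow> R (h x p) (dsum_inj S P x p)"
    by metis
  obtain g where g: "g \<in> rhom A ?D M"
    and gh: "\<And>x p. x \<in> S \<Longrightarrow> p \<in> carrier (P x) \<Longrightarrow> g (dsum_inj S P x p) = h x p"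
    using rhom_dsum_extend[of S A P M h] S P M h by auto
  show "\<exists>h\<in>rhom A ?D M. \<forall>p\<in>carrier ?D. R (h p) p"
  proof (rule bexI[OF _ g], intro ballI)
    fix p assume p: "p \<in> carrier ?D"
    show "R (g p) p"
    proof (rule dsum_induct[OF S P p])
      show "R (g \<zero>\<^bsub>?D\<^esub>) \<zero>\<^bsub>?D\<^esub>" unfolding rhom_zero[OF D M g] by (rule z)
    next
      fix x p assume "x \<in> S" "p \<in> carrier (P x)"
      then show "R (g (dsum_inj S P x p)) (dsum_inj S P x p)" by (simp only: gh hR)
    next
      fix p q assume "p \<in> carrier ?D" "q \<in> carrier ?D" "R (g p) p" "R (g q) q"
      then show "R (g (p \<oplus>\<^bsub>?D\<^esub> q)) (p \<oplus>\<^bsub>?D\<^esub> q)"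
        unfolding rhom_add[OF g \<open>p \<in> carrier ?D\<close> \<open>q \<in> carrier ?D\<close>]
        using add rhom_closed[OF g] by blast
    qed
  qed
qed

section \<open>The modules \<open>eA\<close>\<close>

lemma idem_module_simps [simp]:
  "carrier (idem_module A e) = {e \<otimes>\<^bsub>A\<^esub> a | a. a \<in> carrier A}"
  "zero (idem_module A e) = \<zero>\<^bsub>A\<^esub>"
  "add (idem_module A e) = add A"
  "smult (idem_module A e) = smult A"
  "ract (idem_module A e) = mult A"
  by (simp_all add: idem_module_def)

locale idempotent = ring A for A :: "('k::field, 'a) module" +
  fixes e
  assumes idem_closed: "e \<in> carrier A" and idem: "e \<otimes>\<^bsub>A\<^esub> e = e"
begin

lemma idem_mem: "e \<in> carrier (idem_module A e)"
  using idem idem_closed by force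

lemma idem_module_closed: "p \<in> carrier (idem_module A e) \<Longrightarrow> p \<in> carrier A"
  using idem_closed by auto

lemma idem_mult: "p \<in> carrier (idem_module A e) \<Longrightarrow> e \<otimes>\<^bsub>A\<^esub> p = p"
  using idem idem_closed by (auto simp: m_assoc[symmetric])

lemma ract_rhom:
  assumes "right_module A M" "m \<in> carrier M"
  shows "ract M m \<in> rhom A (idem_module A e) M"
proof -
  interpret M: right_module A M by fact
  show ?thesis unfolding rhom_iff
    using idem_module_closed assms(2)
    by (auto simp del: idem_module_simps(1) simp: M.ract_closed M.ract_add_right M.ract_smult_right M.ract_mult)
qed

text \<open>\<open>eA\<close> is generated by \<open>e\<close>: any \<open>m\<close> related to
  \<open>e\<close> gives the lift sending \<open>p\<close> to \<open>m p\<close>, because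
  \<open>p = e p\<close> and \<open>R\<close> is closed under the action.\<close>

lemma liftable: 
  assumes M: "right_module A M"
  shows "liftable A (idem_module A e) M"
  unfolding liftable_def
proof (intro allI impI)
  fix R
  assume act: "\<forall>m\<in>carrier M. \<forall>p\<in>carrier (idem_module A e). \<forall>a\<in>carrier A.
      R m p \<longrightarrow> R (ract M m a) (ract (idem_module A e) p a)"
    and tot: "\<forall>p\<in>carrier (idem_module A e). \<exists>m\<in>carrier M. R m p"
  obtain m where m: "m \<in> carrier M" "R m e" using tot idem_mem by blast
  show "\<exists>h\<in>rhom A (idem_module A e) M. \<forall>p\<in>carrier (idem_module A e). R (h p) p"
  proof (rule bexI[OF _ ract_rhom[OF M m(1)]], intro ballI)
    fix p assume p: "p \<in> carrier (idem_module A e)"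
    have "R (ract M m p) (ract (idem_module A e) e p)"
      using act m idem_mem idem_module_closed[OF p] by blast
    then show "R (ract M m p) p" by (simp add: idem_mult[OF p])
  qed
qed

text \<open>Every homomorphism \<open>f\<close> sends \<open>p\<close> to \<open>(f e) p\<close>, so
  the space is a linear image of \<open>M\<close>.\<close>

lemma fin_dim_hom:
  assumes P: "right_module A (idem_module A e)" and fd: "fd_module A M"
  shows "vectorspace.fin_dim scalars (hom_space A (idem_module A e) M)"
proof -
  let ?P = "idem_module A e"
  have M: "right_module A M" using fd by (simp add: fd_module_def)
  interpret P: right_module A ?P by fact
  interpret M: right_module A M by fact
  let ?T = "\<lambda>m. restrict (ract M m) (carrier ?P)"
  have T: "?T \<in> module_hom scalars M (hom_space A ?P M)"
    using idem_module_closed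
    by (auto simp del: idem_module_simps(1) simp: module_hom_def M.ract_add_left M.ract_smult_left
        intro!: rhom_restrict[OF P] ract_rhom[OF M] restrict_ext)
  interpret L: linear_map scalars M "hom_space A ?P M" ?T
    by (rule linear_mapI[OF M.vectorspace_axioms hom_space_vectorspace[OF P M] T])
  have "?T ` carrier M = carrier (hom_space A ?P M)"
  proof
    show "?T ` carrier M \<subseteq> carrier (hom_space A ?P M)" using T by (auto simp: module_hom_def)
    show "carrier (hom_space A ?P M) \<subseteq> ?T ` carrier M"
    proof
      fix f assume f: "f \<in> carrier (hom_space A ?P M)"
      then have fr: "f \<in> rhom A ?P M" by simp
      have "f = ?T (f e)"
      proof (rule extensionalityI[of _ "carrier ?P"])
        fix p assume p: "p \<in> carrier ?P"
        show "f p = ?T (f e) p"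
          using rhom_ract[OF fr idem_mem idem_module_closed[OF p]] p idem_mult[OF p] by simp
      qed (use f in auto)
      then show "f \<in> ?T ` carrier M" using rhom_closed[OF fr idem_mem] by (rule image_eqI)
    qed
  qed
  then show ?thesis using L.surj_fin_dim fd by (simp add: fd_module_def)
qed

end

section \<open>Complexes and homotopies\<close>

lemma cmod_module: "bounded_complex A X \<Longrightarrow> right_module A (cmod X i)"
  and cdiff_rhom: "bounded_complex A X \<Longrightarrow> cdiff X i \<in> rhom A (cmod X i) (cmod X (i + 1))"
  and cdiff_cdiff: "bounded_complex A X \<Longrightarrow> x \<in> carrier (cmod X i) \<Longrightarrow>
    cdiff X (i + 1) (cdiff X i x) = \<zero>\<^bsub>cmod X (i + 1 + 1)\<^esub>"
  by (simp_all add: bounded_complex_def fd_module_def)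

lemma cdiff_rhom': "bounded_complex A X \<Longrightarrow> cdiff X (i - 1) \<in> rhom A (cmod X (i - 1)) (cmod X i)"
  using cdiff_rhom[of A X "i - 1"] by simp

lemma chain_mapI:
  assumes "\<And>i. f i \<in> rhom A (cmod X i) (cmod Y i)"
    and "\<And>i x. x \<in> carrier (cmod X i) \<Longrightarrow> f (i + 1) (cdiff X i x) = cdiff Y i (f i x)"
  shows "chain_map A X Y f"
  using assms by (simp add: chain_map_def)

lemma chain_map_rhom: "chain_map A X Y f \<Longrightarrow> f i \<in> rhom A (cmod X i) (cmod Y i)"
  and chain_map_diff: "chain_map A X Y f \<Longrightarrow> x \<in> carrier (cmod X i) \<Longrightarrow>
    f (i + 1) (cdiff X i x) = cdiff Y i (f i x)"
  by (simp_all add: chain_map_def)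

lemma chain_map_closed: "chain_map A X Y f \<Longrightarrow> x \<in> carrier (cmod X i) \<Longrightarrow> f i x \<in> carrier (cmod Y i)"
  by (rule rhom_closed[OF chain_map_rhom])

lemma chain_map_diff': "chain_map A X Y f \<Longrightarrow> x \<in> carrier (cmod X (i - 1)) \<Longrightarrow>
    f i (cdiff X (i - 1) x) = cdiff Y (i - 1) (f (i - 1) x)"
  using chain_map_diff[of A X Y f x "i - 1"] by simp

lemma chain_map_cid: "chain_map A X X cid"
  by (simp add: chain_map_def cid_def rhom_id)

lemma chain_map_ccomp:
  assumes "chain_map A X Y f" "chain_map A Y Z g"
  shows "chain_map A X Z (ccomp g f)"
  unfolding ccomp_def
  by (rule chain_mapI)
    (simp_all add: rhom_comp[OF chain_map_rhom[OF assms(1)] chain_map_rhom[OF assms(2)]]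
      chain_map_diff[OF assms(1)] chain_map_diff[OF assms(2)] chain_map_closed[OF assms(1)])

lemma chain_map_zero:
  assumes "bounded_complex A Y"
  shows "chain_map A X Y (\<lambda>i x. \<zero>\<^bsub>cmod Y i\<^esub>)"
  using rhom_zero[OF cmod_module[OF assms] cmod_module[OF assms] cdiff_rhom[OF assms]]
  by (intro chain_mapI) (simp_all add: rhom_zero_map[OF cmod_module[OF assms]])

lemma chain_map_sum:
  assumes Y: "bounded_complex A Y" and f: "chain_map A X Y f" and g: "chain_map A X Y g"
  shows "chain_map A X Y (\<lambda>i x. f i x \<oplus>\<^bsub>cmod Y i\<^esub> g i x)"
  by (rule chain_mapI)
    (simp_all add: rhom_sum[OF cmod_module[OF Y] chain_map_rhom[OF f] chain_map_rhom[OF g]]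
      chain_map_diff[OF f] chain_map_diff[OF g] rhom_add[OF cdiff_rhom[OF Y]]
      chain_map_closed[OF f] chain_map_closed[OF g])

lemma chain_map_smult:
  assumes Y: "bounded_complex A Y" and f: "chain_map A X Y f"
  shows "chain_map A X Y (\<lambda>i x. c \<odot>\<^bsub>cmod Y i\<^esub> f i x)"
  by (rule chain_mapI)
    (simp_all add: rhom_smult[OF cmod_module[OF Y] chain_map_rhom[OF f]]
      chain_map_diff[OF f] rhom_scale[OF cdiff_rhom[OF Y]] chain_map_closed[OF f])

section \<open>Chain homotopies: equivalence, composition and linearity\<close>

lemma homotopicI:
  assumes "\<And>i. h i \<in> rhom A (cmod X i) (cmod Y (i - 1))"
    and "\<And>i x. x \<in> carrier (cmod X i) \<Longrightarrow>
      f i x = g i x \<oplus>\<^bsub>cmod Y i\<^esub> (cdiff Y (i - 1) (h i x) \<oplus>\<^bsub>cmod Y i\<^esub> h (i + 1) (cdiff X i x))"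
  shows "homotopic A X Y f g"
  using assms unfolding homotopic_def by blast

definition homotopy ::
    "('k::field, 'a) module \<Rightarrow> ('k, 'a, 'm) cplx \<Rightarrow> ('k, 'a, 'n) cplx \<Rightarrow>
      (int \<Rightarrow> 'm \<Rightarrow> 'n) \<Rightarrow> (int \<Rightarrow> 'm \<Rightarrow> 'n) \<Rightarrow> (int \<Rightarrow> 'm \<Rightarrow> 'n) \<Rightarrow> bool" where
  "homotopy A X Y f g h \<longleftrightarrow>
    (\<forall>i. h i \<in> rhom A (cmod X i) (cmod Y (i - 1))) \<and>
    (\<forall>i. \<forall>x\<in>carrier (cmod X i). f i x =
      g i x \<oplus>\<^bsub>cmod Y i\<^esub> (cdiff Y (i - 1) (h i x) \<oplus>\<^bsub>cmod Y i\<^esub> h (i + 1) (cdiff X i x)))"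

lemma homotopicE:
  assumes "homotopic A X Y f g"
  obtains h where "homotopy A X Y f g h"
  using assms unfolding homotopic_def homotopy_def by blast

lemma homotopy_rhom: "homotopy A X Y f g h \<Longrightarrow> h i \<in> rhom A (cmod X i) (cmod Y (i - 1))"
  and homotopy_eq: "homotopy A X Y f g h \<Longrightarrow> x \<in> carrier (cmod X i) \<Longrightarrow>
    f i x = g i x \<oplus>\<^bsub>cmod Y i\<^esub> (cdiff Y (i - 1) (h i x) \<oplus>\<^bsub>cmod Y i\<^esub> h (i + 1) (cdiff X i x))"
  by (simp_all add: homotopy_def)

lemma homotopy_rhom_next:
  assumes "\<And>i. h i \<in> rhom A (cmod X i) (cmod Y (i - 1))"
  shows "h (i + 1) \<in> rhom A (cmod X (i + 1)) (cmod Y i)"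
  using assms[of "i + 1"] by simp

lemma homotopy_terms_closed:
  assumes X: "bounded_complex A X" and Y: "bounded_complex A Y"
    and h: "\<And>i. h i \<in> rhom A (cmod X i) (cmod Y (i - 1))" and x: "x \<in> carrier (cmod X i)"
  shows "cdiff Y (i - 1) (h i x) \<in> carrier (cmod Y i)" "h (i + 1) (cdiff X i x) \<in> carrier (cmod Y i)"
  using rhom_closed[OF cdiff_rhom'[OF Y] rhom_closed[OF h x]]
    rhom_closed[OF homotopy_rhom_next[where h = h, OF h] rhom_closed[OF cdiff_rhom[OF X] x]] by auto

lemma homotopic_eqI:
  assumes Y: "bounded_complex A Y" and g: "chain_map A X Y g"
    and eq: "\<And>i x. x \<in> carrier (cmod X i) \<Longrightarrow> f i x = g i x"
  shows "homotopic A X Y f g"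
proof (rule homotopicI[where h = "\<lambda>i x. \<zero>\<^bsub>cmod Y (i - 1)\<^esub>"])
  note m = cmod_module[OF Y]
  show "(\<lambda>x. \<zero>\<^bsub>cmod Y (i - 1)\<^esub>) \<in> rhom A (cmod X i) (cmod Y (i - 1))" for i
    by (rule rhom_zero_map[OF m])
  fix i x assume x: "x \<in> carrier (cmod X i)"
  interpret Y: right_module A "cmod Y i" by (rule m)
  show "f i x = g i x \<oplus>\<^bsub>cmod Y i\<^esub> (cdiff Y (i - 1) \<zero>\<^bsub>cmod Y (i - 1)\<^esub> \<oplus>\<^bsub>cmod Y i\<^esub> \<zero>\<^bsub>cmod Y (i + 1 - 1)\<^esub>)"
    using x rhom_zero[OF m m cdiff_rhom'[OF Y]] chain_map_closed[OF g x]
    by (simp add: eq Y.add_zero Y.zero_mem)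
qed

lemma homotopic_refl: "bounded_complex A Y \<Longrightarrow> chain_map A X Y f \<Longrightarrow> homotopic A X Y f f"
  by (rule homotopic_eqI) auto

lemma homotopic_sym:
  assumes X: "bounded_complex A X" and Y: "bounded_complex A Y" and g: "chain_map A X Y g"
    and hom: "homotopic A X Y f g"
  shows "homotopic A X Y g f"
proof -
  obtain h where Hh: "homotopy A X Y f g h" using hom by (rule homotopicE)
  note h = homotopy_rhom[OF Hh] and eq = homotopy_eq[OF Hh]
  note m = cmod_module[OF Y]
  show ?thesis
  proof (rule homotopicI[where h = "\<lambda>i x. \<ominus>\<^bsub>cmod Y (i - 1)\<^esub> h i x"])
    show "(\<lambda>x. \<ominus>\<^bsub>cmod Y (i - 1)\<^esub> h i x) \<in> rhom A (cmod X i) (cmod Y (i - 1))" for i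
      by (rule rhom_uminus[OF m h])
    fix i x assume x: "x \<in> carrier (cmod X i)"
    interpret Y: right_module A "cmod Y i" by (rule m)
    note c = homotopy_terms_closed[OF X Y h x] chain_map_closed[OF g x]
    have "cdiff Y (i - 1) (\<ominus>\<^bsub>cmod Y (i - 1)\<^esub> h i x) = \<ominus>\<^bsub>cmod Y i\<^esub> cdiff Y (i - 1) (h i x)"
      by (rule rhom_neg[OF m m cdiff_rhom'[OF Y] rhom_closed[OF h x]])
    then show "g i x = f i x \<oplus>\<^bsub>cmod Y i\<^esub> (cdiff Y (i - 1) (\<ominus>\<^bsub>cmod Y (i - 1)\<^esub> h i x)
        \<oplus>\<^bsub>cmod Y i\<^esub> \<ominus>\<^bsub>cmod Y (i + 1 - 1)\<^esub> h (i + 1) (cdiff X i x))"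
      using c x by (simp add: eq Y.neg_sum[symmetric] Y.add_closed Y.neg_closed Y.add_assoc Y.add_neg Y.add_zero)
  qed
qed

lemma homotopic_trans:
  assumes X: "bounded_complex A X" and Y: "bounded_complex A Y" and k: "chain_map A X Y k"
    and fg: "homotopic A X Y f g" and gk: "homotopic A X Y g k"
  shows "homotopic A X Y f k"
proof -
  obtain h where Hh: "homotopy A X Y f g h" using fg by (rule homotopicE)
  note h = homotopy_rhom[OF Hh] and eq = homotopy_eq[OF Hh]
  obtain h' where Hh': "homotopy A X Y g k h'" using gk by (rule homotopicE)
  note h' = homotopy_rhom[OF Hh'] and eq' = homotopy_eq[OF Hh']
  note m = cmod_module[OF Y]
  show ?thesis
  proof (rule homotopicI[where h = "\<lambda>i x. h i x \<oplus>\<^bsub>cmod Y (i - 1)\<^esub> h' i x"])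
    show "(\<lambda>x. h i x \<oplus>\<^bsub>cmod Y (i - 1)\<^esub> h' i x) \<in> rhom A (cmod X i) (cmod Y (i - 1))" for i
      by (rule rhom_sum[OF m h h'])
    fix i x assume x: "x \<in> carrier (cmod X i)"
    interpret Y: right_module A "cmod Y i" by (rule m)
    note c = homotopy_terms_closed[OF X Y h x] homotopy_terms_closed[OF X Y h' x] chain_map_closed[OF k x]
    show "f i x = k i x \<oplus>\<^bsub>cmod Y i\<^esub> (cdiff Y (i - 1) (h i x \<oplus>\<^bsub>cmod Y (i - 1)\<^esub> h' i x)
        \<oplus>\<^bsub>cmod Y i\<^esub> (h (i + 1) (cdiff X i x) \<oplus>\<^bsub>cmod Y (i + 1 - 1)\<^esub> h' (i + 1) (cdiff X i x)))"
      using c x rhom_add[OF cdiff_rhom'[OF Y] rhom_closed[OF h x] rhom_closed[OF h' x]]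
      by (simp add: eq eq' Y.add_closed Y.add_assoc Y.add_lcomm Y.add_commute)
  qed
qed

lemma homotopic_ccomp_left:
  assumes X: "bounded_complex A X" and Y: "bounded_complex A Y" and f': "chain_map A X Y f'"
    and g: "chain_map A Y Z g" and hom: "homotopic A X Y f f'"
  shows "homotopic A X Z (ccomp g f) (ccomp g f')"
proof -
  obtain h where Hh: "homotopy A X Y f f' h" using hom by (rule homotopicE)
  note h = homotopy_rhom[OF Hh] and eq = homotopy_eq[OF Hh]
  show ?thesis
  proof (rule homotopicI[where h = "\<lambda>i x. g (i - 1) (h i x)"])
    show "(\<lambda>x. g (i - 1) (h i x)) \<in> rhom A (cmod X i) (cmod Z (i - 1))" for i
      by (rule rhom_comp[OF h chain_map_rhom[OF g]])
    fix i x assume x: "x \<in> carrier (cmod X i)"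
    interpret Y: right_module A "cmod Y i" by (rule cmod_module[OF Y])
    note c = homotopy_terms_closed[OF X Y h x] chain_map_closed[OF f' x]
    show "ccomp g f i x = ccomp g f' i x \<oplus>\<^bsub>cmod Z i\<^esub> (cdiff Z (i - 1) (g (i - 1) (h i x))
        \<oplus>\<^bsub>cmod Z i\<^esub> g (i + 1 - 1) (h (i + 1) (cdiff X i x)))"
      using c x by (simp add: ccomp_def eq rhom_add[OF chain_map_rhom[OF g]] Y.add_closed
          chain_map_diff'[OF g rhom_closed[OF h x]])
  qed
qed

lemma homotopic_ccomp_right:
  assumes e: "chain_map A W X e" and hom: "homotopic A X Y f f'"
  shows "homotopic A W Y (ccomp f e) (ccomp f' e)"
proof -
  obtain h where Hh: "homotopy A X Y f f' h" using hom by (rule homotopicE)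
  note h = homotopy_rhom[OF Hh] and eq = homotopy_eq[OF Hh]
  show ?thesis
    by (rule homotopicI[where h = "\<lambda>i x. h i (e i x)"])
      (simp_all add: rhom_comp[OF chain_map_rhom[OF e] h] ccomp_def eq chain_map_closed[OF e] chain_map_diff[OF e])
qed

lemma homotopic_sum:
  assumes X: "bounded_complex A X" and Y: "bounded_complex A Y"
    and f': "chain_map A X Y f'" and g': "chain_map A X Y g'"
    and ff: "homotopic A X Y f f'" and gg: "homotopic A X Y g g'"
  shows "homotopic A X Y (\<lambda>i x. f i x \<oplus>\<^bsub>cmod Y i\<^esub> g i x) (\<lambda>i x. f' i x \<oplus>\<^bsub>cmod Y i\<^esub> g' i x)"
proof -
  obtain h where Hh: "homotopy A X Y f f' h" using ff by (rule homotopicE)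
  note h = homotopy_rhom[OF Hh] and eq = homotopy_eq[OF Hh]
  obtain h' where Hh': "homotopy A X Y g g' h'" using gg by (rule homotopicE)
  note h' = homotopy_rhom[OF Hh'] and eq' = homotopy_eq[OF Hh']
  note m = cmod_module[OF Y]
  show ?thesis
  proof (rule homotopicI[where h = "\<lambda>i x. h i x \<oplus>\<^bsub>cmod Y (i - 1)\<^esub> h' i x"])
    show "(\<lambda>x. h i x \<oplus>\<^bsub>cmod Y (i - 1)\<^esub> h' i x) \<in> rhom A (cmod X i) (cmod Y (i - 1))" for i
      by (rule rhom_sum[OF m h h'])
    fix i x assume x: "x \<in> carrier (cmod X i)"
    interpret Y: right_module A "cmod Y i" by (rule m)
    note c = homotopy_terms_closed[OF X Y h x] homotopy_terms_closed[OF X Y h' x]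
      chain_map_closed[OF f' x] chain_map_closed[OF g' x]
    show "f i x \<oplus>\<^bsub>cmod Y i\<^esub> g i x = (f' i x \<oplus>\<^bsub>cmod Y i\<^esub> g' i x) \<oplus>\<^bsub>cmod Y i\<^esub>
        (cdiff Y (i - 1) (h i x \<oplus>\<^bsub>cmod Y (i - 1)\<^esub> h' i x)
        \<oplus>\<^bsub>cmod Y i\<^esub> (h (i + 1) (cdiff X i x) \<oplus>\<^bsub>cmod Y (i + 1 - 1)\<^esub> h' (i + 1) (cdiff X i x)))"
      using c x rhom_add[OF cdiff_rhom'[OF Y] rhom_closed[OF h x] rhom_closed[OF h' x]]
      by (simp add: eq eq' Y.add_closed Y.add_assoc Y.add_lcomm Y.add_commute)
  qed
qed

lemma homotopic_smult:
  assumes X: "bounded_complex A X" and Y: "bounded_complex A Y"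
    and f': "chain_map A X Y f'" and ff: "homotopic A X Y f f'"
  shows "homotopic A X Y (\<lambda>i x. c \<odot>\<^bsub>cmod Y i\<^esub> f i x) (\<lambda>i x. c \<odot>\<^bsub>cmod Y i\<^esub> f' i x)"
proof -
  obtain h where Hh: "homotopy A X Y f f' h" using ff by (rule homotopicE)
  note h = homotopy_rhom[OF Hh] and eq = homotopy_eq[OF Hh]
  note m = cmod_module[OF Y]
  show ?thesis
  proof (rule homotopicI[where h = "\<lambda>i x. c \<odot>\<^bsub>cmod Y (i - 1)\<^esub> h i x"])
    show "(\<lambda>x. c \<odot>\<^bsub>cmod Y (i - 1)\<^esub> h i x) \<in> rhom A (cmod X i) (cmod Y (i - 1))" for i
      by (rule rhom_smult[OF m h])
    fix i x assume x: "x \<in> carrier (cmod X i)"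
    interpret Y: right_module A "cmod Y i" by (rule m)
    note cl = homotopy_terms_closed[OF X Y h x] chain_map_closed[OF f' x]
    show "c \<odot>\<^bsub>cmod Y i\<^esub> f i x = c \<odot>\<^bsub>cmod Y i\<^esub> f' i x \<oplus>\<^bsub>cmod Y i\<^esub>
        (cdiff Y (i - 1) (c \<odot>\<^bsub>cmod Y (i - 1)\<^esub> h i x)
        \<oplus>\<^bsub>cmod Y i\<^esub> c \<odot>\<^bsub>cmod Y (i + 1 - 1)\<^esub> h (i + 1) (cdiff X i x))"
      using cl x rhom_scale[OF cdiff_rhom'[OF Y] rhom_closed[OF h x]]
      by (simp add: eq Y.add_closed Y.scale_add)
  qed
qed

section \<open>Quasi-isomorphisms\<close>

lemma coboundaries_closed: 
  assumes "bounded_complex A X" "b \<in> coboundaries X i"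
  shows "b \<in> carrier (cmod X i)"
  using assms rhom_closed[OF cdiff_rhom'[OF assms(1)]] by (auto simp: coboundaries_def)

lemma cocycles_closed: "x \<in> cocycles X i \<Longrightarrow> x \<in> carrier (cmod X i)"
  and cocycles_diff: "x \<in> cocycles X i \<Longrightarrow> cdiff X i x = \<zero>\<^bsub>cmod X (i + 1)\<^esub>"
  by (simp_all add: cocycles_def)

lemma coboundaries_zero:
  assumes X: "bounded_complex A X"
  shows "\<zero>\<^bsub>cmod X i\<^esub> \<in> coboundaries X i"
proof -
  note m = cmod_module[OF X]
  have "cdiff X (i - 1) \<zero>\<^bsub>cmod X (i - 1)\<^esub> = \<zero>\<^bsub>cmod X i\<^esub>"
    by (rule rhom_zero[OF m m cdiff_rhom'[OF X]])
  then show ?thesis unfolding coboundaries_def using right_module.zero_mem[OF m] by (metis image_eqI)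
qed

lemma coboundaries_add:
  assumes X: "bounded_complex A X" and "a \<in> coboundaries X i" "b \<in> coboundaries X i"
  shows "a \<oplus>\<^bsub>cmod X i\<^esub> b \<in> coboundaries X i"
proof -
  obtain x y where x: "x \<in> carrier (cmod X (i - 1))" "a = cdiff X (i - 1) x"
    and y: "y \<in> carrier (cmod X (i - 1))" "b = cdiff X (i - 1) y"
    using assms(2,3) by (auto simp: coboundaries_def)
  show ?thesis unfolding coboundaries_def
    by (rule image_eqI[of _ _ "x \<oplus>\<^bsub>cmod X (i - 1)\<^esub> y"])
      (use x y in \<open>simp_all add: rhom_add[OF cdiff_rhom'[OF X]]
        right_module.add_closed[OF cmod_module[OF X]]\<close>)
qed

lemma coboundaries_neg:
  assumes X: "bounded_complex A X" and "a \<in> coboundaries X i"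
  shows "\<ominus>\<^bsub>cmod X i\<^esub> a \<in> coboundaries X i"
proof -
  note m = cmod_module[OF X]
  obtain x where x: "x \<in> carrier (cmod X (i - 1))" "a = cdiff X (i - 1) x"
    using assms(2) by (auto simp: coboundaries_def)
  show ?thesis unfolding coboundaries_def
    by (rule image_eqI[of _ _ "\<ominus>\<^bsub>cmod X (i - 1)\<^esub> x"])
      (use x in \<open>simp_all add: rhom_neg[OF m m cdiff_rhom'[OF X]] right_module.neg_closed[OF m]\<close>)
qed

lemma coset_eq_iff:
  assumes X: "bounded_complex A X" and x: "x \<in> carrier (cmod X i)" and y: "y \<in> carrier (cmod X i)"
  shows "coboundaries X i +>\<^bsub>cmod X i\<^esub> x = coboundaries X i +>\<^bsub>cmod X i\<^esub> y \<longleftrightarrow>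
    (\<exists>b\<in>coboundaries X i. x = b \<oplus>\<^bsub>cmod X i\<^esub> y)"
proof -
  let ?M = "cmod X i"
  interpret M: right_module A "?M" by (rule cmod_module[OF X])
  let ?B = "coboundaries X i"
  note B = coboundaries_closed[OF X]
  have sub: "?B +>\<^bsub>?M\<^esub> x \<subseteq> ?B +>\<^bsub>?M\<^esub> y"
    if "b \<in> ?B" "x = b \<oplus>\<^bsub>?M\<^esub> y" "y \<in> carrier ?M" for b x y
    using that coboundaries_add[OF X] B by (auto simp: a_r_coset_def' M.add_assoc[symmetric])
  show ?thesis
  proof
    assume eq: "?B +>\<^bsub>?M\<^esub> x = ?B +>\<^bsub>?M\<^esub> y"
    have "x \<in> ?B +>\<^bsub>?M\<^esub> x"
      using coboundaries_zero[OF X] M.zero_add[OF x] by (force simp: a_r_coset_def')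
    then show "\<exists>b\<in>?B. x = b \<oplus>\<^bsub>?M\<^esub> y" unfolding eq by (auto simp: a_r_coset_def')
  next
    assume "\<exists>b\<in>?B. x = b \<oplus>\<^bsub>?M\<^esub> y"
    then obtain b where b: "b \<in> ?B" "x = b \<oplus>\<^bsub>?M\<^esub> y" by blast
    have "y = \<ominus>\<^bsub>?M\<^esub> b \<oplus>\<^bsub>?M\<^esub> x"
      using b(2) y B[OF b(1)] by (simp add: M.neg_closed M.add_assoc[symmetric] M.neg_add M.zero_add)
    from sub[OF b y] sub[OF coboundaries_neg[OF X b(1)] this x]
    show "?B +>\<^bsub>?M\<^esub> x = ?B +>\<^bsub>?M\<^esub> y" by blast
  qed
qed

lemma chain_map_coboundaries:
  assumes "chain_map A Z X s" "b \<in> coboundaries Z i"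
  shows "s i b \<in> coboundaries X i"
proof -
  obtain z where z: "z \<in> carrier (cmod Z (i - 1))" "b = cdiff Z (i - 1) z"
    using assms(2) by (auto simp: coboundaries_def)
  then show ?thesis unfolding coboundaries_def
    using chain_map_diff'[OF assms(1) z(1)] chain_map_closed[OF assms(1) z(1)] by auto
qed

lemma chain_map_cocycles:
  assumes "bounded_complex A Z" "bounded_complex A X" "chain_map A Z X s" "z \<in> cocycles Z i"
  shows "s i z \<in> cocycles X i"
proof -
  have "cdiff X i (s i z) = s (i + 1) (cdiff Z i z)"
    using chain_map_diff[OF assms(3) cocycles_closed[OF assms(4)]] by simp
  also have "\<dots> = \<zero>\<^bsub>cmod X (i + 1)\<^esub>"
    unfolding cocycles_diff[OF assms(4)]
    by (rule rhom_zero[OF cmod_module[OF assms(1)] cmod_module[OF assms(2)]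
          chain_map_rhom[OF assms(3)]])
  finally show ?thesis using chain_map_closed[OF assms(3)] assms(4) by (simp add: cocycles_def)
qed

text \<open>Identifies the map on cosets in \<open>quasi_iso\<close> with the one induced by
  \<open>s\<close> on representatives: \<open>s\<close> sends coboundaries to coboundaries, and
  these are absorbed by the summand \<open>coboundaries X i\<close>.\<close>

lemma chain_map_coset:
  assumes Z: "bounded_complex A Z" and X: "bounded_complex A X" and s: "chain_map A Z X s"
    and z: "z \<in> carrier (cmod Z i)"
  shows "coboundaries X i <+>\<^bsub>cmod X i\<^esub> (s i ` (coboundaries Z i +>\<^bsub>cmod Z i\<^esub> z)) =
    coboundaries X i +>\<^bsub>cmod X i\<^esub> s i z"
proof -
  let ?M = "cmod X i" and ?N = "cmod Z i" and ?C = "coboundaries X i"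
  interpret M: right_module A "?M" by (rule cmod_module[OF X])
  interpret N: right_module A "?N" by (rule cmod_module[OF Z])
  have "b \<oplus>\<^bsub>?M\<^esub> s i (c \<oplus>\<^bsub>?N\<^esub> z) = (b \<oplus>\<^bsub>?M\<^esub> s i c) \<oplus>\<^bsub>?M\<^esub> s i z"
    if "b \<in> ?C" "c \<in> coboundaries Z i" for b c
    using that z coboundaries_closed[OF X] coboundaries_closed[OF Z] chain_map_closed[OF s]
    by (simp add: rhom_add[OF chain_map_rhom[OF s]] M.add_assoc)
  moreover have "b \<oplus>\<^bsub>?M\<^esub> s i c \<in> ?C"
    if "b \<in> ?C" "c \<in> coboundaries Z i" for b c
    by (rule coboundaries_add[OF X that(1) chain_map_coboundaries[OF s that(2)]])
  moreover have "b \<oplus>\<^bsub>?M\<^esub> s i z = b \<oplus>\<^bsub>?M\<^esub> s i (\<zero>\<^bsub>?N\<^esub> \<oplus>\<^bsub>?N\<^esub> z)" for b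
    using z by (simp add: N.zero_add)
  moreover note coboundaries_zero[OF Z, of i]
  ultimately show ?thesis
    unfolding a_r_coset_def' set_add_def' by (auto 0 4)
qed

text \<open>Injectivity and surjectivity on cohomology, spelled out on representatives so that the
  later diagram chases need no cosets.\<close>

lemma quasi_iso_iff:
  assumes Z: "bounded_complex A Z" and X: "bounded_complex A X" and s: "chain_map A Z X s"
  shows "quasi_iso A Z X s \<longleftrightarrow>
    (\<forall>i. \<forall>z\<in>cocycles Z i. s i z \<in> coboundaries X i \<longrightarrow> z \<in> coboundaries Z i) \<and>
    (\<forall>i. \<forall>x\<in>cocycles X i. \<exists>z\<in>cocycles Z i. \<exists>b\<in>coboundaries X i. x = b \<oplus>\<^bsub>cmod X i\<^esub> s i z)"
proof -
  have "bij_betw (\<lambda>C. coboundaries X i <+>\<^bsub>cmod X i\<^esub> (s i ` C)) (cohomology Z i) (cohomology X i) \<longleftrightarrow>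
    (\<forall>z\<in>cocycles Z i. s i z \<in> coboundaries X i \<longrightarrow> z \<in> coboundaries Z i) \<and>
    (\<forall>x\<in>cocycles X i. \<exists>z\<in>cocycles Z i. \<exists>b\<in>coboundaries X i. x = b \<oplus>\<^bsub>cmod X i\<^esub> s i z)"
    (is "?bij \<longleftrightarrow> ?inj \<and> ?surj") for i
  proof -
    let ?M = "cmod X i" and ?N = "cmod Z i" and ?B = "coboundaries X i"
      and ?C = "coboundaries Z i"
    interpret M: right_module A "?M" by (rule cmod_module[OF X])
    interpret N: right_module A "?N" by (rule cmod_module[OF Z])
    interpret N': right_module A "cmod Z (i + 1)" by (rule cmod_module[OF Z])
    let ?G = "\<lambda>C. ?B <+>\<^bsub>?M\<^esub> (s i ` C)"
    let ?c = "\<lambda>z. ?C +>\<^bsub>?N\<^esub> z" and ?c' = "\<lambda>x. ?B +>\<^bsub>?M\<^esub> x"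
    note m = chain_map_coset[OF Z X s]
    have G: "?G (?c z) = ?c' (s i z)" if "z \<in> cocycles Z i" for z
      by (rule m[OF cocycles_closed[OF that]])
    have sz: "s i z \<in> carrier ?M" if "z \<in> cocycles Z i" for z
      using chain_map_closed[OF s cocycles_closed[OF that]] .
    have z0: "\<zero>\<^bsub>?N\<^esub> \<in> cocycles Z i"
      using rhom_zero[OF cmod_module[OF Z] cmod_module[OF Z] cdiff_rhom[OF Z]]
      by (simp add: cocycles_def N.zero_mem)
    have s0: "s i \<zero>\<^bsub>?N\<^esub> = \<zero>\<^bsub>?M\<^esub>"
      by (rule rhom_zero[OF cmod_module[OF Z] cmod_module[OF X] chain_map_rhom[OF s]])
    have inj: "inj_on ?G (cohomology Z i) \<longleftrightarrow> ?inj"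
    proof
      assume i: "inj_on ?G (cohomology Z i)"
      show ?inj
      proof (intro ballI impI)
        fix z assume z: "z \<in> cocycles Z i" and sb: "s i z \<in> ?B"
        have "?c' (s i z) = ?c' (s i \<zero>\<^bsub>?N\<^esub>)"
          using coset_eq_iff[OF X sz[OF z] sz[OF z0]] sb s0 M.add_zero[OF sz[OF z]] by force
        then have "?G (?c z) = ?G (?c \<zero>\<^bsub>?N\<^esub>)" using G[OF z] G[OF z0] by simp
        then have "?c z = ?c \<zero>\<^bsub>?N\<^esub>" using i z z0 by (simp add: inj_on_def cohomology_def)
        then obtain b where "b \<in> ?C" "z = b \<oplus>\<^bsub>?N\<^esub> \<zero>\<^bsub>?N\<^esub>"
          using coset_eq_iff[OF Z cocycles_closed[OF z] N.zero_mem] by blast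
        then show "z \<in> ?C" using N.add_zero coboundaries_closed[OF Z] by simp
      qed
    next
      assume i: ?inj
      show "inj_on ?G (cohomology Z i)"
      proof (rule inj_onI)
        fix C D assume "C \<in> cohomology Z i" "D \<in> cohomology Z i" and eq: "?G C = ?G D"
        then obtain z w where z: "z \<in> cocycles Z i" "C = ?c z" and w: "w \<in> cocycles Z i" "D = ?c w"
          by (auto simp: cohomology_def)
        note zc = cocycles_closed[OF z(1)] and wc = cocycles_closed[OF w(1)]
        have "?c' (s i z) = ?c' (s i w)" using eq z w G by simp
        then obtain b where b: "b \<in> ?B" "s i z = b \<oplus>\<^bsub>?M\<^esub> s i w"
          using coset_eq_iff[OF X sz[OF z(1)] sz[OF w(1)]] by blast
        let ?v = "z \<oplus>\<^bsub>?N\<^esub> (\<ominus>\<^bsub>?N\<^esub> w)"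
        have nw: "s i (\<ominus>\<^bsub>?N\<^esub> w) = \<ominus>\<^bsub>?M\<^esub> s i w"
          by (rule rhom_neg[OF cmod_module[OF Z] cmod_module[OF X] chain_map_rhom[OF s] wc])
        have "s i ?v = b"
          using b sz[OF w(1)] coboundaries_closed[OF X b(1)] zc wc
          by (simp add: rhom_add[OF chain_map_rhom[OF s]] N.neg_closed nw M.add_assoc M.neg_closed M.add_neg M.add_zero)
        moreover have "cdiff Z i (\<ominus>\<^bsub>?N\<^esub> w) = \<ominus>\<^bsub>cmod Z (i + 1)\<^esub> cdiff Z i w"
          by (rule rhom_neg[OF cmod_module[OF Z] cmod_module[OF Z] cdiff_rhom[OF Z] wc])
        then have "?v \<in> cocycles Z i"
          using z(1) w(1) by (simp add: cocycles_def N.add_closed N.neg_closed rhom_add[OF cdiff_rhom[OF Z]] N'.neg_zero N'.add_zero N'.zero_mem)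
        ultimately have "?v \<in> ?C" using i b(1) by blast
        moreover have "z = ?v \<oplus>\<^bsub>?N\<^esub> w" using zc wc by (simp add: N.add_assoc N.neg_closed N.neg_add N.add_zero)
        ultimately show "C = D" unfolding z(2) w(2) coset_eq_iff[OF Z zc wc] by blast
      qed
    qed
    have surj: "?G ` cohomology Z i = cohomology X i \<longleftrightarrow> ?surj"
    proof
      assume e: "?G ` cohomology Z i = cohomology X i"
      show ?surj
      proof
        fix x assume x: "x \<in> cocycles X i"
        then have "?c' x \<in> ?G ` cohomology Z i" unfolding e by (simp add: cohomology_def)
        then obtain z where z: "z \<in> cocycles Z i" "?c' x = ?c' (s i z)" using G by (auto simp: cohomology_def)
        then show "\<exists>z\<in>cocycles Z i. \<exists>b\<in>?B. x = b \<oplus>\<^bsub>?M\<^esub> s i z"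
          using coset_eq_iff[OF X cocycles_closed[OF x] sz[OF z(1)]] by blast
      qed
    next
      assume su: ?surj
      show "?G ` cohomology Z i = cohomology X i"
      proof
        show "?G ` cohomology Z i \<subseteq> cohomology X i"
          using G chain_map_cocycles[OF Z X s] by (auto simp: cohomology_def)
        show "cohomology X i \<subseteq> ?G ` cohomology Z i"
        proof
          fix C assume "C \<in> cohomology X i"
          then obtain x where x: "x \<in> cocycles X i" "C = ?c' x" by (auto simp: cohomology_def)
          obtain z b where z: "z \<in> cocycles Z i" "b \<in> ?B" "x = b \<oplus>\<^bsub>?M\<^esub> s i z"
            using su x(1) by blast
          then have "C = ?G (?c z)"
            unfolding x(2) G[OF z(1)] coset_eq_iff[OF X cocycles_closed[OF x(1)] sz[OF z(1)]] by blast
          then show "C \<in> ?G ` cohomology Z i" using z(1) by (auto simp: cohomology_def)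
        qed
      qed
    qed
    show ?thesis unfolding bij_betw_def inj surj by (rule refl)
  qed
  then show ?thesis using s unfolding quasi_iso_def by blast
qed

lemma quasi_iso_chain_map: "quasi_iso A Z X s \<Longrightarrow> chain_map A Z X s"
  by (simp add: quasi_iso_def)

lemma quasi_iso_inj:
  assumes "bounded_complex A Z" "bounded_complex A X" "quasi_iso A Z X s" "z \<in> cocycles Z i" "s i z \<in> coboundaries X i"
  shows "z \<in> coboundaries Z i"
  using quasi_iso_iff[OF assms(1,2) quasi_iso_chain_map[OF assms(3)]] assms(3-) by blast

lemma quasi_iso_surj:
  assumes "bounded_complex A Z" "bounded_complex A X" "quasi_iso A Z X s" "x \<in> cocycles X i"
  shows "\<exists>z\<in>cocycles Z i. \<exists>b\<in>coboundaries X i. x = b \<oplus>\<^bsub>cmod X i\<^esub> s i z"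
  using quasi_iso_iff[OF assms(1,2) quasi_iso_chain_map[OF assms(3)]] assms(3-) by blast

lemma quasi_iso_ccomp:
  assumes W: "bounded_complex A W" and Z: "bounded_complex A Z" and X: "bounded_complex A X"
    and u: "quasi_iso A W Z u" and s: "quasi_iso A Z X s"
  shows "quasi_iso A W X (ccomp s u)"
proof -
  note uc = quasi_iso_chain_map[OF u] and sc = quasi_iso_chain_map[OF s]
  show ?thesis
    unfolding quasi_iso_iff[OF W X chain_map_ccomp[OF uc sc]]
    unfolding ccomp_def
  proof (intro conjI allI ballI impI)
    fix i w assume w: "w \<in> cocycles W i" "s i (u i w) \<in> coboundaries X i"
    have "u i w \<in> coboundaries Z i"
      by (rule quasi_iso_inj[OF Z X s chain_map_cocycles[OF W Z uc w(1)] w(2)])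
    then show "w \<in> coboundaries W i" by (rule quasi_iso_inj[OF W Z u w(1)])
  next
    fix i x assume "x \<in> cocycles X i"
    then obtain z b where z: "z \<in> cocycles Z i" "b \<in> coboundaries X i" "x = b \<oplus>\<^bsub>cmod X i\<^esub> s i z"
      using quasi_iso_surj[OF Z X s] by blast
    obtain w c where w: "w \<in> cocycles W i" "c \<in> coboundaries Z i" "z = c \<oplus>\<^bsub>cmod Z i\<^esub> u i w"
      using quasi_iso_surj[OF W Z u z(1)] by blast
    interpret M: right_module A "cmod X i" by (rule cmod_module[OF X])
    have "x = (b \<oplus>\<^bsub>cmod X i\<^esub> s i c) \<oplus>\<^bsub>cmod X i\<^esub> s i (u i w)"
      using z(3) w coboundaries_closed[OF X z(2)] coboundaries_closed[OF Z w(2)] cocycles_closed[OF w(1)]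
        chain_map_closed[OF uc] chain_map_closed[OF sc]
      by (simp add: rhom_add[OF chain_map_rhom[OF sc]] M.add_assoc)
    then show "\<exists>w\<in>cocycles W i. \<exists>b\<in>coboundaries X i. x = b \<oplus>\<^bsub>cmod X i\<^esub> s i (u i w)"
      using w(1) coboundaries_add[OF X z(2) chain_map_coboundaries[OF sc w(2)]] by blast
  qed
qed

text \<open>On a cocycle \<open>x\<close> the homotopy term applied to \<open>dx\<close> vanishes,
  so \<open>f x\<close> and \<open>x\<close> differ by the coboundary
  \<open>d (h x)\<close>.\<close>

lemma homotopic_cid_quasi_iso:
  assumes X: "bounded_complex A X" and f: "chain_map A X X f" and hom: "homotopic A X X f cid"
  shows "quasi_iso A X X f"
proof -
  obtain h where Hh: "homotopy A X X f cid h" using hom by (rule homotopicE)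
  note h = homotopy_rhom[OF Hh] and eq = homotopy_eq[OF Hh]
  have key: "\<exists>b\<in>coboundaries X i. x = b \<oplus>\<^bsub>cmod X i\<^esub> f i x" if x: "x \<in> cocycles X i" for i x
  proof -
    interpret M: right_module A "cmod X i" by (rule cmod_module[OF X])
    note xc = cocycles_closed[OF x]
    have "h (i + 1) (cdiff X i x) = \<zero>\<^bsub>cmod X i\<^esub>"
      unfolding cocycles_diff[OF x]
      using rhom_zero[OF cmod_module[OF X] cmod_module[OF X] h[of "i + 1"]] by simp
    then have f: "f i x = x \<oplus>\<^bsub>cmod X i\<^esub> cdiff X (i - 1) (h i x)"
      using xc homotopy_terms_closed[OF X X h xc] by (simp add: eq cid_def M.add_zero)
    have b: "cdiff X (i - 1) (h i x) \<in> coboundaries X i"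
      using rhom_closed[OF h xc] by (simp add: coboundaries_def)
    show ?thesis
      by (rule bexI[OF _ coboundaries_neg[OF X b]])
        (use xc homotopy_terms_closed(1)[OF X X h xc] in
          \<open>simp add: f M.add_commute[OF xc] M.add_assoc[symmetric] M.neg_closed M.neg_add M.zero_add\<close>)
  qed
  show ?thesis
    unfolding quasi_iso_iff[OF X X f]
  proof (intro conjI allI ballI impI)
    fix i x assume x: "x \<in> cocycles X i" and "f i x \<in> coboundaries X i"
    then show "x \<in> coboundaries X i" using key[OF x] coboundaries_add[OF X] by metis
  next
    fix i x assume x: "x \<in> cocycles X i"
    then show "\<exists>z\<in>cocycles X i. \<exists>b\<in>coboundaries X i. x = b \<oplus>\<^bsub>cmod X i\<^esub> f i z"
      using key[OF x] by blast
  qed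
qed

lemma quasi_iso_cid: "bounded_complex A X \<Longrightarrow> quasi_iso A X X cid"
  by (rule homotopic_cid_quasi_iso[OF _ chain_map_cid homotopic_refl[OF _ chain_map_cid]])

section \<open>Morphisms from two-term complexes of projectives\<close>

text \<open>\<open>m\<close> is the lower of the two degrees. Projectivity of the terms is asked
  against modules with elements in \<open>'m\<close>, the type in which the middle objects of roofs
  live.\<close>

locale two_term =
  fixes A :: "('k::field, 'a) module" and X :: "('k, 'a, 'm) cplx" and m :: int
  assumes X: "bounded_complex A X"
    and outside: "\<And>i. i \<noteq> m \<Longrightarrow> i \<noteq> m + 1 \<Longrightarrow> carrier (cmod X i) = {\<zero>\<^bsub>cmod X i\<^esub>}"
    and lift: "\<And>i (M :: ('k, 'a, 'm) rmod). right_module A M \<Longrightarrow> liftable A (cmod X i) M"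
begin

lemmas mX = cmod_module[OF X]

lemma below: "carrier (cmod X (m - 1)) = {\<zero>\<^bsub>cmod X (m - 1)\<^esub>}"
  and above: "carrier (cmod X (m + 1 + 1)) = {\<zero>\<^bsub>cmod X (m + 1 + 1)\<^esub>}"
  by (auto intro!: outside)

lemma top_cocycles: "x \<in> carrier (cmod X (m + 1)) \<Longrightarrow> x \<in> cocycles X (m + 1)"
  using rhom_closed[OF cdiff_rhom[OF X, of "m + 1"]] above by (auto simp: cocycles_def)

lemma bottom_coboundaries: "coboundaries X m = {\<zero>\<^bsub>cmod X m\<^esub>}"
  unfolding coboundaries_def below using rhom_zero[OF mX mX cdiff_rhom'[OF X]] by simp

text \<open>The target family \<open>N\<close> is a parameter because the same construction is used
  for chain maps, with \<open>N = cmod Z\<close>, and for homotopies, with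
  \<open>N i = cmod Z (i - 1)\<close>.\<close>

definition glue :: "(int \<Rightarrow> ('k, 'a, 'm) rmod) \<Rightarrow> ('m \<Rightarrow> 'm) \<Rightarrow> ('m \<Rightarrow> 'm) \<Rightarrow> int \<Rightarrow> 'm \<Rightarrow> 'm" where
  "glue N f g i = (if i = m then f else if i = m + 1 then g else (\<lambda>x. \<zero>\<^bsub>N i\<^esub>))"

lemma glue_rhom:
  assumes "\<And>i. right_module A (N i)" "f \<in> rhom A (cmod X m) (N m)" "g \<in> rhom A (cmod X (m + 1)) (N (m + 1))"
  shows "glue N f g i \<in> rhom A (cmod X i) (N i)"
  using assms by (simp add: glue_def rhom_zero_map)

text \<open>Outside the degrees \<open>m\<close> and \<open>m + 1\<close> the zero element is the
  only one.\<close>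

lemma degree_cases:
  assumes x: "x \<in> carrier (cmod X i)"
    and "i = m \<Longrightarrow> Q i x" "i = m + 1 \<Longrightarrow> Q i x" "Q i \<zero>\<^bsub>cmod X i\<^esub>"
  shows "Q i x"
  using assms outside[of i] by (cases "i = m"; cases "i = m + 1") auto

text \<open>\<open>Z\<close> may be nonzero above degree \<open>m + 1\<close>, whence the condition
  \<open>g0\<close>. In the degrees where \<open>X\<close> is zero both sides of the square are
  zero.\<close>

lemma chain_map_glue:
  assumes Z: "bounded_complex A Z" and f: "f \<in> rhom A (cmod X m) (cmod Z m)"
    and g: "g \<in> rhom A (cmod X (m + 1)) (cmod Z (m + 1))"
    and fg: "\<And>x. x \<in> carrier (cmod X m) \<Longrightarrow> g (cdiff X m x) = cdiff Z m (f x)"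
    and g0: "\<And>x. x \<in> carrier (cmod X (m + 1)) \<Longrightarrow> cdiff Z (m + 1) (g x) = \<zero>\<^bsub>cmod Z (m + 1 + 1)\<^esub>"
  shows "chain_map A X Z (glue (cmod Z) f g)"
proof (rule chain_mapI)
  note mZ = cmod_module[OF Z]
  note r = glue_rhom[of "cmod Z", OF mZ f g]
  show "glue (cmod Z) f g i \<in> rhom A (cmod X i) (cmod Z i)" for i by (rule r)
  fix i x assume x: "x \<in> carrier (cmod X i)"
  show "glue (cmod Z) f g (i + 1) (cdiff X i x) = cdiff Z i (glue (cmod Z) f g i x)"
    using x
  proof (rule degree_cases[where Q = "\<lambda>i x. glue (cmod Z) f g (i + 1) (cdiff X i x) = cdiff Z i (glue (cmod Z) f g i x)"])
    assume "i = m"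
    then show "glue (cmod Z) f g (i + 1) (cdiff X i x) = cdiff Z i (glue (cmod Z) f g i x)"
      using fg x by (simp add: glue_def)
  next
    assume "i = m + 1"
    then show "glue (cmod Z) f g (i + 1) (cdiff X i x) = cdiff Z i (glue (cmod Z) f g i x)"
      using g0 x by (simp add: glue_def)
  next
    show "glue (cmod Z) f g (i + 1) (cdiff X i \<zero>\<^bsub>cmod X i\<^esub>) = cdiff Z i (glue (cmod Z) f g i \<zero>\<^bsub>cmod X i\<^esub>)"
      by (simp add: rhom_zero[OF mX mX cdiff_rhom[OF X]] rhom_zero[OF mZ mZ cdiff_rhom[OF Z]]
          rhom_zero[OF mX mZ r])
  qed
qed

text \<open>Injectivity of \<open>s\<close> on cohomology in degree \<open>m + 1\<close> gives some
  \<open>z\<close> with \<open>dz = w\<close>. The error \<open>s z - v\<close> is a cocycle in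
  degree \<open>m\<close>, where \<open>X\<close> has no nonzero coboundaries, so surjectivity
  yields a cocycle \<open>z'\<close> that hits it exactly; then \<open>z - z'\<close> is as
  required.\<close>

lemma lift_cocycle:
  assumes Z: "bounded_complex A (Z :: ('k, 'a, 'm) cplx)" and s: "quasi_iso A Z X s"
    and w: "w \<in> cocycles Z (m + 1)" and v: "v \<in> carrier (cmod X m)" and sw: "s (m + 1) w = cdiff X m v"
  shows "\<exists>z\<in>carrier (cmod Z m). cdiff Z m z = w \<and> s m z = v"
proof -
  let ?X0 = "cmod X m" and ?Z0 = "cmod Z m"
  note sc = quasi_iso_chain_map[OF s] and mZ = cmod_module[OF Z]
  note sr = chain_map_rhom[OF sc] and dX = cdiff_rhom[OF X] and dZ = cdiff_rhom[OF Z]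
  interpret X0: right_module A "?X0" by (rule mX)
  interpret X1: right_module A "cmod X (m + 1)" by (rule mX)
  interpret Z0: right_module A "?Z0" by (rule mZ)
  interpret Z1: right_module A "cmod Z (m + 1)" by (rule mZ)
  have "s (m + 1) w \<in> coboundaries X (m + 1)" using v sw by (auto simp: coboundaries_def)
  from quasi_iso_inj[OF Z X s w this] obtain z where z: "z \<in> carrier ?Z0" "w = cdiff Z m z"
    by (auto simp: coboundaries_def)
  note sz = chain_map_closed[OF sc z(1)]
  let ?c = "s m z \<oplus>\<^bsub>?X0\<^esub> (\<ominus>\<^bsub>?X0\<^esub> v)"
  have "cdiff X m ?c = \<zero>\<^bsub>cmod X (m + 1)\<^esub>"
    using chain_map_diff[OF sc z(1)] sw z(2) v sz
    by (simp add: rhom_add[OF dX] X0.neg_closed rhom_neg[OF mX mX dX] X1.add_neg rhom_closed[OF dX])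
  then have "?c \<in> cocycles X m" using sz v by (simp add: cocycles_def X0.add_closed X0.neg_closed)
  from quasi_iso_surj[OF Z X s this] obtain z' where z': "z' \<in> cocycles Z m" "?c = s m z'"
    using chain_map_closed[OF sc cocycles_closed] X0.zero_add unfolding bottom_coboundaries by auto
  note z'c = cocycles_closed[OF z'(1)]
  let ?z = "z \<oplus>\<^bsub>?Z0\<^esub> (\<ominus>\<^bsub>?Z0\<^esub> z')"
  have "cdiff Z m ?z = w"
    using z z'c cocycles_diff[OF z'(1)] rhom_closed[OF dZ z(1)]
    by (simp add: rhom_add[OF dZ] Z0.neg_closed rhom_neg[OF mZ mZ dZ] Z1.neg_zero Z1.add_zero)
  moreover have "s m ?z = v"
    using z z'c sz v
    by (simp add: rhom_add[OF sr] Z0.neg_closed rhom_neg[OF mZ mX sr] z'(2)[symmetric] X0.neg_sum X0.neg_neg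
        X0.neg_closed X0.add_closed X0.add_neg2)
  moreover have "?z \<in> carrier ?Z0" using z z'c by (simp add: Z0.add_closed Z0.neg_closed)
  ultimately show ?thesis by blast
qed

text \<open>
  Both statements are proved by lifting the identity of \<open>X\<close> degree by degree, starting at the top:
  surjectivity of \<open>s\<close> on cohomology provides the lifts in degree \<open>m + 1\<close>, and injectivity in degree
  \<open>m + 1\<close> together with surjectivity in degree \<open>m\<close> those in degree \<open>m\<close>.
\<close>

lemma quasi_iso_section:
  assumes Z: "bounded_complex A (Z :: ('k, 'a, 'm) cplx)" and s: "quasi_iso A Z X s"
  shows "\<exists>u. chain_map A X Z u \<and> homotopic A X X (ccomp s u) cid"
proof -
  let ?X0 = "cmod X m" and ?X1 = "cmod X (m + 1)" and ?Z0 = "cmod Z m"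
    and ?Z1 = "cmod Z (m + 1)"
  note sc = quasi_iso_chain_map[OF s] and mZ = cmod_module[OF Z]
  note sr = chain_map_rhom[OF sc]
  note dX = cdiff_rhom[OF X] and dZ = cdiff_rhom[OF Z]
  interpret X0: right_module A "?X0" by (rule mX)
  interpret X1: right_module A "?X1" by (rule mX)
  interpret Z0: right_module A "?Z0" by (rule mZ)
  interpret Z1: right_module A "?Z1" by (rule mZ)
  interpret Z2: right_module A "cmod Z (m + 1 + 1)" by (rule mZ)
  let ?dX = "cdiff X m" and ?dZ = "cdiff Z m" and ?d1 = "cdiff Z (m + 1)"
  \<comment> \<open>Top component of the section. The correcting \<open>y\<close> stays existential
    here, which keeps the condition a linear relation; a linear choice of \<open>y\<close> is made
    by a second lifting.\<close>
  have "\<exists>h\<in>rhom A ?X1 ?Z1. \<forall>x\<in>carrier ?X1.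
      ?d1 (h x) = \<zero>\<^bsub>cmod Z (m + 1 + 1)\<^esub> \<and>
      (\<exists>y\<in>carrier ?X0. s (m + 1) (h x) = x \<oplus>\<^bsub>?X1\<^esub> ?dX y)"
  proof (rule liftableD[OF lift[OF mZ], where R = "\<lambda>z x. ?d1 z = \<zero>\<^bsub>cmod Z (m + 1 + 1)\<^esub> \<and>
      (\<exists>y\<in>carrier ?X0. s (m + 1) z = x \<oplus>\<^bsub>?X1\<^esub> ?dX y)"], goal_cases)
    case 1
    show ?case
      using rhom_zero[OF mZ mZ dZ] rhom_zero[OF mX mX dX] rhom_zero[OF mZ mX sr] X1.zero_mem
      by (intro conjI bexI[OF _ X0.zero_mem]) (simp_all add: X1.add_zero)
  next
    case (2 z z' x x')
    then obtain y y' where y: "y \<in> carrier ?X0" "s (m + 1) z = x \<oplus>\<^bsub>?X1\<^esub> ?dX y"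
      and y': "y' \<in> carrier ?X0" "s (m + 1) z' = x' \<oplus>\<^bsub>?X1\<^esub> ?dX y'" by blast
    have "s (m + 1) (z \<oplus>\<^bsub>?Z1\<^esub> z') =
        (x \<oplus>\<^bsub>?X1\<^esub> x') \<oplus>\<^bsub>?X1\<^esub> ?dX (y \<oplus>\<^bsub>?X0\<^esub> y')"
      using 2 y y' rhom_closed[OF dX]
      by (simp add: rhom_add[OF sr] rhom_add[OF dX] X1.add_closed X1.add_assoc X1.add_lcomm)
    moreover have "?d1 (z \<oplus>\<^bsub>?Z1\<^esub> z') = \<zero>\<^bsub>cmod Z (m + 1 + 1)\<^esub>"
      by (simp only: rhom_add[OF dZ 2(1,2)] conjunct1[OF 2(5)] conjunct1[OF 2(6)] Z2.add_zero[OF Z2.zero_mem])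
    ultimately show ?case using X0.add_closed[OF y(1) y'(1)] by blast
  next
    case (3 z x a)
    then obtain y where y: "y \<in> carrier ?X0" "s (m + 1) z = x \<oplus>\<^bsub>?X1\<^esub> ?dX y" by blast
    have "s (m + 1) (ract ?Z1 z a) =
        ract ?X1 x a \<oplus>\<^bsub>?X1\<^esub> ?dX (ract ?X0 y a)"
      using 3 y rhom_closed[OF dX] by (simp add: rhom_ract[OF sr] rhom_ract[OF dX] X1.ract_add_left)
    moreover have "?d1 (ract ?Z1 z a) = \<zero>\<^bsub>cmod Z (m + 1 + 1)\<^esub>"
      by (simp only: rhom_ract[OF dZ 3(1,3)] conjunct1[OF 3(4)] Z2.ract_zero[OF 3(3)])
    ultimately show ?case using X0.ract_closed[OF y(1) 3(3)] by blast
  next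
    case (4 x)
    obtain z b where z: "z \<in> cocycles Z (m + 1)" and b: "b \<in> coboundaries X (m + 1)"
      and xz: "x = b \<oplus>\<^bsub>?X1\<^esub> s (m + 1) z"
      using quasi_iso_surj[OF Z X s top_cocycles[OF 4]] by blast
    have "\<ominus>\<^bsub>?X1\<^esub> b \<in> coboundaries X (m + 1)" by (rule coboundaries_neg[OF X b])
    then obtain y where y: "y \<in> carrier ?X0" "\<ominus>\<^bsub>?X1\<^esub> b = ?dX y"
      by (auto simp: coboundaries_def)
    have "s (m + 1) z = x \<oplus>\<^bsub>?X1\<^esub> ?dX y"
      using coboundaries_closed[OF X b] chain_map_closed[OF sc cocycles_closed[OF z]]
      unfolding y(2)[symmetric] xz
      by (simp add: X1.add_assoc X1.neg_closed X1.add_commute[of b] X1.add_closed X1.add_neg X1.add_zero X1.neg_add)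
    then show ?case using y(1) cocycles_closed[OF z] cocycles_diff[OF z] by blast
  qed
  then obtain u1 where u1: "u1 \<in> rhom A ?X1 ?Z1"
    and du1: "\<And>x. x \<in> carrier ?X1 \<Longrightarrow> ?d1 (u1 x) = \<zero>\<^bsub>cmod Z (m + 1 + 1)\<^esub>"
    and su1: "\<And>x. x \<in> carrier ?X1 \<Longrightarrow>
      \<exists>y\<in>carrier ?X0. s (m + 1) (u1 x) = x \<oplus>\<^bsub>?X1\<^esub> ?dX y" by blast
  have su1r: "(\<lambda>x. s (m + 1) (u1 x)) \<in> rhom A ?X1 ?X1" by (rule rhom_comp[OF u1 sr])
  \<comment> \<open>The linear choice of the correction, so that \<open>s u1 = 1 + dk\<close>. This
    \<open>k\<close> is the one nonzero component of the homotopy from \<open>s u\<close> to the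
    identity.\<close>
  have "\<exists>h\<in>rhom A ?X1 ?X0. \<forall>x\<in>carrier ?X1.
      s (m + 1) (u1 x) = x \<oplus>\<^bsub>?X1\<^esub> ?dX (h x)"
  proof (rule liftableD[OF lift[OF mX], where R = "\<lambda>y x. s (m + 1) (u1 x) = x \<oplus>\<^bsub>?X1\<^esub> ?dX y"], goal_cases)
    case 1
    show ?case using rhom_zero[OF mX mX dX] rhom_zero[OF mX mX su1r] X1.zero_mem by (simp add: X1.add_zero)
  next
    case (2 y y' x x')
    then show ?case using rhom_closed[OF dX]
      by (simp add: rhom_add[OF su1r] rhom_add[OF dX] X1.add_closed X1.add_assoc X1.add_lcomm)
  next
    case (3 y x a)
    then show ?case using rhom_closed[OF dX]
      by (simp add: rhom_ract[OF su1r] rhom_ract[OF dX] X1.ract_add_left)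
  next
    case (4 x)
    then show ?case by (rule su1)
  qed
  then obtain k where k: "k \<in> rhom A ?X1 ?X0"
    and sk: "\<And>x. x \<in> carrier ?X1 \<Longrightarrow> s (m + 1) (u1 x) = x \<oplus>\<^bsub>?X1\<^esub> ?dX (k x)" by blast
  have ud: "(\<lambda>x. u1 (?dX x)) \<in> rhom A ?X0 ?Z1" by (rule rhom_comp[OF dX u1])
  have kd: "(\<lambda>x. k (?dX x)) \<in> rhom A ?X0 ?X0" by (rule rhom_comp[OF dX k])
  \<comment> \<open>Bottom component of the section. The first condition makes \<open>u\<close> a
    chain map, the second is the homotopy equation in degree \<open>m\<close>; one lift has to meet
    both.\<close>
  have "\<exists>h\<in>rhom A ?X0 ?Z0. \<forall>x\<in>carrier ?X0.
      ?dZ (h x) = u1 (?dX x) \<and> s m (h x) = x \<oplus>\<^bsub>?X0\<^esub> k (?dX x)"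
  proof (rule liftableD[OF lift[OF mZ], where R = "\<lambda>z x. ?dZ z = u1 (?dX x) \<and> s m z = x \<oplus>\<^bsub>?X0\<^esub> k (?dX x)"], goal_cases)
    case 1
    show ?case using rhom_zero[OF mZ mZ dZ] rhom_zero[OF mX mZ ud] rhom_zero[OF mX mX kd] rhom_zero[OF mZ mX sr] X0.zero_mem
      by (simp add: X0.add_zero)
  next
    case (2 z z' x x')
    then show ?case using rhom_closed[OF kd]
      by (simp add: rhom_add[OF dZ] rhom_add[OF ud] rhom_add[OF kd] rhom_add[OF sr] X0.add_closed X0.add_assoc X0.add_lcomm)
  next
    case (3 z x a)
    then show ?case using rhom_closed[OF kd]
      by (simp add: rhom_ract[OF dZ] rhom_ract[OF ud] rhom_ract[OF kd] rhom_ract[OF sr] X0.ract_add_left)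
  next
    case (4 x)
    note dx = rhom_closed[OF dX 4]
    let ?w = "u1 (?dX x)"
    have w: "?w \<in> cocycles Z (m + 1)" using rhom_closed[OF u1 dx] du1[OF dx] by (simp add: cocycles_def)
    note kx = rhom_closed[OF kd 4]
    let ?v = "x \<oplus>\<^bsub>?X0\<^esub> k (?dX x)"
    have v: "?v \<in> carrier ?X0" using X0.add_closed[OF 4 kx] .
    have sw: "s (m + 1) ?w = ?dX ?v" unfolding sk[OF dx] rhom_add[OF dX 4 kx] ..
    show ?case using lift_cocycle[OF Z s w v sw] .
  qed
  then obtain u0 where u0: "u0 \<in> rhom A ?X0 ?Z0"
    and du0: "\<And>x. x \<in> carrier ?X0 \<Longrightarrow> ?dZ (u0 x) = u1 (?dX x)"
    and su0: "\<And>x. x \<in> carrier ?X0 \<Longrightarrow> s m (u0 x) = x \<oplus>\<^bsub>?X0\<^esub> k (?dX x)" by blast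
  let ?u = "glue (cmod Z) u0 u1"
  have u: "chain_map A X Z ?u" by (rule chain_map_glue[OF Z u0 u1]) (simp_all add: du0 du1)
  have "homotopic A X X (ccomp s ?u) cid"
  proof (rule homotopicI)
    let ?h = "glue (\<lambda>i. cmod X (i - 1)) (\<lambda>x. \<zero>\<^bsub>cmod X (m - 1)\<^esub>) k"
    show h: "?h i \<in> rhom A (cmod X i) (cmod X (i - 1))" for i
      by (rule glue_rhom) (use k mX rhom_zero_map[OF mX] in auto)
    fix i x assume x: "x \<in> carrier (cmod X i)"
    let ?Q = "\<lambda>i x. ccomp s ?u i x = cid i x \<oplus>\<^bsub>cmod X i\<^esub>
      (cdiff X (i - 1) (?h i x) \<oplus>\<^bsub>cmod X i\<^esub> ?h (i + 1) (cdiff X i x))"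
    show "?Q i x"
      using x
    proof (rule degree_cases[where Q = ?Q])
      assume i: "i = m"
      have "cdiff X (m - 1) \<zero>\<^bsub>cmod X (m - 1)\<^esub> = \<zero>\<^bsub>?X0\<^esub>" by (rule rhom_zero[OF mX mX cdiff_rhom'[OF X]])
      then show "?Q i x" using x unfolding i
        by (simp add: glue_def ccomp_def cid_def su0 X0.zero_add rhom_closed[OF kd])
    next
      assume i: "i = m + 1"
      then show "?Q i x" using x rhom_closed[OF dX rhom_closed[OF k]]
        by (simp add: glue_def ccomp_def cid_def sk X1.add_zero add.commute[of 1 m])
    next
      interpret Xi: right_module A "cmod X i" by (rule mX)
      have "?h (i + 1) \<zero>\<^bsub>cmod X (i + 1)\<^esub> = \<zero>\<^bsub>cmod X i\<^esub>" using rhom_zero[OF mX mX h[of "i + 1"]] by simp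
      then show "?Q i \<zero>\<^bsub>cmod X i\<^esub>"
        by (simp add: rhom_zero[OF mX mX h] rhom_zero[OF mX mX dX] rhom_zero[OF mX mX cdiff_rhom'[OF X]]
            ccomp_def cid_def rhom_zero[OF mX mZ chain_map_rhom[OF u]] rhom_zero[OF mZ mX sr] Xi.add_zero Xi.zero_mem)
    qed
  qed
  then show ?thesis using u by blast
qed

lemma quasi_iso_monic:
  assumes Z: "bounded_complex A (Z :: ('k, 'a, 'm) cplx)" and s: "quasi_iso A Z X s"
    and v: "chain_map A X Z v" and hom: "homotopic A X X (ccomp s v) (\<lambda>i x. \<zero>\<^bsub>cmod X i\<^esub>)"
  shows "homotopic A X Z v (\<lambda>i x. \<zero>\<^bsub>cmod Z i\<^esub>)"
proof -
  let ?X0 = "cmod X m" and ?X1 = "cmod X (m + 1)" and ?Z0 = "cmod Z m"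
  note sc = quasi_iso_chain_map[OF s] and mZ = cmod_module[OF Z]
  note sr = chain_map_rhom[OF sc] and vr = chain_map_rhom[OF v]
  note dX = cdiff_rhom[OF X] and dZ = cdiff_rhom[OF Z]
  interpret X0: right_module A "?X0" by (rule mX)
  interpret X1: right_module A "?X1" by (rule mX)
  interpret Z0: right_module A "?Z0" by (rule mZ)
  interpret Z1: right_module A "cmod Z (m + 1)" by (rule mZ)
  let ?dX = "cdiff X m" and ?dZ = "cdiff Z m" and ?d' = "cdiff Z (m - 1)"
  note dZ' = cdiff_rhom'[OF Z]
  obtain k where Hk: "homotopy A X X (ccomp s v) (\<lambda>i x. \<zero>\<^bsub>cmod X i\<^esub>) k" using hom by (rule homotopicE)
  note k = homotopy_rhom[OF Hk] and eq = homotopy_eq[OF Hk]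
  let ?k = "k (m + 1)"
  have kn: "k (i + 1) \<in> rhom A (cmod X (i + 1)) (cmod X i)" for i using k[of "i + 1"] by simp
  note kr = kn[of m]
  \<comment> \<open>Since \<open>X\<close> is zero outside two degrees, a single component
    \<open>?k\<close> of the null homotopy of \<open>s v\<close> survives.\<close>
  have sv1: "s (m + 1) (v (m + 1) x) = ?dX (?k x)" if x: "x \<in> carrier ?X1" for x
  proof -
    have "k (m + 1 + 1) (cdiff X (m + 1) x) = \<zero>\<^bsub>?X1\<^esub>"
      using cocycles_diff[OF top_cocycles[OF x]] rhom_zero[OF mX mX kn[of "m + 1"]] by simp
    then show ?thesis
      using eq[OF x] rhom_closed[OF dX rhom_closed[OF kr x]] by (simp add: ccomp_def X1.add_zero X1.zero_add)
  qed
  have sv0: "s m (v m x) = ?k (?dX x)" if x: "x \<in> carrier ?X0" for x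
  proof -
    have "k m x = \<zero>\<^bsub>cmod X (m - 1)\<^esub>" using rhom_closed[OF k x] below by simp
    then have "cdiff X (m - 1) (k m x) = \<zero>\<^bsub>?X0\<^esub>" by (simp add: rhom_zero[OF mX mX cdiff_rhom'[OF X]])
    then show ?thesis
      using eq[OF x] rhom_closed[OF kr rhom_closed[OF dX x]] by (simp add: ccomp_def X0.zero_add)
  qed
  \<comment> \<open>Besides \<open>dh = v\<close>, the lift is required to satisfy
    \<open>s h = ?k\<close>: this is what makes the remainder \<open>v - h1 d\<close> in degree
    \<open>m\<close> vanish under \<open>s\<close>.\<close>
  have "\<exists>h\<in>rhom A ?X1 ?Z0. \<forall>x\<in>carrier ?X1.
      ?dZ (h x) = v (m + 1) x \<and> s m (h x) = ?k x"
  proof (rule liftableD[OF lift[OF mZ], where R = "\<lambda>z x. ?dZ z = v (m + 1) x \<and> s m z = ?k x"], goal_cases)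
    case 1
    show ?case using rhom_zero[OF mZ mZ dZ] rhom_zero[OF mX mZ vr] rhom_zero[OF mX mX kr] rhom_zero[OF mZ mX sr] by simp
  next
    case (2 z z' x x')
    then show ?case by (simp add: rhom_add[OF dZ] rhom_add[OF vr] rhom_add[OF kr] rhom_add[OF sr])
  next
    case (3 z x a)
    then show ?case by (simp add: rhom_ract[OF dZ] rhom_ract[OF vr] rhom_ract[OF kr] rhom_ract[OF sr])
  next
    case (4 x)
    have w: "v (m + 1) x \<in> cocycles Z (m + 1)" by (rule chain_map_cocycles[OF X Z v top_cocycles[OF 4]])
    note kx = rhom_closed[OF kr 4]
    show ?case using lift_cocycle[OF Z s w kx sv1[OF 4]] .
  qed
  then obtain h1 where h1: "h1 \<in> rhom A ?X1 ?Z0"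
    and dh1: "\<And>x. x \<in> carrier ?X1 \<Longrightarrow> ?dZ (h1 x) = v (m + 1) x"
    and sh1: "\<And>x. x \<in> carrier ?X1 \<Longrightarrow> s m (h1 x) = ?k x" by blast
  have hd: "(\<lambda>x. h1 (?dX x)) \<in> rhom A ?X0 ?Z0" by (rule rhom_comp[OF dX h1])
  have "\<exists>h\<in>rhom A ?X0 (cmod Z (m - 1)). \<forall>x\<in>carrier ?X0.
      v m x = ?d' (h x) \<oplus>\<^bsub>?Z0\<^esub> h1 (?dX x)"
  proof (rule liftableD[OF lift[OF mZ], where R = "\<lambda>z x. v m x = ?d' z \<oplus>\<^bsub>?Z0\<^esub> h1 (?dX x)"], goal_cases)
    case 1
    show ?case using rhom_zero[OF mZ mZ dZ'] rhom_zero[OF mX mZ vr] rhom_zero[OF mX mZ hd] Z0.zero_mem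
      by (simp add: Z0.add_zero)
  next
    case (2 z z' x x')
    then show ?case using rhom_closed[OF dZ'] rhom_closed[OF hd]
      by (simp add: rhom_add[OF dZ'] rhom_add[OF vr] rhom_add[OF hd] Z0.add_closed Z0.add_assoc Z0.add_lcomm)
  next
    case (3 z x a)
    then show ?case using rhom_closed[OF dZ'] rhom_closed[OF hd]
      by (simp add: rhom_ract[OF dZ'] rhom_ract[OF vr] rhom_ract[OF hd] Z0.ract_add_left)
  next
    case (4 x)
    note dx = rhom_closed[OF dX 4] and vx = rhom_closed[OF vr 4] and hx = rhom_closed[OF hd 4]
    \<comment> \<open>A cocycle killed by \<open>s\<close>, hence a coboundary by injectivity on
      cohomology; its preimages furnish the homotopy component into degree \<open>m - 1\<close>,
      where \<open>Z\<close> may be nonzero.\<close>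
    let ?w = "v m x \<oplus>\<^bsub>?Z0\<^esub> (\<ominus>\<^bsub>?Z0\<^esub> h1 (?dX x))"
    have wc: "?w \<in> carrier ?Z0" using vx hx by (simp add: Z0.add_closed Z0.neg_closed)
    have "?dZ ?w = \<zero>\<^bsub>cmod Z (m + 1)\<^esub>"
      using vx hx chain_map_diff[OF v 4] dh1[OF dx] rhom_closed[OF dZ vx]
      by (simp add: rhom_add[OF dZ] Z0.neg_closed rhom_neg[OF mZ mZ dZ] Z1.add_neg)
    then have w: "?w \<in> cocycles Z m" using wc by (simp add: cocycles_def)
    have "s m ?w = \<zero>\<^bsub>?X0\<^esub>"
      using vx hx sv0[OF 4] sh1[OF dx] rhom_closed[OF kr dx]
      by (simp add: rhom_add[OF sr] Z0.neg_closed rhom_neg[OF mZ mX sr] X0.add_neg)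
    then have "s m ?w \<in> coboundaries X m" by (simp add: bottom_coboundaries)
    from quasi_iso_inj[OF Z X s w this] obtain z where z: "z \<in> carrier (cmod Z (m - 1))" "?w = ?d' z"
      by (auto simp: coboundaries_def)
    have "v m x = ?d' z \<oplus>\<^bsub>?Z0\<^esub> h1 (?dX x)"
      using vx hx unfolding z(2)[symmetric] by (simp add: Z0.add_assoc Z0.neg_closed Z0.neg_add Z0.add_zero)
    then show ?case using z(1) by blast
  qed
  then obtain h0 where h0: "h0 \<in> rhom A ?X0 (cmod Z (m - 1))"
    and vh0: "\<And>x. x \<in> carrier ?X0 \<Longrightarrow> v m x = ?d' (h0 x) \<oplus>\<^bsub>?Z0\<^esub> h1 (?dX x)" by blast
  show ?thesis
  proof (rule homotopicI)
    let ?h = "glue (\<lambda>i. cmod Z (i - 1)) h0 h1"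
    show h: "?h i \<in> rhom A (cmod X i) (cmod Z (i - 1))" for i
      by (rule glue_rhom) (use h0 h1 mZ in auto)
    fix i x assume x: "x \<in> carrier (cmod X i)"
    let ?Q = "\<lambda>i x. v i x = \<zero>\<^bsub>cmod Z i\<^esub> \<oplus>\<^bsub>cmod Z i\<^esub>
      (cdiff Z (i - 1) (?h i x) \<oplus>\<^bsub>cmod Z i\<^esub> ?h (i + 1) (cdiff X i x))"
    show "?Q i x"
      using x
    proof (rule degree_cases[where Q = ?Q])
      assume i: "i = m"
      show "?Q i x" using x rhom_closed[OF dZ' rhom_closed[OF h0]] rhom_closed[OF hd] unfolding i
        by (simp add: glue_def vh0 Z0.zero_add Z0.add_closed)
    next
      assume i: "i = m + 1"
      then show "?Q i x" using x rhom_closed[OF vr]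
        by (simp add: glue_def dh1 Z1.add_zero Z1.zero_add add.commute[of 1 m])
    next
      interpret Zi: right_module A "cmod Z i" by (rule mZ)
      have "?h (i + 1) \<zero>\<^bsub>cmod X (i + 1)\<^esub> = \<zero>\<^bsub>cmod Z i\<^esub>" using rhom_zero[OF mX mZ h[of "i + 1"]] by simp
      then show "?Q i \<zero>\<^bsub>cmod X i\<^esub>"
        by (simp add: rhom_zero[OF mX mZ h] rhom_zero[OF mX mX dX] rhom_zero[OF mZ mZ dZ']
            rhom_zero[OF mX mZ vr] Zi.add_zero Zi.zero_mem)
    qed
  qed
qed

end

section \<open>Morphisms in the derived category\<close>

lemma ccomp_assoc: "ccomp h (ccomp g f) = ccomp (ccomp h g) f"
  and ccomp_cid [simp]: "ccomp f cid = f" "ccomp cid f = f"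
  by (simp_all add: ccomp_def cid_def)

lemma (in right_module) zero_scale: "x \<in> carrier M \<Longrightarrow> 0 \<odot>\<^bsub>M\<^esub> x = \<zero>\<^bsub>M\<^esub>"
  using smult_l_null[of x] by simp

lemma (in right_module) add_minus_one_scale:
  "x \<in> carrier M \<Longrightarrow> x \<oplus>\<^bsub>M\<^esub> (- 1) \<odot>\<^bsub>M\<^esub> x = \<zero>\<^bsub>M\<^esub>"
  "x \<in> carrier M \<Longrightarrow> (- 1) \<odot>\<^bsub>M\<^esub> x \<oplus>\<^bsub>M\<^esub> x = \<zero>\<^bsub>M\<^esub>"
  using add_scale[of x 1 "- 1"] add_scale[of x "- 1" 1] by (simp_all add: one_scale zero_scale)

context two_term
begin

text \<open>\<open>quasi_iso_monic\<close> applied to the difference of \<open>v\<close> and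
  \<open>v'\<close>, written with the scalar -1 so that the lemmas on sums and multiples of chain
  maps cover it.\<close>

lemma quasi_iso_cancel:
  assumes Z: "bounded_complex A (Z :: ('k, 'a, 'm) cplx)" and s: "quasi_iso A Z X s"
    and v: "chain_map A X Z v" and v': "chain_map A X Z v'"
    and hom: "homotopic A X X (ccomp s v) (ccomp s v')"
  shows "homotopic A X Z v v'"
proof -
  note sc = quasi_iso_chain_map[OF s] and mZ = cmod_module[OF Z]
  have nv': "chain_map A X Z (\<lambda>i x. (- 1) \<odot>\<^bsub>cmod Z i\<^esub> v' i x)" by (rule chain_map_smult[OF Z v'])
  let ?w = "\<lambda>i x. v i x \<oplus>\<^bsub>cmod Z i\<^esub> (- 1) \<odot>\<^bsub>cmod Z i\<^esub> v' i x"
  have w: "chain_map A X Z ?w" by (rule chain_map_sum[OF Z v nv'])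
  have sv': "chain_map A X X (ccomp s v')" by (rule chain_map_ccomp[OF v' sc])
  have sv: "chain_map A X X (ccomp s v)" by (rule chain_map_ccomp[OF v sc])
  have nsv': "chain_map A X X (\<lambda>i x. (- 1) \<odot>\<^bsub>cmod X i\<^esub> ccomp s v' i x)" by (rule chain_map_smult[OF X sv'])
  have z: "chain_map A X X (\<lambda>i x. \<zero>\<^bsub>cmod X i\<^esub>)" by (rule chain_map_zero[OF X])
  have zZ: "chain_map A X Z (\<lambda>i x. \<zero>\<^bsub>cmod Z i\<^esub>)" by (rule chain_map_zero[OF Z])
  have "homotopic A X X (ccomp s ?w) (\<lambda>i x. ccomp s v i x \<oplus>\<^bsub>cmod X i\<^esub> (- 1) \<odot>\<^bsub>cmod X i\<^esub> ccomp s v' i x)"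
    by (rule homotopic_eqI[OF X chain_map_sum[OF X sv nsv']])
      (simp add: ccomp_def rhom_add[OF chain_map_rhom[OF sc]] rhom_scale[OF chain_map_rhom[OF sc]]
        chain_map_closed[OF v] chain_map_closed[OF v'] right_module.scale_closed[OF mZ])
  moreover have "homotopic A X X (\<lambda>i x. ccomp s v i x \<oplus>\<^bsub>cmod X i\<^esub> (- 1) \<odot>\<^bsub>cmod X i\<^esub> ccomp s v' i x)
      (\<lambda>i x. ccomp s v' i x \<oplus>\<^bsub>cmod X i\<^esub> (- 1) \<odot>\<^bsub>cmod X i\<^esub> ccomp s v' i x)"
    by (rule homotopic_sum[OF X X sv' nsv' hom homotopic_refl[OF X nsv']])
  moreover have "homotopic A X X (\<lambda>i x. ccomp s v' i x \<oplus>\<^bsub>cmod X i\<^esub> (- 1) \<odot>\<^bsub>cmod X i\<^esub> ccomp s v' i x)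
      (\<lambda>i x. \<zero>\<^bsub>cmod X i\<^esub>)"
    by (rule homotopic_eqI[OF X z]) (simp add: right_module.add_minus_one_scale[OF mX] chain_map_closed[OF sv'])
  ultimately have "homotopic A X X (ccomp s ?w) (\<lambda>i x. \<zero>\<^bsub>cmod X i\<^esub>)"
    using homotopic_trans[OF X X z] by blast
  then have w0: "homotopic A X Z ?w (\<lambda>i x. \<zero>\<^bsub>cmod Z i\<^esub>)" by (rule quasi_iso_monic[OF Z s w])
  have "homotopic A X Z v (\<lambda>i x. ?w i x \<oplus>\<^bsub>cmod Z i\<^esub> v' i x)"
  proof (rule homotopic_eqI[OF Z chain_map_sum[OF Z w v']])
    fix i x assume x: "x \<in> carrier (cmod X i)"
    interpret M: right_module A "cmod Z i" by (rule mZ)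
    show "v i x = ?w i x \<oplus>\<^bsub>cmod Z i\<^esub> v' i x"
      using chain_map_closed[OF v x] chain_map_closed[OF v' x]
      by (simp add: M.add_assoc M.scale_closed M.add_minus_one_scale M.add_zero)
  qed
  moreover have "homotopic A X Z (\<lambda>i x. ?w i x \<oplus>\<^bsub>cmod Z i\<^esub> v' i x) (\<lambda>i x. \<zero>\<^bsub>cmod Z i\<^esub> \<oplus>\<^bsub>cmod Z i\<^esub> v' i x)"
    by (rule homotopic_sum[OF X Z zZ v' w0 homotopic_refl[OF Z v']])
  moreover have "homotopic A X Z (\<lambda>i x. \<zero>\<^bsub>cmod Z i\<^esub> \<oplus>\<^bsub>cmod Z i\<^esub> v' i x) v'"
    by (rule homotopic_eqI[OF Z v']) (simp add: right_module.zero_add[OF mZ] chain_map_closed[OF v'])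
  ultimately show ?thesis using homotopic_trans[OF X Z v'] by blast
qed

definition homotopy_section :: "('k, 'a, 'm) cplx \<Rightarrow> (int \<Rightarrow> 'm \<Rightarrow> 'm) \<Rightarrow> (int \<Rightarrow> 'm \<Rightarrow> 'm) \<Rightarrow> bool" where
  "homotopy_section Z s u \<longleftrightarrow> chain_map A X Z u \<and> homotopic A X X (ccomp s u) cid"

lemma homotopy_section_unique:
  assumes Z: "bounded_complex A Z" and s: "quasi_iso A Z X s"
    and u: "homotopy_section Z s u" and v: "homotopy_section Z s v"
  shows "homotopic A X Z u v"
proof (rule quasi_iso_cancel[OF Z s])
  have "homotopic A X X cid (ccomp s v)"
    by (rule homotopic_sym[OF X X chain_map_cid]) (use v in \<open>simp add: homotopy_section_def\<close>)
  then show "homotopic A X X (ccomp s u) (ccomp s v)"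
    using u v homotopic_trans[OF X X chain_map_ccomp[OF _ quasi_iso_chain_map[OF s]], of v]
    unfolding homotopy_section_def by blast
qed (use u v in \<open>auto simp: homotopy_section_def\<close>)

lemma homotopy_section_exists:
  "bounded_complex A Z \<Longrightarrow> quasi_iso A Z X s \<Longrightarrow> \<exists>u. homotopy_section Z s u"
  unfolding homotopy_section_def by (rule quasi_iso_section)

lemma homotopy_section_cid: "homotopy_section X cid cid"
  unfolding homotopy_section_def by (simp add: chain_map_cid homotopic_refl[OF X])

text \<open>
  A roof \<open>X \<leftarrow> Z \<rightarrow> Y\<close> is determined by the homotopy class of its right leg composed with a section
  of its left leg, so that morphisms from \<open>X\<close> are homotopy classes of chain maps.
\<close>

lemma roof_equiv_iff:
  assumes Y: "bounded_complex A Y" and r: "(Z, s, f) \<in> roofs A X Y" and r': "(Z', s', f') \<in> roofs A X Y"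
    and u: "homotopy_section Z s u" and u': "homotopy_section Z' s' u'"
  shows "roof_equiv A X Y (Z, s, f) (Z', s', f') \<longleftrightarrow> homotopic A X Y (ccomp f u) (ccomp f' u')"
proof -
  have Z: "bounded_complex A Z" "quasi_iso A Z X s" "chain_map A Z Y f" using r by (auto simp: roofs_def)
  have Z': "bounded_complex A Z'" "quasi_iso A Z' X s'" "chain_map A Z' Y f'" using r' by (auto simp: roofs_def)
  have uc: "chain_map A X Z u" "homotopic A X X (ccomp s u) cid"
    and uc': "chain_map A X Z' u'" "homotopic A X X (ccomp s' u') cid"
    using u u' by (auto simp: homotopy_section_def)
  note sc = quasi_iso_chain_map[OF Z(2)] and sc' = quasi_iso_chain_map[OF Z'(2)]
  show ?thesis
  proof
    assume "roof_equiv A X Y (Z, s, f) (Z', s', f')"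
    then obtain W :: "('k, 'a, 'm) cplx" and a b where W: "bounded_complex A W"
      and a: "chain_map A W Z a" and b: "chain_map A W Z' b" and q: "quasi_iso A W X (ccomp s a)"
      and sab: "homotopic A W X (ccomp s a) (ccomp s' b)" and fab: "homotopic A W Y (ccomp f a) (ccomp f' b)"
      by auto
    \<comment> \<open>A section of the refined left leg. Then \<open>a w\<close> and
      \<open>b w\<close> are sections of \<open>s\<close> and \<open>s'\<close>, hence homotopic to
      \<open>u\<close> and \<open>u'\<close> by uniqueness.\<close>
    obtain w where w: "chain_map A X W w" "homotopic A X X (ccomp (ccomp s a) w) cid"
      using homotopy_section_exists[OF W q] by (auto simp: homotopy_section_def)
    have aw: "chain_map A X Z (ccomp a w)" and bw: "chain_map A X Z' (ccomp b w)"
      using chain_map_ccomp w(1) a b by blast+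
    have "homotopic A X X (ccomp (ccomp s' b) w) (ccomp (ccomp s a) w)"
      by (rule homotopic_sym[OF X X _ homotopic_ccomp_right[OF w(1) sab]])
        (use chain_map_ccomp[OF w(1) chain_map_ccomp[OF b sc']] in simp)
    then have "homotopic A X X (ccomp s' (ccomp b w)) cid"
      using homotopic_trans[OF X X chain_map_cid _ w(2)] by (simp add: ccomp_assoc)
    then have "homotopy_section Z' s' (ccomp b w)" using bw by (simp add: homotopy_section_def)
    then have ub: "homotopic A X Z' (ccomp b w) u'" using homotopy_section_unique[OF Z'(1,2)] u' by blast
    have "homotopy_section Z s (ccomp a w)" using w aw by (simp add: homotopy_section_def ccomp_assoc)
    then have ua: "homotopic A X Z u (ccomp a w)" using homotopy_section_unique[OF Z(1,2)] u by blast
    have "homotopic A X Y (ccomp f u) (ccomp f (ccomp a w))" by (rule homotopic_ccomp_left[OF X Z(1) aw Z(3) ua])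
    moreover have "homotopic A X Y (ccomp f (ccomp a w)) (ccomp f' (ccomp b w))"
      unfolding ccomp_assoc by (rule homotopic_ccomp_right[OF w(1) fab])
    moreover have "homotopic A X Y (ccomp f' (ccomp b w)) (ccomp f' u')"
      by (rule homotopic_ccomp_left[OF X Z'(1) uc'(1) Z'(3) ub])
    ultimately show "homotopic A X Y (ccomp f u) (ccomp f' u')"
      using homotopic_trans[OF X Y chain_map_ccomp[OF uc'(1) Z'(3)]] by blast
  next
    assume h: "homotopic A X Y (ccomp f u) (ccomp f' u')"
    \<comment> \<open>For the converse, \<open>X\<close> itself with the maps \<open>u\<close> and
      \<open>u'\<close> is the common refinement.\<close>
    have "quasi_iso A X X (ccomp s u)"
      by (rule homotopic_cid_quasi_iso[OF X chain_map_ccomp[OF uc(1) sc] uc(2)])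
    moreover have su': "chain_map A X X (ccomp s' u')" by (rule chain_map_ccomp[OF uc'(1) sc'])
    then have "homotopic A X X (ccomp s u) (ccomp s' u')"
      using homotopic_trans[OF X X su' uc(2) homotopic_sym[OF X X chain_map_cid uc'(2)]] by blast
    ultimately show "roof_equiv A X Y (Z, s, f) (Z', s', f')"
      using X uc(1) uc'(1) h by auto
  qed
qed

section \<open>Derived Hom spaces in terms of homotopy classes of chain maps\<close>

lemma cid_roof: "chain_map A X Y f \<Longrightarrow> (X, cid, f) \<in> roofs A X Y"
  by (simp add: roofs_def X quasi_iso_cid)

lemma roof_section:
  assumes "(Z, s, f) \<in> roofs A X Y"
  obtains u where "homotopy_section Z s u" "chain_map A X Y (ccomp f u)"
proof -
  have Z: "bounded_complex A Z" "quasi_iso A Z X s" "chain_map A Z Y f" using assms by (auto simp: roofs_def)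
  obtain u where u: "homotopy_section Z s u" using homotopy_section_exists[OF Z(1,2)] by blast
  then have "chain_map A X Y (ccomp f u)" using chain_map_ccomp[OF _ Z(3)] by (auto simp: homotopy_section_def)
  then show ?thesis using u that by blast
qed

lemma mem_D_of_chain_map:
  assumes Y: "bounded_complex A Y" and f: "chain_map A X Y f" and u: "homotopy_section Z s u"
  shows "(Z, s, g) \<in> D_of_chain_map A X Y f \<longleftrightarrow>
    (Z, s, g) \<in> roofs A X Y \<and> homotopic A X Y f (ccomp g u)"
  using roof_equiv_iff[OF Y cid_roof[OF f] _ homotopy_section_cid u]
  by (auto simp: D_of_chain_map_def roof_class_def simp del: roof_equiv.simps)

lemma D_of_chain_map_eq_iff:
  assumes Y: "bounded_complex A Y" and f: "chain_map A X Y f" and g: "chain_map A X Y g"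
  shows "D_of_chain_map A X Y f = D_of_chain_map A X Y g \<longleftrightarrow> homotopic A X Y f g"
proof
  assume eq: "D_of_chain_map A X Y f = D_of_chain_map A X Y g"
  have "(X, cid, g) \<in> D_of_chain_map A X Y g"
    using mem_D_of_chain_map[OF Y g homotopy_section_cid] cid_roof[OF g] homotopic_refl[OF Y g] by simp
  then show "homotopic A X Y f g"
    using mem_D_of_chain_map[OF Y f homotopy_section_cid, of g] unfolding eq by simp
next
  assume fg: "homotopic A X Y f g"
  then have gf: "homotopic A X Y g f" by (rule homotopic_sym[OF X Y g])
  have "(Z, s, h) \<in> D_of_chain_map A X Y f \<longleftrightarrow> (Z, s, h) \<in> D_of_chain_map A X Y g" for Z s h
  proof (cases "(Z, s, h) \<in> roofs A X Y")
    case True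
    then obtain u where u: "homotopy_section Z s u" "chain_map A X Y (ccomp h u)" by (rule roof_section)
    show ?thesis
      unfolding mem_D_of_chain_map[OF Y f u(1)] mem_D_of_chain_map[OF Y g u(1)]
      using homotopic_trans[OF X Y u(2)] fg gf by blast
  qed (auto simp: D_of_chain_map_def roof_class_def)
  then show "D_of_chain_map A X Y f = D_of_chain_map A X Y g" by auto
qed

lemma roof_class_eq:
  assumes Y: "bounded_complex A Y" and r: "(Z, s, f) \<in> roofs A X Y" and u: "homotopy_section Z s u"
  shows "roof_class A X Y (Z, s, f) = D_of_chain_map A X Y (ccomp f u)"
proof -
  have fu: "chain_map A X Y (ccomp f u)"
    using r u chain_map_ccomp by (auto simp: roofs_def homotopy_section_def)
  have "(Z', s', f') \<in> roof_class A X Y (Z, s, f) \<longleftrightarrow> (Z', s', f') \<in> D_of_chain_map A X Y (ccomp f u)" for Z' s' f'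
  proof (cases "(Z', s', f') \<in> roofs A X Y")
    case True
    then obtain u' where u': "homotopy_section Z' s' u'" by (rule roof_section)
    show ?thesis
      unfolding mem_D_of_chain_map[OF Y fu u']
      using roof_equiv_iff[OF Y r True u u'] True by (simp add: roof_class_def del: roof_equiv.simps)
  qed (auto simp: D_of_chain_map_def roof_class_def)
  then show ?thesis by auto
qed

lemma carrier_D_hom:
  assumes Y: "bounded_complex A Y"
  shows "carrier (D_hom A X Y) = {D_of_chain_map A X Y f | f. chain_map A X Y f}"
proof -
  have "roof_class A X Y ` roofs A X Y = {D_of_chain_map A X Y f | f. chain_map A X Y f}"
  proof (intro equalityI subsetI)
    fix \<xi> assume "\<xi> \<in> roof_class A X Y ` roofs A X Y"
    then obtain Z s f where r: "(Z, s, f) \<in> roofs A X Y" "\<xi> = roof_class A X Y (Z, s, f)" by (auto elim!: imageE)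
    obtain u where "homotopy_section Z s u" "chain_map A X Y (ccomp f u)" using r(1) by (rule roof_section)
    then show "\<xi> \<in> {D_of_chain_map A X Y f | f. chain_map A X Y f}"
      using roof_class_eq[OF Y r(1)] r(2) by blast
  next
    fix \<xi> assume "\<xi> \<in> {D_of_chain_map A X Y f | f. chain_map A X Y f}"
    then show "\<xi> \<in> roof_class A X Y ` roofs A X Y" using cid_roof by (auto simp: D_of_chain_map_def)
  qed
  then show ?thesis by (simp add: D_hom_def)
qed

lemma zero_D_hom: "\<zero>\<^bsub>D_hom A X Y\<^esub> = D_of_chain_map A X Y (\<lambda>i x. \<zero>\<^bsub>cmod Y i\<^esub>)"
  by (simp add: D_hom_def)

lemma D_hom_trivial_iff:
  assumes Y: "bounded_complex A Y"
  shows "carrier (D_hom A X Y) = {\<zero>\<^bsub>D_hom A X Y\<^esub>} \<longleftrightarrow>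
    (\<forall>f. chain_map A X Y f \<longrightarrow> homotopic A X Y f (\<lambda>i x. \<zero>\<^bsub>cmod Y i\<^esub>))"
  unfolding carrier_D_hom[OF Y] zero_D_hom
  using D_of_chain_map_eq_iff[OF Y _ chain_map_zero[OF Y]] chain_map_zero[OF Y] by fastforce

text \<open>All members of the union that defines the sum are one and the same class, so the union
  is that class; representatives with denominator \<open>cid\<close> show that there is a
  member.\<close>

lemma D_hom_add:
  assumes Y: "bounded_complex A Y" and f: "chain_map A X Y f" and g: "chain_map A X Y g"
  shows "D_of_chain_map A X Y f \<oplus>\<^bsub>D_hom A X Y\<^esub> D_of_chain_map A X Y g =
    D_of_chain_map A X Y (\<lambda>i x. f i x \<oplus>\<^bsub>cmod Y i\<^esub> g i x)" (is "_ = ?fg")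
proof -
  let ?S = "{roof_class A X Y (W, t, \<lambda>i x. f' i x \<oplus>\<^bsub>cmod Y i\<^esub> g' i x) | W t f' g'.
    (W, t, f') \<in> D_of_chain_map A X Y f \<and> (W, t, g') \<in> D_of_chain_map A X Y g}"
  note fg = chain_map_sum[OF Y f g]
  have "roof_class A X Y (W, t, \<lambda>i x. f' i x \<oplus>\<^bsub>cmod Y i\<^esub> g' i x) = ?fg"
    if f': "(W, t, f') \<in> D_of_chain_map A X Y f" and g': "(W, t, g') \<in> D_of_chain_map A X Y g" for W t f' g'
  proof -
    have r: "(W, t, f') \<in> roofs A X Y" "(W, t, g') \<in> roofs A X Y"
      using f' g' by (auto simp: D_of_chain_map_def roof_class_def)
    then have c: "chain_map A W Y f'" "chain_map A W Y g'" by (auto simp: roofs_def)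
    have r': "(W, t, \<lambda>i x. f' i x \<oplus>\<^bsub>cmod Y i\<^esub> g' i x) \<in> roofs A X Y"
      using r chain_map_sum[OF Y c] by (simp add: roofs_def)
    obtain u where u: "homotopy_section W t u" using r(1) by (rule roof_section)
    then have uc: "chain_map A X W u" by (simp add: homotopy_section_def)
    have fu: "chain_map A X Y (ccomp f' u)" "chain_map A X Y (ccomp g' u)"
      using chain_map_ccomp[OF uc] c by blast+
    have "homotopic A X Y f (ccomp f' u)" "homotopic A X Y g (ccomp g' u)"
      using f' g' mem_D_of_chain_map[OF Y f u] mem_D_of_chain_map[OF Y g u] by blast+
    from homotopic_sum[OF X Y fu this]
    have "homotopic A X Y (\<lambda>i x. f i x \<oplus>\<^bsub>cmod Y i\<^esub> g i x) (ccomp (\<lambda>i x. f' i x \<oplus>\<^bsub>cmod Y i\<^esub> g' i x) u)"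
      by (simp add: ccomp_def)
    moreover have "chain_map A X Y (ccomp (\<lambda>i x. f' i x \<oplus>\<^bsub>cmod Y i\<^esub> g' i x) u)"
      by (rule chain_map_ccomp[OF uc chain_map_sum[OF Y c]])
    ultimately show ?thesis
      unfolding roof_class_eq[OF Y r' u] using D_of_chain_map_eq_iff[OF Y fg] by blast
  qed
  moreover have "(X, cid, f) \<in> D_of_chain_map A X Y f" "(X, cid, g) \<in> D_of_chain_map A X Y g"
    using mem_D_of_chain_map[OF Y f homotopy_section_cid] mem_D_of_chain_map[OF Y g homotopy_section_cid]
      cid_roof f g homotopic_refl[OF Y] by auto
  ultimately have "?S = {?fg}" by blast
  then show ?thesis by (simp add: D_hom_def)
qed

lemma D_hom_smult:
  assumes Y: "bounded_complex A Y" and f: "chain_map A X Y f"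
  shows "c \<odot>\<^bsub>D_hom A X Y\<^esub> D_of_chain_map A X Y f =
    D_of_chain_map A X Y (\<lambda>i x. c \<odot>\<^bsub>cmod Y i\<^esub> f i x)" (is "_ = ?cf")
proof -
  let ?S = "{roof_class A X Y (W, t, \<lambda>i x. c \<odot>\<^bsub>cmod Y i\<^esub> f' i x) | W t f'.
    (W, t, f') \<in> D_of_chain_map A X Y f}"
  note cf = chain_map_smult[OF Y f]
  have "roof_class A X Y (W, t, \<lambda>i x. c \<odot>\<^bsub>cmod Y i\<^esub> f' i x) = ?cf"
    if f': "(W, t, f') \<in> D_of_chain_map A X Y f" for W t f'
  proof -
    have r: "(W, t, f') \<in> roofs A X Y" using f' by (auto simp: D_of_chain_map_def roof_class_def)
    then have cm: "chain_map A W Y f'" by (auto simp: roofs_def)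
    have r': "(W, t, \<lambda>i x. c \<odot>\<^bsub>cmod Y i\<^esub> f' i x) \<in> roofs A X Y"
      using r chain_map_smult[OF Y cm] by (simp add: roofs_def)
    obtain u where u: "homotopy_section W t u" using r by (rule roof_section)
    then have uc: "chain_map A X W u" by (simp add: homotopy_section_def)
    have fu: "chain_map A X Y (ccomp f' u)" by (rule chain_map_ccomp[OF uc cm])
    have "homotopic A X Y f (ccomp f' u)" using f' mem_D_of_chain_map[OF Y f u] by blast
    from homotopic_smult[OF X Y fu this, of c]
    have "homotopic A X Y (\<lambda>i x. c \<odot>\<^bsub>cmod Y i\<^esub> f i x) (ccomp (\<lambda>i x. c \<odot>\<^bsub>cmod Y i\<^esub> f' i x) u)"
      by (simp add: ccomp_def)
    moreover have "chain_map A X Y (ccomp (\<lambda>i x. c \<odot>\<^bsub>cmod Y i\<^esub> f' i x) u)"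
      by (rule chain_map_ccomp[OF uc chain_map_smult[OF Y cm]])
    ultimately show ?thesis
      unfolding roof_class_eq[OF Y r' u] using D_of_chain_map_eq_iff[OF Y cf] by blast
  qed
  moreover have "(X, cid, f) \<in> D_of_chain_map A X Y f"
    using mem_D_of_chain_map[OF Y f homotopy_section_cid] cid_roof f homotopic_refl[OF Y] by auto
  ultimately have "?S = {?cf}" by blast
  then show ?thesis by (simp add: D_hom_def)
qed

text \<open>With a section \<open>y\<close> of \<open>t\<close>, the maps \<open>y f\<close> and
  \<open>v w\<close> into \<open>Z'\<close> agree up to homotopy after \<open>t\<close>, since both
  become \<open>f\<close>. Cancelling \<open>t\<close> and applying \<open>g'\<close> turns the
  composite roof into \<open>g f\<close>.\<close>

lemma D_comp_D_of_chain_map: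
  assumes f: "chain_map A X X f" and g: "chain_map A X X g"
  shows "D_comp A X X X (D_of_chain_map A X X g) (D_of_chain_map A X X f) = D_of_chain_map A X X (ccomp g f)"
    (is "_ = ?gf")
proof -
  let ?S = "{roof_class A X X (W, ccomp s u, ccomp g' v) | W s u g' v.
         \<exists>Z f' Z' t. (Z, s, f') \<in> D_of_chain_map A X X f \<and> (Z', t, g') \<in> D_of_chain_map A X X g \<and> bounded_complex A W \<and>
           quasi_iso A W Z u \<and> chain_map A W Z' v \<and> homotopic A W X (ccomp f' u) (ccomp t v)}"
  note gf = chain_map_ccomp[OF f g]
  have "roof_class A X X (W, ccomp s u, ccomp g' v) = ?gf"
    if f': "(Z, s, f') \<in> D_of_chain_map A X X f" and g': "(Z', t, g') \<in> D_of_chain_map A X X g"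
      and W: "bounded_complex A W" and u: "quasi_iso A W Z u" and v: "chain_map A W Z' v"
      and h: "homotopic A W X (ccomp f' u) (ccomp t v)" for W s u g' v Z f' Z' t
  proof -
    have "(Z, s, f') \<in> roofs A X X" "(Z', t, g') \<in> roofs A X X"
      using f' g' by (auto simp: D_of_chain_map_def roof_class_def)
    then have Z: "bounded_complex A Z" "quasi_iso A Z X s" "chain_map A Z X f'"
      and Z': "bounded_complex A Z'" "quasi_iso A Z' X t" "chain_map A Z' X g'" by (auto simp: roofs_def)
    note uc = quasi_iso_chain_map[OF u] and tc = quasi_iso_chain_map[OF Z'(2)]
    have su: "quasi_iso A W X (ccomp s u)" by (rule quasi_iso_ccomp[OF W Z(1) X u Z(2)])
    then have r: "(W, ccomp s u, ccomp g' v) \<in> roofs A X X"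
      using W chain_map_ccomp[OF v Z'(3)] by (simp add: roofs_def)
    obtain w where w: "homotopy_section W (ccomp s u) w" using r by (rule roof_section)
    then have wc: "chain_map A X W w" by (simp add: homotopy_section_def)
    have uw: "chain_map A X Z (ccomp u w)" and vw: "chain_map A X Z' (ccomp v w)"
      using chain_map_ccomp[OF wc] uc v by blast+
    have "homotopy_section Z s (ccomp u w)" using w uw by (simp add: homotopy_section_def ccomp_assoc)
    then have fuw: "homotopic A X X f (ccomp f' (ccomp u w))" using f' mem_D_of_chain_map[OF X f] by blast
    obtain y where y: "homotopy_section Z' t y" using homotopy_section_exists[OF Z'(1,2)] by blast
    then have yc: "chain_map A X Z' y" "homotopic A X X (ccomp t y) cid" by (auto simp: homotopy_section_def)
    have gy: "homotopic A X X g (ccomp g' y)" using g' mem_D_of_chain_map[OF X g y] by blast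
    have yf: "chain_map A X Z' (ccomp y f)" by (rule chain_map_ccomp[OF f yc(1)])
    have tvw: "chain_map A X X (ccomp t (ccomp v w))" by (rule chain_map_ccomp[OF vw tc])
    have "homotopic A X X (ccomp f' (ccomp u w)) (ccomp t (ccomp v w))"
      unfolding ccomp_assoc by (rule homotopic_ccomp_right[OF wc h])
    then have "homotopic A X X f (ccomp t (ccomp v w))" using homotopic_trans[OF X X tvw fuw] by blast
    moreover have "homotopic A X X (ccomp t (ccomp y f)) f"
      using homotopic_ccomp_right[OF f yc(2)] by (simp add: ccomp_assoc)
    ultimately have "homotopic A X X (ccomp t (ccomp y f)) (ccomp t (ccomp v w))"
      using homotopic_trans[OF X X tvw] by blast
    then have "homotopic A X Z' (ccomp y f) (ccomp v w)" by (rule quasi_iso_cancel[OF Z'(1,2) yf vw])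
    then have "homotopic A X X (ccomp g' (ccomp y f)) (ccomp g' (ccomp v w))"
      by (rule homotopic_ccomp_left[OF X Z'(1) vw Z'(3)])
    moreover have "homotopic A X X (ccomp g f) (ccomp g' (ccomp y f))"
      using homotopic_ccomp_right[OF f gy] by (simp add: ccomp_assoc)
    moreover have gvw: "chain_map A X X (ccomp g' (ccomp v w))" by (rule chain_map_ccomp[OF vw Z'(3)])
    ultimately have "homotopic A X X (ccomp g f) (ccomp g' (ccomp v w))"
      using homotopic_trans[OF X X gvw] by blast
    then show ?thesis
      unfolding roof_class_eq[OF X r w] ccomp_assoc[symmetric]
      using D_of_chain_map_eq_iff[OF X gf gvw] by simp
  qed
  then have "?S \<subseteq> {?gf}" by blast
  moreover have "?S \<noteq> {}"
  proof -
    have "(X, cid, f) \<in> D_of_chain_map A X X f" "(X, cid, g) \<in> D_of_chain_map A X X g"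
      using mem_D_of_chain_map[OF X f homotopy_section_cid] mem_D_of_chain_map[OF X g homotopy_section_cid]
        cid_roof f g homotopic_refl[OF X] by auto
    moreover have "quasi_iso A X X cid" by (rule quasi_iso_cid[OF X])
    moreover have "homotopic A X X (ccomp f cid) (ccomp cid f)" using homotopic_refl[OF X f] by simp
    ultimately show ?thesis using X f by blast
  qed
  ultimately have "?S = {?gf}" by blast
  then show ?thesis by (simp add: D_comp_def)
qed

section \<open>The endomorphism algebra in the derived category\<close>

abbreviation B where "B \<equiv> D_End A X"
abbreviation cls where "cls f \<equiv> D_of_chain_map A X X f"

lemma carrier_B: "carrier B = {cls f | f. chain_map A X X f}"
  using carrier_D_hom[OF X] by (simp add: D_End_def)

lemma cls_mem: "chain_map A X X f \<Longrightarrow> cls f \<in> carrier B"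
  by (auto simp: carrier_B)

lemma zero_B: "\<zero>\<^bsub>B\<^esub> = cls (\<lambda>i x. \<zero>\<^bsub>cmod X i\<^esub>)"
  and one_B: "\<one>\<^bsub>B\<^esub> = cls cid"
  and add_B: "chain_map A X X f \<Longrightarrow> chain_map A X X g \<Longrightarrow> cls f \<oplus>\<^bsub>B\<^esub> cls g = cls (\<lambda>i x. f i x \<oplus>\<^bsub>cmod X i\<^esub> g i x)"
  and smult_B: "chain_map A X X f \<Longrightarrow> c \<odot>\<^bsub>B\<^esub> cls f = cls (\<lambda>i x. c \<odot>\<^bsub>cmod X i\<^esub> f i x)"
  and mult_B: "chain_map A X X g \<Longrightarrow> chain_map A X X f \<Longrightarrow> cls g \<otimes>\<^bsub>B\<^esub> cls f = cls (ccomp g f)"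
  using D_hom_add[OF X] D_hom_smult[OF X] D_comp_D_of_chain_map
  by (simp_all add: D_End_def zero_D_hom)

lemma cls_eqI:
  assumes "chain_map A X X f" "chain_map A X X g" "\<And>i x. x \<in> carrier (cmod X i) \<Longrightarrow> f i x = g i x"
  shows "cls f = cls g"
  using D_of_chain_map_eq_iff[OF X assms(1,2)] homotopic_eqI[OF X assms(2,3)] by blast

lemmas chain_map_intros = chain_map_zero[OF X] chain_map_cid chain_map_ccomp[where X = X and Y = X and Z = X]
  chain_map_sum[OF X] chain_map_smult[OF X]

lemma B_cases: "b \<in> carrier B \<Longrightarrow> (\<And>f. chain_map A X X f \<Longrightarrow> b = cls f \<Longrightarrow> thesis) \<Longrightarrow> thesis"
  by (auto simp: carrier_B)

lemma B_vectorspace: "vectorspace scalars B"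
proof (rule vs_criteria[OF field_scalars], goal_cases)
  case 1
  show ?case unfolding zero_B by (intro cls_mem chain_map_intros)
next
  case 2
  show ?case by (auto elim!: B_cases simp: add_B intro!: cls_mem chain_map_intros)
next
  case 3
  show ?case
  proof
    fix b assume "b \<in> carrier B"
    then obtain f where f: "chain_map A X X f" "b = cls f" by (rule B_cases)
    have "cls f \<oplus>\<^bsub>B\<^esub> cls (\<lambda>i x. (- 1) \<odot>\<^bsub>cmod X i\<^esub> f i x) = \<zero>\<^bsub>B\<^esub>"
      unfolding zero_B add_B[OF f(1) chain_map_smult[OF X f(1)]]
      by (rule cls_eqI) (use f in \<open>auto intro!: chain_map_intros
        simp: right_module.add_minus_one_scale[OF mX] chain_map_closed\<close>)
    then show "\<exists>c\<in>carrier B. b \<oplus>\<^bsub>B\<^esub> c = \<zero>\<^bsub>B\<^esub>" using cls_mem[OF chain_map_smult[OF X f(1)]] f(2) by blast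
  qed
next
  case 4
  show ?case by (auto elim!: B_cases simp: smult_B intro!: cls_mem chain_map_intros)
next
  case 5
  show ?case
    by (clarsimp elim!: B_cases simp: add_B chain_map_intros)
      (rule cls_eqI, simp_all add: chain_map_intros chain_map_closed right_module.add_commute[OF mX])
next
  case 6
  show ?case
    by (clarsimp elim!: B_cases simp: add_B chain_map_intros)
      (rule cls_eqI, simp_all add: chain_map_intros chain_map_closed right_module.add_assoc[OF mX])
next
  case 7
  show ?case
    by (clarsimp elim!: B_cases simp: zero_B add_B chain_map_intros)
      (rule cls_eqI, simp_all add: chain_map_intros chain_map_closed right_module.add_zero[OF mX])
next
  case 8
  show ?case
    by (clarsimp elim!: B_cases simp: smult_B chain_map_intros)
      (rule cls_eqI, simp_all add: chain_map_intros chain_map_closed right_module.scale_scale[OF mX])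
next
  case 9
  show ?case
    by (clarsimp elim!: B_cases simp: smult_B chain_map_intros)
      (rule cls_eqI, simp_all add: chain_map_intros chain_map_closed right_module.one_scale[OF mX])
next
  case 10
  show ?case
    by (clarsimp elim!: B_cases simp: smult_B add_B chain_map_intros)
      (rule cls_eqI, simp_all add: chain_map_intros chain_map_closed right_module.add_scale[OF mX])
next
  case 11
  show ?case
    by (clarsimp elim!: B_cases simp: smult_B add_B chain_map_intros)
      (rule cls_eqI, simp_all add: chain_map_intros chain_map_closed right_module.scale_add[OF mX])
qed

lemma B_ring: "ring B"
proof (rule ringI)
  show "abelian_group B"
    using B_vectorspace by (simp add: vectorspace_def module_def)
  show "monoid B"
    by (rule monoidI)
      (auto elim!: B_cases simp: one_B mult_B chain_map_cid chain_map_ccomp ccomp_assoc intro!: cls_mem chain_map_intros)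
next
  fix x y z assume xyz: "x \<in> carrier B" "y \<in> carrier B" "z \<in> carrier B"
  obtain f where f: "chain_map A X X f" "x = cls f" using xyz(1) by (rule B_cases)
  obtain g where g: "chain_map A X X g" "y = cls g" using xyz(2) by (rule B_cases)
  obtain h where h: "chain_map A X X h" "z = cls h" using xyz(3) by (rule B_cases)
  note c = f(1) g(1) h(1)
  have "cls (ccomp (\<lambda>i x. f i x \<oplus>\<^bsub>cmod X i\<^esub> g i x) h) = cls (\<lambda>i x. ccomp f h i x \<oplus>\<^bsub>cmod X i\<^esub> ccomp g h i x)"
    by (simp add: ccomp_def)
  then show "(x \<oplus>\<^bsub>B\<^esub> y) \<otimes>\<^bsub>B\<^esub> z = x \<otimes>\<^bsub>B\<^esub> z \<oplus>\<^bsub>B\<^esub> y \<otimes>\<^bsub>B\<^esub> z"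
    unfolding f(2) g(2) h(2) using c by (simp add: add_B mult_B chain_map_intros)
  have "cls (ccomp h (\<lambda>i x. f i x \<oplus>\<^bsub>cmod X i\<^esub> g i x)) = cls (\<lambda>i x. ccomp h f i x \<oplus>\<^bsub>cmod X i\<^esub> ccomp h g i x)"
    by (rule cls_eqI; (intro chain_map_intros c)?)
      (simp add: ccomp_def rhom_add[OF chain_map_rhom[OF h(1)]] chain_map_closed[OF f(1)] chain_map_closed[OF g(1)])
  then show "z \<otimes>\<^bsub>B\<^esub> (x \<oplus>\<^bsub>B\<^esub> y) = z \<otimes>\<^bsub>B\<^esub> x \<oplus>\<^bsub>B\<^esub> z \<otimes>\<^bsub>B\<^esub> y"
    unfolding f(2) g(2) h(2) using c by (simp add: add_B mult_B chain_map_intros)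
qed

lemma B_smult_mult:
  assumes "x \<in> carrier B" "y \<in> carrier B"
  shows "(c \<odot>\<^bsub>B\<^esub> x) \<otimes>\<^bsub>B\<^esub> y = c \<odot>\<^bsub>B\<^esub> (x \<otimes>\<^bsub>B\<^esub> y)" "x \<otimes>\<^bsub>B\<^esub> (c \<odot>\<^bsub>B\<^esub> y) = c \<odot>\<^bsub>B\<^esub> (x \<otimes>\<^bsub>B\<^esub> y)"
proof -
  obtain f where f: "chain_map A X X f" "x = cls f" using assms(1) by (rule B_cases)
  obtain g where g: "chain_map A X X g" "y = cls g" using assms(2) by (rule B_cases)
  note c' = f(1) g(1)
  have "cls (ccomp f (\<lambda>i x. c \<odot>\<^bsub>cmod X i\<^esub> g i x)) = cls (\<lambda>i x. c \<odot>\<^bsub>cmod X i\<^esub> ccomp f g i x)"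
    by (rule cls_eqI; (intro chain_map_intros c')?)
      (simp add: ccomp_def rhom_scale[OF chain_map_rhom[OF f(1)]] chain_map_closed[OF g(1)])
  then show "x \<otimes>\<^bsub>B\<^esub> (c \<odot>\<^bsub>B\<^esub> y) = c \<odot>\<^bsub>B\<^esub> (x \<otimes>\<^bsub>B\<^esub> y)"
    unfolding f(2) g(2) using c' by (simp add: smult_B mult_B chain_map_intros)
  have "cls (ccomp (\<lambda>i x. c \<odot>\<^bsub>cmod X i\<^esub> f i x) g) = cls (\<lambda>i x. c \<odot>\<^bsub>cmod X i\<^esub> ccomp f g i x)"
    by (simp add: ccomp_def)
  then show "(c \<odot>\<^bsub>B\<^esub> x) \<otimes>\<^bsub>B\<^esub> y = c \<odot>\<^bsub>B\<^esub> (x \<otimes>\<^bsub>B\<^esub> y)"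
    unfolding f(2) g(2) using c' by (simp add: smult_B mult_B chain_map_intros)
qed

end

text \<open>Membership in \<open>eA\<close> is the equation \<open>e x = x\<close>, after which
  every law is inherited from \<open>A\<close>.\<close>

lemma (in idempotent) idem_right_module:
  assumes V: "vectorspace scalars A"
    and sm: "\<And>c x y. x \<in> carrier A \<Longrightarrow> y \<in> carrier A \<Longrightarrow> (c \<odot>\<^bsub>A\<^esub> x) \<otimes>\<^bsub>A\<^esub> y = c \<odot>\<^bsub>A\<^esub> (x \<otimes>\<^bsub>A\<^esub> y)"
      "\<And>c x y. x \<in> carrier A \<Longrightarrow> y \<in> carrier A \<Longrightarrow> x \<otimes>\<^bsub>A\<^esub> (c \<odot>\<^bsub>A\<^esub> y) = c \<odot>\<^bsub>A\<^esub> (x \<otimes>\<^bsub>A\<^esub> y)"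
  shows "right_module A (idem_module A e)"
proof -
  interpret V: vectorspace scalars A by fact
  have sc: "c \<odot>\<^bsub>A\<^esub> x \<in> carrier A" if "x \<in> carrier A" for c x using V.smult_closed[of c x] that by simp
  have mem: "x \<in> carrier (idem_module A e) \<longleftrightarrow> x \<in> carrier A \<and> e \<otimes>\<^bsub>A\<^esub> x = x" for x
  proof
    assume "x \<in> carrier A \<and> e \<otimes>\<^bsub>A\<^esub> x = x"
    then show "x \<in> carrier (idem_module A e)" by (metis (mono_tags, lifting) idem_module_simps(1) mem_Collect_eq)
  qed (use idem_module_closed idem_mult in blast)
  note [simp del] = idem_module_simps(1)
  have "vectorspace scalars (idem_module A e)"
  proof (rule vs_criteria[OF field_scalars], goal_cases)
    case 3
    show ?case
    proof
      fix x assume "x \<in> carrier (idem_module A e)"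
      then show "\<exists>y\<in>carrier (idem_module A e). x \<oplus>\<^bsub>idem_module A e\<^esub> y = \<zero>\<^bsub>idem_module A e\<^esub>"
        by (intro bexI[of _ "\<ominus>\<^bsub>A\<^esub> x"]) (auto simp: mem r_neg r_minus idem_closed)
    qed
  next
    case 8
    show ?case using V.smult_assoc1 by (simp add: mem)
  next
    case 9
    show ?case using V.smult_one by (simp add: mem)
  next
    case 10
    show ?case using V.smult_l_distr by (simp add: mem)
  next
    case 11
    show ?case using V.smult_r_distr by (simp add: mem)
  qed (auto simp: mem idem_closed r_distr a_ac sc sm)
  moreover have "right_module_axioms A (idem_module A e)"
    by unfold_locales (auto simp: mem idem_closed m_assoc[symmetric] l_distr r_distr sm)
  ultimately show ?thesis by (simp add: right_module_def)
qed

section \<open>Sums of two-term complexes of projectives\<close>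

lemma bounded_complex_shift:
  assumes X: "bounded_complex A X"
  shows "bounded_complex A (shift r X)"
proof -
  note mX = cmod_module[OF X]
  have ci: "i + 1 + r = i + r + 1" for i :: int by simp
  have d: "cdiff (shift r X) i \<in> rhom A (cmod X (i + r)) (cmod X (i + r + 1))" for i
    using cdiff_rhom[OF X] rhom_uminus[OF mX cdiff_rhom[OF X]]
    by (cases "even r") (simp_all add: shift_def)
  have dd: "cdiff (shift r X) (i + 1) (cdiff (shift r X) i x) = \<zero>\<^bsub>cmod X (i + r + 1 + 1)\<^esub>"
    if x: "x \<in> carrier (cmod X (i + r))" for i x
  proof -
    note dx = rhom_closed[OF cdiff_rhom[OF X] x]
    show ?thesis
      unfolding shift_def ci
      using cdiff_cdiff[OF X x] rhom_neg[OF mX mX cdiff_rhom[OF X] dx]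
      by (simp add: ci right_module.neg_zero[OF mX])
  qed
  obtain N where N: "\<And>i. \<bar>i\<bar> > N \<Longrightarrow> carrier (cmod X i) = {\<zero>\<^bsub>cmod X i\<^esub>}"
    using X by (auto simp: bounded_complex_def)
  have "carrier (cmod X (i + r)) = {\<zero>\<^bsub>cmod X (i + r)\<^esub>}" if "\<bar>i\<bar> > N + \<bar>r\<bar>" for i
    using that by (intro N) linarith
  moreover have "fd_module A (cmod X i)" for i using X by (simp add: bounded_complex_def)
  moreover have m: "cmod (shift r X) i = cmod X (i + r)" for i by (simp add: shift_def)
  ultimately show ?thesis unfolding bounded_complex_def m ci using d dd by blast
qed

text \<open>The degree \<open>d\<close> term of \<open>X i\<close> has one summand
  \<open>e_u A\<close> for each \<open>x\<close> in \<open>S i d\<close>, with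
  \<open>u = a i d x\<close>. The module axioms for the \<open>e_u A\<close> are drawn from
  \<open>bounded_T\<close>; \<open>all_vertices\<close> ensures that each of them occurs in some
  term.\<close>

locale two_term_sum = ring A for A :: "('k::field, 'a) module" +
  fixes e :: "'v::finite \<Rightarrow> 'a"
    and X :: "'v \<Rightarrow> ('k, 'a, 'i \<Rightarrow> 'a) cplx"
    and S :: "'v \<Rightarrow> int \<Rightarrow> 'i set"
    and a :: "'v \<Rightarrow> int \<Rightarrow> 'i \<Rightarrow> 'v"
    and m :: int
  assumes e_closed: "e u \<in> carrier A" and e_idem: "e u \<otimes>\<^bsub>A\<^esub> e u = e u"
    and cmod_X: "cmod (X i) d = dsum_module (S i d) (\<lambda>x. idem_module A (e (a i d x)))"
    and finite_S: "finite (S i d)"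
    and S_empty: "d \<noteq> m \<Longrightarrow> d \<noteq> m + 1 \<Longrightarrow> S i d = {}"
    and all_vertices: "\<exists>i d. \<exists>x\<in>S i d. a i d x = u"
    and bounded_T: "bounded_complex A (dsum_complex X)"
    and vanishing: "r \<noteq> 0 \<Longrightarrow>
      carrier (D_hom A (dsum_complex X) (shift r (dsum_complex X))) =
        {\<zero>\<^bsub>D_hom A (dsum_complex X) (shift r (dsum_complex X))\<^esub>}"
begin

abbreviation T where "T \<equiv> dsum_complex X"
abbreviation P where "P u \<equiv> idem_module A (e u)"

lemma cmod_T: "cmod T d = dsum_module UNIV (\<lambda>i. cmod (X i) d)"
  and cdiff_T: "cdiff T d t = (\<lambda>i. cdiff (X i) d (t i))"
  by (simp_all add: dsum_complex_def)

lemma idempotent: "idempotent A (e u)"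
  by unfold_locales (rule e_closed, rule e_idem)

lemma fd_X: "fd_module A (cmod (X i) d)"
  using bounded_T fd_dsum_component[of A UNIV "\<lambda>i. cmod (X i) d" i] by (simp add: bounded_complex_def cmod_T)

lemma right_module_X: "right_module A (cmod (X i) d)"
  using fd_X by (simp add: fd_module_def)

text \<open>
  \<open>P\<^sub>u\<close> is a direct summand of a term of \<open>T\<close>, and the terms of objects of \<open>D\<^sup>b(A)\<close> are finite-dimensional.
\<close>

lemma fd_P: "fd_module A (P u)"
proof -
  obtain i d x where x: "x \<in> S i d" "a i d x = u" using all_vertices by blast
  show ?thesis
    using fd_dsum_component[OF fd_X[of i d, unfolded cmod_X] x(1)] x(2) by simp
qed

lemma right_module_P: "right_module A (P u)"
  using fd_P by (simp add: fd_module_def)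

lemma X_zero: "d \<noteq> m \<Longrightarrow> d \<noteq> m + 1 \<Longrightarrow> carrier (cmod (X i) d) = {\<zero>\<^bsub>cmod (X i) d\<^esub>}"
  using S_empty[of d i] by (auto simp: cmod_X)

lemma liftable_T:
  assumes M: "right_module A M"
  shows "liftable A (cmod T d) M"
  unfolding cmod_T
proof (rule liftable_dsum[OF finite _ M])
  show "right_module A (cmod (X i) d)" for i by (rule right_module_X)
  show "liftable A (cmod (X i) d) M" for i
    unfolding cmod_X
    by (rule liftable_dsum[OF finite_S right_module_P M idempotent.liftable[OF idempotent M]])
qed

sublocale T: two_term A T m
proof
  fix d assume "d \<noteq> m" "d \<noteq> m + 1"
  then show "carrier (cmod T d) = {\<zero>\<^bsub>cmod T d\<^esub>}"
    using X_zero by (auto simp: cmod_T fun_eq_iff PiE_iff right_module.zero_mem[OF right_module_X])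
qed (use bounded_T liftable_T in auto)

abbreviation embed :: "'v \<Rightarrow> int \<Rightarrow> ('i \<Rightarrow> 'a) \<Rightarrow> 'v \<Rightarrow> 'i \<Rightarrow> 'a" where
  "embed i d \<equiv> dsum_inj UNIV (\<lambda>j. cmod (X j) d) i"

abbreviation project :: "'v \<Rightarrow> int \<Rightarrow> ('v \<Rightarrow> 'i \<Rightarrow> 'a) \<Rightarrow> 'i \<Rightarrow> 'a" where
  "project i d \<equiv> (\<lambda>t. t i)"

lemma embed_apply: "embed i d x j = (if j = i then x else \<zero>\<^bsub>cmod (X j) d\<^esub>)"
  by (simp add: dsum_inj_def)

lemma embed_rhom: "embed i d \<in> rhom A (cmod (X i) d) (cmod T d)"
  unfolding cmod_T by (rule dsum_inj_rhom) (rule right_module_X)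

lemma project_rhom: "project i d \<in> rhom A (cmod T d) (cmod (X i) d)"
  unfolding cmod_T by (rule proj_rhom[where P = "\<lambda>i. cmod (X i) d"]) simp

lemma project_closed: "t \<in> carrier (cmod T d) \<Longrightarrow> t i \<in> carrier (cmod (X i) d)"
  by (rule rhom_closed[OF project_rhom])

lemma diff_X: "cdiff (X i) d \<in> rhom A (cmod (X i) d) (cmod (X i) (d + 1))"
proof -
  have "(\<lambda>x. cdiff T d (embed i d x) i) \<in> rhom A (cmod (X i) d) (cmod (X i) (d + 1))"
    by (rule rhom_comp[where g = "\<lambda>t. t i", OF rhom_comp[OF embed_rhom cdiff_rhom[OF bounded_T]] project_rhom])
  then show ?thesis by (simp add: cdiff_T embed_apply)
qed

lemma diff_X_zero: "cdiff (X i) d \<zero>\<^bsub>cmod (X i) d\<^esub> = \<zero>\<^bsub>cmod (X i) (d + 1)\<^esub>"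
  by (rule rhom_zero[OF right_module_X right_module_X diff_X])

lemma cdiff_embed: "cdiff T d (embed i d x) = embed i (d + 1) (cdiff (X i) d x)"
  by (auto simp: cdiff_T embed_apply diff_X_zero)

lemma embed_chain_map: "chain_map A (X i) T (embed i)"
  by (rule chain_mapI[OF embed_rhom]) (simp add: cdiff_embed)

lemma project_chain_map: "chain_map A T (X i) (project i)"
  by (rule chain_mapI[OF project_rhom]) (simp add: cdiff_T)

lemma summand_proj_eq: "summand_proj X i = ccomp (embed i) (project i)"
  by (auto simp: summand_proj_def ccomp_def embed_apply fun_eq_iff)

lemma summand_proj_chain_map: "chain_map A T T (summand_proj X i)"
  unfolding summand_proj_eq by (rule chain_map_ccomp[OF project_chain_map embed_chain_map])

section \<open>The Hom complex of two summands and its outer cohomology\<close>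

lemma shift_null:
  assumes "r \<noteq> 0" "chain_map A T (shift r T) f"
  shows "homotopic A T (shift r T) f (\<lambda>d x. \<zero>\<^bsub>cmod (shift r T) d\<^esub>)"
  using T.D_hom_trivial_iff[OF bounded_complex_shift[OF bounded_T]] vanishing assms by blast

lemma shift_simps: "cmod (shift r Y) d = cmod Y (d + r)"
  "odd r \<Longrightarrow> cdiff (shift r Y) d x = \<ominus>\<^bsub>cmod Y (d + r + 1)\<^esub> cdiff Y (d + r) x"
  by (simp_all add: shift_def)

text \<open>Placed in degree \<open>m\<close> between the summands, \<open>g\<close> is a chain map
  from \<open>T\<close> to \<open>T[1]\<close>, as \<open>T\<close> is zero in degree
  \<open>m + 2\<close>. Its null homotopy, restricted to \<open>X i\<close> and projected to
  \<open>X j\<close>, gives \<open>h0\<close> and \<open>h1\<close>; the minus sign comes from the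
  differential of \<open>T[1]\<close>.\<close>

lemma hom_degree_one:
  assumes g: "g \<in> rhom A (cmod (X i) m) (cmod (X j) (m + 1))"
  shows "\<exists>h0\<in>rhom A (cmod (X i) m) (cmod (X j) m). \<exists>h1\<in>rhom A (cmod (X i) (m + 1)) (cmod (X j) (m + 1)).
    \<forall>x\<in>carrier (cmod (X i) m).
      g x = \<ominus>\<^bsub>cmod (X j) (m + 1)\<^esub> cdiff (X j) m (h0 x) \<oplus>\<^bsub>cmod (X j) (m + 1)\<^esub> h1 (cdiff (X i) m x)"
proof -
  let ?Y1 = "cmod (X j) (m + 1)" and ?T0 = "cmod T m" and ?T1 = "cmod T (m + 1)"
    and ?Z = "shift 1 T"
  note bs = bounded_complex_shift[OF bounded_T, of 1]
  note mT = cmod_module[OF bounded_T]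
  let ?f = "\<lambda>t. embed j (m + 1) (g (t i))"
  let ?F = "T.glue (cmod ?Z) ?f (\<lambda>t. \<zero>\<^bsub>cmod ?Z (m + 1)\<^esub>)"
  have f: "?f \<in> rhom A ?T0 (cmod ?Z m)"
    unfolding shift_simps by (rule rhom_comp[OF rhom_comp[where g = g, OF project_rhom g] embed_rhom])
  have F: "chain_map A T ?Z ?F"
  proof (rule T.chain_map_glue[OF bs f rhom_zero_map[OF cmod_module[OF bs]]])
    fix t assume t: "t \<in> carrier ?T0"
    have "cdiff ?Z m (?f t) \<in> carrier (cmod ?Z (m + 1))"
      by (rule rhom_closed[OF cdiff_rhom[OF bs] rhom_closed[OF f t]])
    then show "\<zero>\<^bsub>cmod ?Z (m + 1)\<^esub> = cdiff ?Z m (?f t)"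
      using T.above unfolding shift_simps by simp
  next
    show "cdiff ?Z (m + 1) \<zero>\<^bsub>cmod ?Z (m + 1)\<^esub> = \<zero>\<^bsub>cmod ?Z (m + 1 + 1)\<^esub>"
      by (rule rhom_zero[OF cmod_module[OF bs] cmod_module[OF bs] cdiff_rhom[OF bs]])
  qed
  have "homotopic A T ?Z ?F (\<lambda>d x. \<zero>\<^bsub>cmod ?Z d\<^esub>)" by (rule shift_null[OF _ F]) simp
  then obtain h where Hh: "homotopy A T ?Z ?F (\<lambda>d x. \<zero>\<^bsub>cmod ?Z d\<^esub>) h" by (rule homotopicE)
  note h = homotopy_rhom[OF Hh] and eq = homotopy_eq[OF Hh]
  have h': "h d \<in> rhom A (cmod T d) (cmod T d)" for d using h[of d] by (simp add: shift_simps)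
  have hc: "(\<lambda>x. h d (embed i d x) j) \<in> rhom A (cmod (X i) d) (cmod (X j) d)" for d
    by (rule rhom_comp[where g = "\<lambda>t. t j", OF rhom_comp[OF embed_rhom h'] project_rhom])
  show ?thesis
  proof (intro bexI[OF _ hc[of m]] bexI[OF _ hc[of "m + 1"]] ballI)
    fix x assume x: "x \<in> carrier (cmod (X i) m)"
    interpret M: right_module A "?Y1" by (rule right_module_X)
    interpret N: right_module A "?T1" by (rule mT)
    let ?t = "embed i m x"
    have t: "?t \<in> carrier ?T0" by (rule rhom_closed[OF embed_rhom x])
    note dh = rhom_closed[OF cdiff_rhom[OF bounded_T] rhom_closed[OF h' t]]
    note hd = rhom_closed[OF h' rhom_closed[OF cdiff_rhom[OF bounded_T] t]]
    have "?F m ?t = (\<ominus>\<^bsub>?T1\<^esub> cdiff T m (h m ?t)) \<oplus>\<^bsub>?T1\<^esub> h (m + 1) (cdiff T m ?t)"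
      using eq[OF t] dh hd by (simp add: shift_simps N.zero_add N.add_closed N.neg_closed)
    then have "?F m ?t j = ((\<ominus>\<^bsub>?T1\<^esub> cdiff T m (h m ?t)) \<oplus>\<^bsub>?T1\<^esub> h (m + 1) (cdiff T m ?t)) j"
      by simp
    also have "\<dots> = \<ominus>\<^bsub>?Y1\<^esub> cdiff T m (h m ?t) j \<oplus>\<^bsub>?Y1\<^esub> h (m + 1) (cdiff T m ?t) j"
      using rhom_add[OF project_rhom[of j] N.neg_closed[OF dh] hd] rhom_neg[OF mT right_module_X project_rhom[of j] dh]
      by simp
    finally show "g x = \<ominus>\<^bsub>?Y1\<^esub> cdiff (X j) m (h m ?t j) \<oplus>\<^bsub>?Y1\<^esub>
        h (m + 1) (embed i (m + 1) (cdiff (X i) m x)) j"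
      unfolding cdiff_embed by (simp add: T.glue_def embed_apply cdiff_T)
  qed
qed

text \<open>\<open>gd\<close> and \<open>dg\<close> make \<open>g\<close> a chain map from
  \<open>T\<close> to \<open>T[-1]\<close>. In degree \<open>m + 1\<close> the two terms of a null
  homotopy pass through the terms of \<open>T\<close> in degrees \<open>m - 1\<close> and
  \<open>m + 2\<close>, which are zero; so being null-homotopic means being zero.\<close>

lemma hom_degree_minus_one:
  assumes g: "g \<in> rhom A (cmod (X i) (m + 1)) (cmod (X j) m)"
    and gd: "\<And>x. x \<in> carrier (cmod (X i) m) \<Longrightarrow> g (cdiff (X i) m x) = \<zero>\<^bsub>cmod (X j) m\<^esub>"
    and dg: "\<And>x. x \<in> carrier (cmod (X i) (m + 1)) \<Longrightarrow> cdiff (X j) m (g x) = \<zero>\<^bsub>cmod (X j) (m + 1)\<^esub>"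
    and x: "x \<in> carrier (cmod (X i) (m + 1))"
  shows "g x = \<zero>\<^bsub>cmod (X j) m\<^esub>"
proof -
  let ?T0 = "cmod T m" and ?T1 = "cmod T (m + 1)"
  note bs = bounded_complex_shift[OF bounded_T, of "- 1"]
  note mT = cmod_module[OF bounded_T]
  let ?Z = "shift (- 1) T"
  note mZ = cmod_module[OF bs] and dZ = cdiff_rhom[OF bs]
  let ?f = "\<lambda>t. embed j m (g (t i))"
  let ?F = "T.glue (cmod ?Z) (\<lambda>t. \<zero>\<^bsub>cmod ?Z m\<^esub>) ?f"
  have Zm: "cmod ?Z (m + 1) = ?T0" by (simp add: shift_simps)
  have f: "?f \<in> rhom A ?T1 (cmod ?Z (m + 1))"
    unfolding Zm by (rule rhom_comp[OF rhom_comp[where g = g, OF project_rhom g] embed_rhom])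
  have embed_zero: "embed j d \<zero>\<^bsub>cmod (X j) d\<^esub> = \<zero>\<^bsub>cmod T d\<^esub>" for d
    by (rule rhom_zero[OF right_module_X mT embed_rhom])
  have F: "chain_map A T ?Z ?F"
  proof (rule T.chain_map_glue[OF bs rhom_zero_map[OF mZ] f])
    fix t assume t: "t \<in> carrier ?T0"
    have "?f (cdiff T m t) = \<zero>\<^bsub>cmod ?Z (m + 1)\<^esub>"
      unfolding Zm using gd[OF project_closed[OF t]] by (simp add: cdiff_T embed_zero)
    then show "?f (cdiff T m t) = cdiff ?Z m \<zero>\<^bsub>cmod ?Z m\<^esub>" by (simp add: rhom_zero[OF mZ mZ dZ])
  next
    fix t assume t: "t \<in> carrier ?T1"
    have "cdiff T m (?f t) = \<zero>\<^bsub>?T1\<^esub>"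
      unfolding cdiff_embed dg[OF project_closed[OF t]] by (rule embed_zero)
    then show "cdiff ?Z (m + 1) (?f t) = \<zero>\<^bsub>cmod ?Z (m + 1 + 1)\<^esub>"
      using right_module.neg_zero[OF mT] by (simp add: shift_simps add.commute[of 1 m])
  qed
  have "homotopic A T ?Z ?F (\<lambda>d x. \<zero>\<^bsub>cmod ?Z d\<^esub>)" by (rule shift_null[OF _ F]) simp
  then obtain h where Hh: "homotopy A T ?Z ?F (\<lambda>d x. \<zero>\<^bsub>cmod ?Z d\<^esub>) h" by (rule homotopicE)
  note h = homotopy_rhom[OF Hh] and eq = homotopy_eq[OF Hh]
  let ?t = "embed i (m + 1) x"
  have t: "?t \<in> carrier ?T1" by (rule rhom_closed[OF embed_rhom x])
  have hn: "h (d + 1) \<in> rhom A (cmod T (d + 1)) (cmod ?Z d)" for d using h[of "d + 1"] by simp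
  interpret N: right_module A "?T0" by (rule mT)
  have "h (m + 1) ?t \<in> carrier (cmod ?Z m)" by (rule rhom_closed[OF hn t])
  then have "h (m + 1) ?t = \<zero>\<^bsub>cmod ?Z m\<^esub>" using T.below by (simp add: shift_simps)
  then have 1: "cdiff ?Z (m + 1 - 1) (h (m + 1) ?t) = \<zero>\<^bsub>?T0\<^esub>"
    using rhom_zero[OF mZ mZ dZ, of m] Zm by simp
  have 2: "h (m + 1 + 1) (cdiff T (m + 1) ?t) = \<zero>\<^bsub>?T0\<^esub>"
    using cocycles_diff[OF T.top_cocycles[OF t]] rhom_zero[OF mT mZ hn[of "m + 1"]] Zm by simp
  have "?F (m + 1) ?t = \<zero>\<^bsub>?T0\<^esub>"
    unfolding eq[OF t] 1 2 Zm by (simp add: N.zero_add N.zero_mem)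
  then have "?f ?t j = \<zero>\<^bsub>?T0\<^esub> j" by (simp add: T.glue_def)
  then show ?thesis by (simp add: embed_apply cmod_T)
qed

text \<open>
  The complex \<open>Hom(X\<^sub>i, X\<^sub>j)\<close> has its terms in the degrees \<open>-1\<close>, \<open>0\<close>, \<open>1\<close>; they are
  \<open>hom_XX i j (m + 1) m\<close>, \<open>hom0 i j\<close> and \<open>hom_XX i j m (m + 1)\<close>.
\<close>

abbreviation hom_XX :: "'v \<Rightarrow> 'v \<Rightarrow> int \<Rightarrow> int \<Rightarrow> ('k, ('i \<Rightarrow> 'a) \<Rightarrow> ('i \<Rightarrow> 'a)) module" where
  "hom_XX i j p q \<equiv> hom_space A (cmod (X i) p) (cmod (X j) q)"

definition hom0 :: "'v \<Rightarrow> 'v \<Rightarrow> ('k, int \<Rightarrow> ('i \<Rightarrow> 'a) \<Rightarrow> ('i \<Rightarrow> 'a)) module" where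
  "hom0 i j = vprod {m, m + 1} (\<lambda>d. hom_XX i j d d)"

text \<open>\<open>dminus\<close> and \<open>dzero\<close> are the differentials of the Hom complex
  out of the degrees -1 and 0; their signs make null-homotopic maps the image of the first and chain
  maps the kernel of the second.\<close>

definition dminus :: "'v \<Rightarrow> 'v \<Rightarrow> (('i \<Rightarrow> 'a) \<Rightarrow> ('i \<Rightarrow> 'a)) \<Rightarrow> int \<Rightarrow> ('i \<Rightarrow> 'a) \<Rightarrow> ('i \<Rightarrow> 'a)" where
  "dminus i j k = (\<lambda>d\<in>{m, m + 1}. \<lambda>x\<in>carrier (cmod (X i) d).
     if d = m then k (cdiff (X i) m x) else cdiff (X j) m (k x))"

definition dzero :: "'v \<Rightarrow> 'v \<Rightarrow> (int \<Rightarrow> ('i \<Rightarrow> 'a) \<Rightarrow> ('i \<Rightarrow> 'a)) \<Rightarrow> ('i \<Rightarrow> 'a) \<Rightarrow> ('i \<Rightarrow> 'a)" where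
  "dzero i j f = (\<lambda>x\<in>carrier (cmod (X i) m).
     cdiff (X j) m (f m x) \<oplus>\<^bsub>cmod (X j) (m + 1)\<^esub> \<ominus>\<^bsub>cmod (X j) (m + 1)\<^esub> f (m + 1) (cdiff (X i) m x))"

lemma hom0_simps:
  "f \<in> carrier (hom0 i j) \<longleftrightarrow> f \<in> extensional {m, m + 1} \<and>
    (\<forall>d\<in>{m, m + 1}. f d \<in> rhom A (cmod (X i) d) (cmod (X j) d) \<inter> extensional (carrier (cmod (X i) d)))"
  "\<zero>\<^bsub>hom0 i j\<^esub> = (\<lambda>d\<in>{m, m + 1}. \<lambda>x\<in>carrier (cmod (X i) d). \<zero>\<^bsub>cmod (X j) d\<^esub>)"
  "f \<oplus>\<^bsub>hom0 i j\<^esub> g = (\<lambda>d\<in>{m, m + 1}. \<lambda>x\<in>carrier (cmod (X i) d). f d x \<oplus>\<^bsub>cmod (X j) d\<^esub> g d x)"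
  "c \<odot>\<^bsub>hom0 i j\<^esub> f = (\<lambda>d\<in>{m, m + 1}. \<lambda>x\<in>carrier (cmod (X i) d). c \<odot>\<^bsub>cmod (X j) d\<^esub> f d x)"
  by (auto simp: hom0_def vprod_def PiE_iff)

lemma hom_XX_vectorspace: "vectorspace scalars (hom_XX i j p q)"
  by (rule hom_space_vectorspace[OF right_module_X right_module_X])

lemma hom0_vectorspace: "vectorspace scalars (hom0 i j)"
  unfolding hom0_def by (rule vprod_vectorspace[OF field_scalars hom_XX_vectorspace])

lemma dminus_linear: "linear_map scalars (hom_XX i j (m + 1) m) (hom0 i j) (dminus i j)"
proof (rule linear_mapI[OF hom_XX_vectorspace hom0_vectorspace])
  have r1: "(\<lambda>x. k (cdiff (X i) m x)) \<in> rhom A (cmod (X i) m) (cmod (X j) m)"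
    and r2: "(\<lambda>x. cdiff (X j) m (k x)) \<in> rhom A (cmod (X i) (m + 1)) (cmod (X j) (m + 1))"
    if "k \<in> rhom A (cmod (X i) (m + 1)) (cmod (X j) m)" for k
    using rhom_comp[OF diff_X that] rhom_comp[OF that diff_X] by auto
  show "dminus i j \<in> module_hom scalars (hom_XX i j (m + 1) m) (hom0 i j)"
    unfolding module_hom_def hom0_simps
    by (auto simp: hom0_simps dminus_def fun_eq_iff rhom_closed[OF diff_X] rhom_add[OF diff_X] rhom_scale[OF diff_X]
        rhom_closed[of _ A "cmod (X i) (m + 1)"]
        intro!: rhom_restrict[OF right_module_X] r1 r2)
qed

lemma dzero_linear: "linear_map scalars (hom0 i j) (hom_XX i j m (m + 1)) (dzero i j)"
proof (rule linear_mapI[OF hom0_vectorspace hom_XX_vectorspace])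
  interpret M: right_module A "cmod (X j) (m + 1)" by (rule right_module_X)
  have r: "(\<lambda>x. cdiff (X j) m (f x) \<oplus>\<^bsub>cmod (X j) (m + 1)\<^esub> \<ominus>\<^bsub>cmod (X j) (m + 1)\<^esub> g (cdiff (X i) m x))
      \<in> rhom A (cmod (X i) m) (cmod (X j) (m + 1))"
    if "f \<in> rhom A (cmod (X i) m) (cmod (X j) m)" "g \<in> rhom A (cmod (X i) (m + 1)) (cmod (X j) (m + 1))" for f g
    by (intro rhom_sum[OF right_module_X] rhom_uminus[OF right_module_X] rhom_comp[OF that(1) diff_X] rhom_comp[OF diff_X that(2)])
  have c: "f x \<in> carrier (cmod (X j) d)" if "f \<in> rhom A (cmod (X i) d) (cmod (X j) d)" "x \<in> carrier (cmod (X i) d)" for f x d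
    by (rule rhom_closed[OF that])
  show "dzero i j \<in> module_hom scalars (hom0 i j) (hom_XX i j m (m + 1))"
    unfolding module_hom_def
    by (auto simp: hom0_simps dzero_def fun_eq_iff rhom_closed[OF diff_X] rhom_add[OF diff_X] rhom_scale[OF diff_X]
        c M.neg_sum M.neg_closed M.add_closed M.scale_closed M.scale_add M.scale_neg M.add_assoc M.add_lcomm
        intro!: rhom_restrict[OF right_module_X] r)
qed

text \<open>A kernel element is a cocycle of degree -1, that is, a morphism to the shift by -1, and
  these vanish.\<close>

lemma dminus_inj: "inj_on (dminus i j) (carrier (hom_XX i j (m + 1) m))"
proof -
  interpret L: linear_map scalars "hom_XX i j (m + 1) m" "hom0 i j" "dminus i j" by (rule dminus_linear)
  have "k = \<zero>\<^bsub>hom_XX i j (m + 1) m\<^esub>" if "k \<in> L.kerT" for k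
  proof -
    have k: "k \<in> rhom A (cmod (X i) (m + 1)) (cmod (X j) m)" "k \<in> extensional (carrier (cmod (X i) (m + 1)))"
      and z: "dminus i j k = \<zero>\<^bsub>hom0 i j\<^esub>" using that by (auto simp: L.ker_def)
    have "k (cdiff (X i) m x) = \<zero>\<^bsub>cmod (X j) m\<^esub>" if "x \<in> carrier (cmod (X i) m)" for x
      using fun_cong[OF fun_cong[OF z, of m], of x] that by (simp add: dminus_def hom0_simps)
    moreover have "cdiff (X j) m (k x) = \<zero>\<^bsub>cmod (X j) (m + 1)\<^esub>" if "x \<in> carrier (cmod (X i) (m + 1))" for x
      using fun_cong[OF fun_cong[OF z, of "m + 1"], of x] that by (simp add: dminus_def hom0_simps)
    ultimately have "k x = \<zero>\<^bsub>cmod (X j) m\<^esub>" if "x \<in> carrier (cmod (X i) (m + 1))" for x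
      using hom_degree_minus_one[OF k(1) _ _ that] by blast
    then show ?thesis using k(2) by (auto simp: extensional_def fun_eq_iff)
  qed
  moreover have "\<zero>\<^bsub>hom_XX i j (m + 1) m\<^esub> \<in> L.kerT"
    using L.T0_is_0 right_module.zero_mem[OF right_module_X] rhom_restrict[OF right_module_X rhom_zero_map[OF right_module_X]]
    by (simp add: L.ker_def)
  ultimately have "L.kerT = {\<zero>\<^bsub>hom_XX i j (m + 1) m\<^esub>}" by blast
  then show ?thesis by (intro L.Ke0_imp_inj) simp
qed

text \<open>The vanishing of morphisms from \<open>T\<close> to \<open>T[1]\<close>, in the form
  given by \<open>hom_degree_one\<close>.\<close>

lemma dzero_surj: "dzero i j ` carrier (hom0 i j) = carrier (hom_XX i j m (m + 1))"
proof
  let ?M = "cmod (X j) (m + 1)" and ?X0 = "cmod (X i) m" and ?H = "carrier (hom0 i j)"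
  interpret L: linear_map scalars "hom0 i j" "hom_XX i j m (m + 1)" "dzero i j" by (rule dzero_linear)
  show "dzero i j ` ?H \<subseteq> carrier (hom_XX i j m (m + 1))" using L.T_im by blast
  show "carrier (hom_XX i j m (m + 1)) \<subseteq> dzero i j ` ?H"
  proof
    fix g assume g: "g \<in> carrier (hom_XX i j m (m + 1))"
    then obtain h0 h1 where h0: "h0 \<in> rhom A ?X0 (cmod (X j) m)"
      and h1: "h1 \<in> rhom A (cmod (X i) (m + 1)) ?M"
      and eq: "\<And>x. x \<in> carrier ?X0 \<Longrightarrow>
        g x = \<ominus>\<^bsub>?M\<^esub> cdiff (X j) m (h0 x) \<oplus>\<^bsub>?M\<^esub> h1 (cdiff (X i) m x)"
      using hom_degree_one[of g i j] by auto
    \<comment> \<open>The homotopy satisfies \<open>g = - d h0 + h1 d\<close>, whereas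
      \<open>dzero\<close> computes \<open>d f - f d\<close>; hence both components change
      sign.\<close>
    let ?f = "\<lambda>d\<in>{m, m + 1}. \<lambda>x\<in>carrier (cmod (X i) d). \<ominus>\<^bsub>cmod (X j) d\<^esub> (if d = m then h0 x else h1 x)"
    interpret M: right_module A "?M" by (rule right_module_X)
    have f: "?f \<in> ?H"
      using rhom_uminus[OF right_module_X h0] rhom_uminus[OF right_module_X h1]
      by (auto simp: hom0_simps intro!: rhom_restrict[OF right_module_X])
    have "g = dzero i j ?f"
    proof (rule extensionalityI[of _ "carrier ?X0"])
      fix x assume x: "x \<in> carrier ?X0"
      have "cdiff (X j) m (\<ominus>\<^bsub>cmod (X j) m\<^esub> h0 x) = \<ominus>\<^bsub>?M\<^esub> cdiff (X j) m (h0 x)"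
        by (rule rhom_neg[OF right_module_X right_module_X diff_X rhom_closed[OF h0 x]])
      then show "g x = dzero i j ?f x"
        using x rhom_closed[OF h1 rhom_closed[OF diff_X x]]
        by (simp add: dzero_def eq M.neg_neg rhom_closed[OF diff_X])
    qed (use g in \<open>auto simp: dzero_def\<close>)
    then show "g \<in> dzero i j ` ?H" using f by (rule image_eqI)
  qed
qed

section \<open>Homomorphisms over the endomorphism algebra\<close>

abbreviation E where "E i \<equiv> T.cls (summand_proj X i)"
abbreviation Q where "Q i \<equiv> idem_module T.B (E i)"

lemma idempotent_E: "idempotent T.B (E i)"
proof -
  interpret B: ring T.B by (rule T.B_ring)
  show ?thesis
    by unfold_locales
      (simp_all add: T.cls_mem summand_proj_chain_map T.mult_B, simp add: summand_proj_eq ccomp_def embed_apply)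
qed

lemma right_module_Q: "right_module T.B (Q i)"
  by (rule idempotent.idem_right_module[OF idempotent_E T.B_vectorspace T.B_smult_mult])

text \<open>The composite of the projection to \<open>X i\<close>, the map \<open>f\<close> and the
  embedding of \<open>X j\<close>; for a cocycle \<open>f\<close> its class is an element of
  \<open>e_j B e_i\<close>.\<close>

definition extend :: "'v \<Rightarrow> 'v \<Rightarrow> (int \<Rightarrow> ('i \<Rightarrow> 'a) \<Rightarrow> ('i \<Rightarrow> 'a)) \<Rightarrow> int \<Rightarrow> ('v \<Rightarrow> 'i \<Rightarrow> 'a) \<Rightarrow> ('v \<Rightarrow> 'i \<Rightarrow> 'a)" where
  "extend i j f = T.glue (cmod T) (\<lambda>t. embed j m (f m (t i))) (\<lambda>t. embed j (m + 1) (f (m + 1) (t i)))"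

definition cocycles0 :: "'v \<Rightarrow> 'v \<Rightarrow> (int \<Rightarrow> ('i \<Rightarrow> 'a) \<Rightarrow> ('i \<Rightarrow> 'a)) set" where
  "cocycles0 i j = {f \<in> carrier (hom0 i j). dzero i j f = \<zero>\<^bsub>hom_XX i j m (m + 1)\<^esub>}"

lemma cocycles0_rhom:
  assumes "f \<in> cocycles0 i j"
  shows "f m \<in> rhom A (cmod (X i) m) (cmod (X j) m)" "f (m + 1) \<in> rhom A (cmod (X i) (m + 1)) (cmod (X j) (m + 1))"
  using assms by (auto simp: cocycles0_def hom0_simps)

lemma cocycles0_iff:
  assumes f: "f \<in> carrier (hom0 i j)"
  shows "f \<in> cocycles0 i j \<longleftrightarrow>
    (\<forall>x\<in>carrier (cmod (X i) m). f (m + 1) (cdiff (X i) m x) = cdiff (X j) m (f m x))"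
proof -
  let ?M = "cmod (X j) (m + 1)"
  interpret M: right_module A "?M" by (rule right_module_X)
  have fr: "f m \<in> rhom A (cmod (X i) m) (cmod (X j) m)" "f (m + 1) \<in> rhom A (cmod (X i) (m + 1)) ?M"
    using f by (auto simp: hom0_simps)
  have "u \<oplus>\<^bsub>?M\<^esub> \<ominus>\<^bsub>?M\<^esub> v = \<zero>\<^bsub>?M\<^esub> \<longleftrightarrow> v = u"
    if "u \<in> carrier ?M" "v \<in> carrier ?M" for u v
  proof
    assume "u \<oplus>\<^bsub>?M\<^esub> \<ominus>\<^bsub>?M\<^esub> v = \<zero>\<^bsub>?M\<^esub>"
    then have "(u \<oplus>\<^bsub>?M\<^esub> \<ominus>\<^bsub>?M\<^esub> v) \<oplus>\<^bsub>?M\<^esub> v = v"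
      using that by (simp add: M.zero_add)
    then show "v = u" using that by (simp add: M.add_assoc M.neg_closed M.neg_add M.add_zero)
  qed (simp add: that M.add_neg)
  from this[OF rhom_closed[OF diff_X rhom_closed[OF fr(1)]] rhom_closed[OF fr(2) rhom_closed[OF diff_X]]]
  show ?thesis using f by (auto simp: cocycles0_def dzero_def fun_eq_iff)
qed

lemma extend_chain_map:
  assumes f: "f \<in> cocycles0 i j"
  shows "chain_map A T T (extend i j f)"
  unfolding extend_def
proof (rule T.chain_map_glue[OF bounded_T])
  note fr = cocycles0_rhom[OF f]
  show "(\<lambda>t. embed j m (f m (t i))) \<in> rhom A (cmod T m) (cmod T m)"
    by (rule rhom_comp[OF rhom_comp[where g = "f m", OF project_rhom fr(1)] embed_rhom])
  show r: "(\<lambda>t. embed j (m + 1) (f (m + 1) (t i))) \<in> rhom A (cmod T (m + 1)) (cmod T (m + 1))"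
    by (rule rhom_comp[OF rhom_comp[where g = "f (m + 1)", OF project_rhom fr(2)] embed_rhom])
  show "embed j (m + 1) (f (m + 1) (cdiff T m t i)) = cdiff T m (embed j m (f m (t i)))"
    if "t \<in> carrier (cmod T m)" for t
  proof -
    have "f (m + 1) (cdiff (X i) m (t i)) = cdiff (X j) m (f m (t i))"
      using f cocycles0_iff[of f i j] project_closed[OF that] by (simp add: cocycles0_def)
    then show ?thesis unfolding cdiff_embed unfolding cdiff_T by simp
  qed
  show "cdiff T (m + 1) (embed j (m + 1) (f (m + 1) (t i))) = \<zero>\<^bsub>cmod T (m + 1 + 1)\<^esub>"
    if "t \<in> carrier (cmod T (m + 1))" for t
    by (rule cocycles_diff[OF T.top_cocycles[OF rhom_closed[OF r that]]])
qed

lemma extend_eqI: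
  assumes f: "f \<in> cocycles0 i j" and g: "chain_map A T T g"
    and "\<And>t. t \<in> carrier (cmod T m) \<Longrightarrow> embed j m (f m (t i)) = g m t"
    and "\<And>t. t \<in> carrier (cmod T (m + 1)) \<Longrightarrow> embed j (m + 1) (f (m + 1) (t i)) = g (m + 1) t"
  shows "T.cls (extend i j f) = T.cls g"
proof (rule T.cls_eqI[OF extend_chain_map[OF f] g])
  note mT = cmod_module[OF bounded_T]
  fix d t assume t: "t \<in> carrier (cmod T d)"
  show "extend i j f d t = g d t"
    using t
  proof (rule T.degree_cases[where Q = "\<lambda>d t. extend i j f d t = g d t"])
    show "extend i j f d \<zero>\<^bsub>cmod T d\<^esub> = g d \<zero>\<^bsub>cmod T d\<^esub>"
      by (simp add: rhom_zero[OF mT mT chain_map_rhom[OF g]] rhom_zero[OF mT mT chain_map_rhom[OF extend_chain_map[OF f]]])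
  qed (use assms(3,4) t in \<open>auto simp: extend_def T.glue_def\<close>)
qed

lemma E_extend:
  assumes f: "f \<in> cocycles0 i j"
  shows "E j \<otimes>\<^bsub>T.B\<^esub> T.cls (extend i j f) = T.cls (extend i j f)"
    and "T.cls (extend i j f) \<otimes>\<^bsub>T.B\<^esub> E i = T.cls (extend i j f)"
proof -
  note c = extend_chain_map[OF f] summand_proj_chain_map
  show "E j \<otimes>\<^bsub>T.B\<^esub> T.cls (extend i j f) = T.cls (extend i j f)"
    unfolding T.mult_B[OF c(2,1)]
    by (rule extend_eqI[OF f chain_map_ccomp[OF c], symmetric])
      (simp_all add: ccomp_def extend_def T.glue_def summand_proj_eq embed_apply)
  show "T.cls (extend i j f) \<otimes>\<^bsub>T.B\<^esub> E i = T.cls (extend i j f)"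
    unfolding T.mult_B[OF c]
    by (rule extend_eqI[OF f chain_map_ccomp[OF c(2,1)], symmetric])
      (simp_all add: ccomp_def extend_def T.glue_def summand_proj_eq embed_apply)
qed

text \<open>
  \<open>Hom\<^sub>B(e\<^sub>i B, e\<^sub>j B) = e\<^sub>j B e\<^sub>i\<close>, acting by left multiplication, is the cohomology of \<open>Hom(X\<^sub>i, X\<^sub>j)\<close> in
  degree \<open>0\<close>.
\<close>

definition psi :: "'v \<Rightarrow> 'v \<Rightarrow> (int \<Rightarrow> ('i \<Rightarrow> 'a) \<Rightarrow> ('i \<Rightarrow> 'a)) \<Rightarrow> _" where
  "psi i j f = (\<lambda>b\<in>carrier (Q i). T.cls (extend i j f) \<otimes>\<^bsub>T.B\<^esub> b)"

lemma cocycles0_subspace: "vectorspace scalars (hom0 i j\<lparr>carrier := cocycles0 i j\<rparr>)"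
proof -
  interpret L: linear_map scalars "hom0 i j" "hom_XX i j m (m + 1)" "dzero i j" by (rule dzero_linear)
  show ?thesis using L.V.subspace_is_vs[OF L.kerT_is_subspace] by (simp add: L.ker_def cocycles0_def)
qed

lemma extend_add:
  assumes f: "f \<in> cocycles0 i j" and g: "g \<in> cocycles0 i j"
  shows "T.cls (extend i j (f \<oplus>\<^bsub>hom0 i j\<^esub> g)) = T.cls (extend i j f) \<oplus>\<^bsub>T.B\<^esub> T.cls (extend i j g)"
proof -
  interpret Z: vectorspace scalars "hom0 i j\<lparr>carrier := cocycles0 i j\<rparr>" by (rule cocycles0_subspace)
  have fg: "f \<oplus>\<^bsub>hom0 i j\<^esub> g \<in> cocycles0 i j" using Z.module.M.a_closed[of f g] f g by simp
  note c = extend_chain_map[OF f] extend_chain_map[OF g]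
  show ?thesis
    unfolding T.add_B[OF c]
    by (rule extend_eqI[OF fg chain_map_sum[OF bounded_T c]])
      (simp_all add: hom0_simps extend_def T.glue_def project_closed rhom_add[OF embed_rhom]
        rhom_closed[OF cocycles0_rhom(1)[OF f]] rhom_closed[OF cocycles0_rhom(1)[OF g]]
        rhom_closed[OF cocycles0_rhom(2)[OF f]] rhom_closed[OF cocycles0_rhom(2)[OF g]])
qed

lemma extend_smult:
  assumes f: "f \<in> cocycles0 i j"
  shows "T.cls (extend i j (c \<odot>\<^bsub>hom0 i j\<^esub> f)) = c \<odot>\<^bsub>T.B\<^esub> T.cls (extend i j f)"
proof -
  interpret Z: vectorspace scalars "hom0 i j\<lparr>carrier := cocycles0 i j\<rparr>" by (rule cocycles0_subspace)
  have cf: "c \<odot>\<^bsub>hom0 i j\<^esub> f \<in> cocycles0 i j" using Z.smult_closed[of c f] f by simp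
  note cm = extend_chain_map[OF f]
  show ?thesis
    unfolding T.smult_B[OF cm]
    by (rule extend_eqI[OF cf chain_map_smult[OF bounded_T cm]])
      (simp_all add: hom0_simps extend_def T.glue_def project_closed rhom_scale[OF embed_rhom]
        rhom_closed[OF cocycles0_rhom(1)[OF f]] rhom_closed[OF cocycles0_rhom(2)[OF f]])
qed

lemma psi_linear: "linear_map scalars (hom0 i j\<lparr>carrier := cocycles0 i j\<rparr>) (hom_space T.B (Q i) (Q j)) (psi i j)"
proof (rule linear_mapI[OF cocycles0_subspace hom_space_vectorspace[OF right_module_Q right_module_Q]])
  interpret B: ring T.B by (rule T.B_ring)
  interpret Ei: idempotent T.B "E i" by (rule idempotent_E)
  interpret Ej: idempotent T.B "E j" by (rule idempotent_E)
  note mem = Ei.idem_module_closed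
  have rh: "(\<lambda>b. T.cls (extend i j f) \<otimes>\<^bsub>T.B\<^esub> b) \<in> rhom T.B (Q i) (Q j)" if f: "f \<in> cocycles0 i j" for f
  proof -
    let ?x = "T.cls (extend i j f)"
    have x: "?x \<in> carrier T.B" by (rule T.cls_mem[OF extend_chain_map[OF f]])
    have "?x \<otimes>\<^bsub>T.B\<^esub> b \<in> carrier (Q j)" if "b \<in> carrier T.B" for b
      using x that Ej.idem_closed E_extend(1)[OF f]
      by (auto intro!: exI[of _ "?x \<otimes>\<^bsub>T.B\<^esub> b"] simp: B.m_assoc[symmetric])
    then show ?thesis
      using x mem by (auto simp: rhom_iff B.r_distr B.m_assoc T.B_smult_mult simp del: idem_module_simps(1))
  qed
  have cm: "T.cls (extend i j f) \<in> carrier T.B" if "f \<in> cocycles0 i j" for f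
    by (rule T.cls_mem[OF extend_chain_map[OF that]])
  show "psi i j \<in> module_hom scalars (hom0 i j\<lparr>carrier := cocycles0 i j\<rparr>) (hom_space T.B (Q i) (Q j))"
    using rh mem
    by (auto simp: module_hom_def psi_def fun_eq_iff extend_add extend_smult B.l_distr T.B_smult_mult cm
        simp del: idem_module_simps(1) intro!: rhom_restrict[OF right_module_Q])
qed

text \<open>A homomorphism \<open>w\<close> is left multiplication by \<open>w (E i)\<close>, and
  this element is unchanged when multiplied by \<open>E j\<close> on the left and \<open>E i\<close>
  on the right. A chain map \<open>c\<close> representing it can therefore be cut down to its
  component from \<open>X i\<close> to \<open>X j\<close>, which is the required cocycle.\<close>

lemma psi_surj: "psi i j ` cocycles0 i j = carrier (hom_space T.B (Q i) (Q j))"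
proof
  interpret L: linear_map scalars "hom0 i j\<lparr>carrier := cocycles0 i j\<rparr>" "hom_space T.B (Q i) (Q j)" "psi i j" by (rule psi_linear)
  show "psi i j ` cocycles0 i j \<subseteq> carrier (hom_space T.B (Q i) (Q j))" using L.T_im by auto
  show "carrier (hom_space T.B (Q i) (Q j)) \<subseteq> psi i j ` cocycles0 i j"
  proof
    fix w assume w: "w \<in> carrier (hom_space T.B (Q i) (Q j))"
    then have wr: "w \<in> rhom T.B (Q i) (Q j)" by simp
    interpret Ei: idempotent T.B "E i" by (rule idempotent_E)
    interpret Ej: idempotent T.B "E j" by (rule idempotent_E)
    have wy: "w y = w (E i) \<otimes>\<^bsub>T.B\<^esub> y" if y: "y \<in> carrier (Q i)" for y
      using rhom_ract[OF wr Ei.idem_mem Ei.idem_module_closed[OF y]] Ei.idem_mult[OF y] by simp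
    have wE: "w (E i) \<in> carrier (Q j)" by (rule rhom_closed[OF wr Ei.idem_mem])
    obtain c where c: "chain_map A T T c" "w (E i) = T.cls c"
      using Ej.idem_module_closed[OF wE] by (rule T.B_cases)
    let ?c' = "ccomp (summand_proj X j) (ccomp c (summand_proj X i))"
    have c': "chain_map A T T ?c'"
      by (intro chain_map_ccomp[OF chain_map_ccomp[OF summand_proj_chain_map c(1)] summand_proj_chain_map])
    have "w (E i) = E j \<otimes>\<^bsub>T.B\<^esub> (w (E i) \<otimes>\<^bsub>T.B\<^esub> E i)"
      using wy[OF Ei.idem_mem] Ej.idem_mult[OF wE] by simp
    then have wc': "w (E i) = T.cls ?c'"
      unfolding c(2) using c(1) by (simp add: T.mult_B chain_map_ccomp[OF summand_proj_chain_map c(1)] summand_proj_chain_map)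
    let ?f = "\<lambda>d\<in>{m, m + 1}. \<lambda>x\<in>carrier (cmod (X i) d). c d (embed i d x) j"
    have fr: "(\<lambda>x. c d (embed i d x) j) \<in> rhom A (cmod (X i) d) (cmod (X j) d)" for d
      by (rule rhom_comp[where g = "\<lambda>t. t j", OF rhom_comp[OF embed_rhom chain_map_rhom[OF c(1)]] project_rhom])
    have f0: "?f \<in> carrier (hom0 i j)"
      using fr by (auto simp: hom0_simps intro!: rhom_restrict[OF right_module_X])
    have f: "?f \<in> cocycles0 i j"
      unfolding cocycles0_iff[OF f0]
    proof
      fix x assume x: "x \<in> carrier (cmod (X i) m)"
      have "c (m + 1) (embed i (m + 1) (cdiff (X i) m x)) = cdiff T m (c m (embed i m x))"
        unfolding cdiff_embed[symmetric] by (rule chain_map_diff[OF c(1) rhom_closed[OF embed_rhom x]])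
      then show "?f (m + 1) (cdiff (X i) m x) = cdiff (X j) m (?f m x)"
        using x rhom_closed[OF diff_X x] by (simp add: cdiff_T)
    qed
    have "T.cls (extend i j ?f) = T.cls ?c'"
      by (rule extend_eqI[OF f c']) (auto simp: ccomp_def summand_proj_eq project_closed)
    then have "w = psi i j ?f"
      using w wy wc' by (intro extensionalityI[of w "carrier (Q i)"]) (auto simp: psi_def simp del: idem_module_simps(1))
    then show "w \<in> psi i j ` cocycles0 i j" using f by (rule image_eqI)
  qed
qed

text \<open>Evaluation at \<open>E i\<close> recovers the class of \<open>extend i j f\<close>, and
  classes are zero exactly for null-homotopic maps.\<close>

lemma psi_eq_zero_iff:
  assumes f: "f \<in> cocycles0 i j"
  shows "psi i j f = \<zero>\<^bsub>hom_space T.B (Q i) (Q j)\<^esub> \<longleftrightarrow>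
    homotopic A T T (extend i j f) (\<lambda>d t. \<zero>\<^bsub>cmod T d\<^esub>)"
proof -
  interpret B: ring T.B by (rule T.B_ring)
  interpret Ei: idempotent T.B "E i" by (rule idempotent_E)
  have "psi i j f = \<zero>\<^bsub>hom_space T.B (Q i) (Q j)\<^esub> \<longleftrightarrow> T.cls (extend i j f) = \<zero>\<^bsub>T.B\<^esub>"
  proof
    assume "psi i j f = \<zero>\<^bsub>hom_space T.B (Q i) (Q j)\<^esub>"
    from fun_cong[OF this, of "E i"] show "T.cls (extend i j f) = \<zero>\<^bsub>T.B\<^esub>"
      using Ei.idem_mem E_extend(2)[OF f] by (simp add: psi_def del: idem_module_simps(1))
  next
    assume "T.cls (extend i j f) = \<zero>\<^bsub>T.B\<^esub>"
    then show "psi i j f = \<zero>\<^bsub>hom_space T.B (Q i) (Q j)\<^esub>"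
      using Ei.idem_module_closed by (auto simp: psi_def fun_eq_iff simp del: idem_module_simps(1))
  qed
  then show ?thesis
    unfolding T.zero_B T.D_of_chain_map_eq_iff[OF bounded_T extend_chain_map[OF f] chain_map_zero[OF bounded_T]] .
qed

text \<open>As \<open>T\<close> is zero in degrees \<open>m - 1\<close> and \<open>m + 2\<close>, a
  null homotopy of \<open>extend i j f\<close> has one relevant component, from degree
  \<open>m + 1\<close> to degree \<open>m\<close>. Its part from \<open>X i\<close> to
  \<open>X j\<close> is a preimage of \<open>f\<close> under \<open>dminus\<close>; conversely, a
  preimage embedded into \<open>T\<close> is a null homotopy.\<close>

lemma psi_kernel:
  "{f \<in> carrier (hom0 i j). dzero i j f = \<zero>\<^bsub>hom_XX i j m (m + 1)\<^esub> \<and> psi i j f = \<zero>\<^bsub>hom_space T.B (Q i) (Q j)\<^esub>} =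
    dminus i j ` carrier (hom_XX i j (m + 1) m)" (is "?K = _")
proof
  let ?X1 = "cmod (X i) (m + 1)" and ?Y0 = "cmod (X j) m" and ?T0 = "cmod T m"
    and ?T1 = "cmod T (m + 1)"
  note mT = cmod_module[OF bounded_T] and dT = cdiff_rhom[OF bounded_T]
  interpret X0: right_module A "?Y0" by (rule right_module_X)
  interpret X1: right_module A "cmod (X j) (m + 1)" by (rule right_module_X)
  interpret T0: right_module A "?T0" by (rule mT)
  interpret T1: right_module A "?T1" by (rule mT)
  show "?K \<subseteq> dminus i j ` carrier (hom_XX i j (m + 1) m)"
  proof
    fix f assume "f \<in> ?K"
    then have f0: "f \<in> carrier (hom0 i j)" and f: "f \<in> cocycles0 i j"
      and hom: "homotopic A T T (extend i j f) (\<lambda>d t. \<zero>\<^bsub>cmod T d\<^esub>)"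
      using psi_eq_zero_iff[of f i j] by (auto simp: cocycles0_def)
    note fr = cocycles0_rhom[OF f]
    obtain h where Hh: "homotopy A T T (extend i j f) (\<lambda>d t. \<zero>\<^bsub>cmod T d\<^esub>) h" using hom by (rule homotopicE)
    note h = homotopy_rhom[OF Hh] and eq = homotopy_eq[OF Hh]
    have hn: "h (d + 1) \<in> rhom A (cmod T (d + 1)) (cmod T d)" for d using h[of "d + 1"] by simp
    let ?k = "\<lambda>x. h (m + 1) (embed i (m + 1) x) j"
    have kr: "?k \<in> rhom A ?X1 ?Y0"
      by (rule rhom_comp[where g = "\<lambda>t. t j", OF rhom_comp[OF embed_rhom hn] project_rhom])
    let ?k' = "restrict ?k (carrier ?X1)"
    have k': "?k' \<in> carrier (hom_XX i j (m + 1) m)" using rhom_restrict[OF right_module_X kr] by simp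
    have fm: "f m x = ?k (cdiff (X i) m x)" if x: "x \<in> carrier (cmod (X i) m)" for x
    proof -
      let ?t = "embed i m x"
      have t: "?t \<in> carrier ?T0" by (rule rhom_closed[OF embed_rhom x])
      have "h m ?t = \<zero>\<^bsub>cmod T (m - 1)\<^esub>" using rhom_closed[OF h t] T.below by simp
      then have "cdiff T (m - 1) (h m ?t) = \<zero>\<^bsub>?T0\<^esub>"
        by (simp add: rhom_zero[OF mT mT cdiff_rhom'[OF bounded_T]])
      then have "extend i j f m ?t = h (m + 1) (cdiff T m ?t)"
        using eq[OF t] rhom_closed[OF hn rhom_closed[OF dT t]] by (simp add: T0.zero_add)
      from fun_cong[OF this, of j] show ?thesis
        unfolding cdiff_embed by (simp add: extend_def T.glue_def embed_apply)
    qed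
    have fm1: "f (m + 1) x = cdiff (X j) m (?k x)" if x: "x \<in> carrier ?X1" for x
    proof -
      let ?t = "embed i (m + 1) x"
      have t: "?t \<in> carrier ?T1" by (rule rhom_closed[OF embed_rhom x])
      have "h (m + 1 + 1) (cdiff T (m + 1) ?t) = \<zero>\<^bsub>?T1\<^esub>"
        using cocycles_diff[OF T.top_cocycles[OF t]] rhom_zero[OF mT mT hn[of "m + 1"]] by simp
      then have "extend i j f (m + 1) ?t = cdiff T m (h (m + 1) ?t)"
        using eq[OF t] rhom_closed[OF dT rhom_closed[OF hn t]] by (simp add: T1.zero_add T1.add_zero)
      from fun_cong[OF this, of j] show ?thesis
        by (simp add: extend_def T.glue_def embed_apply cdiff_T)
    qed
    have "f = dminus i j ?k'"
    proof (rule extensionalityI[of _ "{m, m + 1}"])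
      fix d assume d: "d \<in> {m, m + 1}"
      show "f d = dminus i j ?k' d"
      proof (rule extensionalityI[of _ "carrier (cmod (X i) d)"])
        show "f d x = dminus i j ?k' d x" if "x \<in> carrier (cmod (X i) d)" for x
          using d that fm fm1 rhom_closed[OF diff_X] by (auto simp: dminus_def)
      qed (use d f0 in \<open>auto simp: hom0_simps dminus_def\<close>)
    qed (use f0 in \<open>auto simp: hom0_simps dminus_def\<close>)
    then show "f \<in> dminus i j ` carrier (hom_XX i j (m + 1) m)" using k' by (rule image_eqI)
  qed
  show "dminus i j ` carrier (hom_XX i j (m + 1) m) \<subseteq> ?K"
  proof
    interpret L: linear_map scalars "hom_XX i j (m + 1) m" "hom0 i j" "dminus i j" by (rule dminus_linear)
    fix f assume "f \<in> dminus i j ` carrier (hom_XX i j (m + 1) m)"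
    then obtain k where k: "k \<in> carrier (hom_XX i j (m + 1) m)" "f = dminus i j k" by blast
    then have kr: "k \<in> rhom A ?X1 ?Y0" by simp
    have f0: "f \<in> carrier (hom0 i j)" using L.T_im k by simp
    have f: "f \<in> cocycles0 i j"
      unfolding cocycles0_iff[OF f0] using rhom_closed[OF diff_X] by (simp add: k(2) dminus_def)
    have "homotopic A T T (extend i j f) (\<lambda>d t. \<zero>\<^bsub>cmod T d\<^esub>)"
    proof (rule homotopicI)
      let ?g = "\<lambda>t. embed j m (k (t i))"
      let ?h = "T.glue (\<lambda>d. cmod T (d - 1)) (\<lambda>t. \<zero>\<^bsub>cmod T (m - 1)\<^esub>) ?g"
      have g: "?g \<in> rhom A ?T1 ?T0"
        by (rule rhom_comp[OF rhom_comp[where g = k, OF project_rhom kr] embed_rhom])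
      show h: "?h d \<in> rhom A (cmod T d) (cmod T (d - 1))" for d
        by (rule T.glue_rhom) (use g mT rhom_zero_map[OF mT] in auto)
      note er = chain_map_rhom[OF extend_chain_map[OF f]]
      fix d t assume t: "t \<in> carrier (cmod T d)"
      let ?Q = "\<lambda>d t. extend i j f d t = \<zero>\<^bsub>cmod T d\<^esub> \<oplus>\<^bsub>cmod T d\<^esub>
        (cdiff T (d - 1) (?h d t) \<oplus>\<^bsub>cmod T d\<^esub> ?h (d + 1) (cdiff T d t))"
      show "?Q d t"
        using t
      proof (rule T.degree_cases[where Q = ?Q])
        assume d: "d = m"
        have tm: "t \<in> carrier ?T0" using t d by simp
        have "cdiff T (m - 1) \<zero>\<^bsub>cmod T (m - 1)\<^esub> = \<zero>\<^bsub>?T0\<^esub>"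
          by (rule rhom_zero[OF mT mT cdiff_rhom'[OF bounded_T]])
        moreover have "?g (cdiff T m t) \<in> carrier ?T0" by (rule rhom_closed[OF g rhom_closed[OF dT tm]])
        ultimately show "?Q d t"
          using project_closed[OF tm, of i] unfolding d
          by (simp add: extend_def T.glue_def k(2) dminus_def T0.zero_add) (simp add: cdiff_T)
      next
        assume d: "d = m + 1"
        have tm: "t \<in> carrier ?T1" using t d by simp
        have "cdiff T m (?g t) \<in> carrier ?T1" by (rule rhom_closed[OF dT rhom_closed[OF g tm]])
        then show "?Q d t"
          using project_closed[OF tm, of i] unfolding d
          by (simp add: extend_def T.glue_def k(2) dminus_def T1.zero_add T1.add_zero add.commute[of 1 m] cdiff_embed)
      next
        interpret Td: right_module A "cmod T d" by (rule mT)
        have "?h (d + 1) \<zero>\<^bsub>cmod T (d + 1)\<^esub> = \<zero>\<^bsub>cmod T d\<^esub>" using rhom_zero[OF mT mT h[of "d + 1"]] by simp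
        then show "?Q d \<zero>\<^bsub>cmod T d\<^esub>"
          by (simp add: rhom_zero[OF mT mT h] rhom_zero[OF mT mT dT] rhom_zero[OF mT mT cdiff_rhom'[OF bounded_T]]
              rhom_zero[OF mT mT er] Td.add_zero Td.zero_mem)
      qed
    qed
    then show "f \<in> ?K" using psi_eq_zero_iff[OF f] f by (simp add: cocycles0_def)
  qed
qed

section \<open>The Cartan matrix\<close>

definition cartan :: "'v \<Rightarrow> 'v \<Rightarrow> nat" where
  "cartan u v = vectorspace.dim scalars (hom_space A (P u) (P v))"

lemma hom_XX_dim:
  "vectorspace.fin_dim scalars (hom_XX i j p q)"
  "vectorspace.dim scalars (hom_XX i j p q) = (\<Sum>x\<in>S i p. \<Sum>y\<in>S j q. cartan (a i p x) (a j q y))"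
proof -
  have 0: "vectorspace.fin_dim scalars (hom_space A (P u) (P v))" for u v
    by (rule idempotent.fin_dim_hom[OF idempotent right_module_P fd_P])
  have 1: "vectorspace.fin_dim scalars (hom_space A (P u) (cmod (X j) q))"
    "vectorspace.dim scalars (hom_space A (P u) (cmod (X j) q)) = (\<Sum>y\<in>S j q. cartan u (a j q y))" for u
    unfolding cmod_X cartan_def
    by (rule hom_space_dsum_target[OF finite_S right_module_P right_module_P 0])+
  show "vectorspace.fin_dim scalars (hom_XX i j p q)"
    unfolding cmod_X[of i p] by (rule hom_space_dsum_source(1)[OF finite_S right_module_P right_module_X 1(1)])
  show "vectorspace.dim scalars (hom_XX i j p q) = (\<Sum>x\<in>S i p. \<Sum>y\<in>S j q. cartan (a i p x) (a j q y))"
    unfolding cmod_X[of i p] 1(2)[symmetric]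
    by (rule hom_space_dsum_source(2)[OF finite_S right_module_P right_module_X 1(1)])
qed

text \<open>The two positive terms are the degree 0 part of the Hom complex, split over the degrees
  \<open>m\<close> and \<open>m + 1\<close> of its components; the negative ones are its degrees 1
  and -1.\<close>

lemma cartan_End:
  "int (vectorspace.dim scalars (hom_space T.B (Q i) (Q j))) =
    int (vectorspace.dim scalars (hom_XX i j m m)) + int (vectorspace.dim scalars (hom_XX i j (m + 1) (m + 1)))
    - int (vectorspace.dim scalars (hom_XX i j m (m + 1))) - int (vectorspace.dim scalars (hom_XX i j (m + 1) m))"
proof -
  have fd0: "vectorspace.fin_dim scalars (hom0 i j) \<and> vectorspace.dim scalars (hom0 i j) =
      (\<Sum>d\<in>{m, m + 1}. vectorspace.dim scalars (hom_XX i j d d))"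
    unfolding hom0_def
    by (rule vprod_dim[OF field_scalars _ hom_XX_vectorspace hom_XX_dim(1)]) simp
  have "int (vectorspace.dim scalars (hom_space T.B (Q i) (Q j))) =
      int (vectorspace.dim scalars (hom0 i j)) - int (vectorspace.dim scalars (hom_XX i j m (m + 1)))
      - int (vectorspace.dim scalars (hom_XX i j (m + 1) m))"
    by (rule dim_middle_cohomology[OF dminus_linear dzero_linear hom_XX_dim(1) conjunct1[OF fd0] dminus_inj dzero_surj
          psi_linear[unfolded cocycles0_def] psi_surj[unfolded cocycles0_def] psi_kernel])
  then show ?thesis using fd0 by simp
qed

text \<open>Coefficient of \<open>P u\<close> in the class of \<open>X i\<close> in the Grothendieck
  group: degree \<open>m\<close> carries the sign given by the parity of \<open>m\<close>, degree
  \<open>m + 1\<close> the opposite one. The absolute value allows a natural exponent without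
  changing the parity.\<close>

definition euler :: "'v \<Rightarrow> 'v \<Rightarrow> int" where
  "euler i u = (-1) ^ nat \<bar>m\<bar> * (int (card {x \<in> S i m. a i m x = u}) - int (card {x \<in> S i (m + 1). a i (m + 1) x = u}))"

lemma sum_over_fibres:
  "(\<Sum>x\<in>S i d. g (a i d x)) = (\<Sum>u\<in>UNIV. int (card {x \<in> S i d. a i d x = u}) * g u)"
proof -
  have "(\<Sum>x\<in>S i d. g (a i d x)) = (\<Sum>u\<in>UNIV. \<Sum>x\<in>{x \<in> S i d. a i d x = u}. g (a i d x))"
    by (rule sum.group[symmetric]) (auto simp: finite_S)
  also have "\<dots> = (\<Sum>u\<in>UNIV. int (card {x \<in> S i d. a i d x = u}) * g u)" by simp
  finally show ?thesis .
qed

lemma hom_XX_dim_sum: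
  "int (vectorspace.dim scalars (hom_XX i j p q)) =
    (\<Sum>u\<in>UNIV. \<Sum>v\<in>UNIV. int (card {x \<in> S i p. a i p x = u}) * int (cartan u v) * int (card {y \<in> S j q. a j q y = v}))"
proof -
  have "int (vectorspace.dim scalars (hom_XX i j p q)) = (\<Sum>x\<in>S i p. \<Sum>y\<in>S j q. int (cartan (a i p x) (a j q y)))"
    by (simp add: hom_XX_dim(2))
  also have "\<dots> = (\<Sum>u\<in>UNIV. int (card {x \<in> S i p. a i p x = u}) * (\<Sum>y\<in>S j q. int (cartan u (a j q y))))"
    by (rule sum_over_fibres[where g = "\<lambda>u. \<Sum>y\<in>S j q. int (cartan u (a j q y))"])
  also have "\<dots> = (\<Sum>u\<in>UNIV. int (card {x \<in> S i p. a i p x = u}) * (\<Sum>v\<in>UNIV. int (card {y \<in> S j q. a j q y = v}) * int (cartan u v)))"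
    by (rule sum.cong[OF refl], subst sum_over_fibres[where g = "\<lambda>v. int (cartan u v)" for u]) simp
  finally show ?thesis by (simp add: sum_distrib_left mult_ac)
qed

theorem cartan_matrix_End:
  "cartan_matrix (End_dsum A X) (End_dsum_proj A X) =
    (\<chi> i u. euler i u) ** cartan_matrix A P ** Finite_Cartesian_Product.transpose (\<chi> i u. euler i u)"
proof -
  \<comment> \<open>The sign of degree \<open>m\<close> enters once through \<open>X i\<close> and
    once through \<open>X j\<close>, so it cancels.\<close>
  have sq: "(-1::int) ^ nat \<bar>m\<bar> * (-1) ^ nat \<bar>m\<bar> = 1" by (simp flip: power_add mult_2)
  have "int (vectorspace.dim scalars (hom_space (End_dsum A X) (End_dsum_proj A X i) (End_dsum_proj A X j))) =
    (\<Sum>v\<in>UNIV. (\<Sum>u\<in>UNIV. euler i u * int (cartan u v)) * euler j v)" for i j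
  proof -
    let ?n = "\<lambda>i d u. int (card {x \<in> S i d. a i d x = u})"
    have eu: "euler i u * c * euler j v = (?n i m u - ?n i (m + 1) u) * c * (?n j m v - ?n j (m + 1) v)" for u v c
    proof -
      have "euler i u * c * euler j v = ((-1) ^ nat \<bar>m\<bar> * (-1) ^ nat \<bar>m\<bar>) *
          ((?n i m u - ?n i (m + 1) u) * c * (?n j m v - ?n j (m + 1) v))"
        unfolding euler_def by (simp only: mult_ac)
      then show ?thesis unfolding sq by simp
    qed
    \<comment> \<open>The product of the two differences of multiplicities expands into the four
      terms of \<open>cartan_End\<close>, the mixed ones with a minus sign.\<close>
    have "int (vectorspace.dim scalars (hom_space T.B (Q i) (Q j))) =
      (\<Sum>u\<in>UNIV. \<Sum>v\<in>UNIV. (?n i m u - ?n i (m + 1) u) * int (cartan u v) * (?n j m v - ?n j (m + 1) v))"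
      unfolding cartan_End hom_XX_dim_sum sum.distrib[symmetric] sum_subtractf[symmetric]
      by (intro sum.cong refl) (simp add: algebra_simps)
    also have "\<dots> = (\<Sum>u\<in>UNIV. \<Sum>v\<in>UNIV. euler i u * int (cartan u v) * euler j v)" unfolding eu ..
    also have "\<dots> = (\<Sum>v\<in>UNIV. \<Sum>u\<in>UNIV. euler i u * int (cartan u v) * euler j v)" by (rule sum.swap)
    finally show ?thesis by (simp add: End_dsum_def End_dsum_proj_def sum_distrib_right)
  qed
  then show ?thesis
    by (simp add: vec_eq_iff cartan_matrix_def matrix_matrix_mult_def Finite_Cartesian_Product.transpose_def cartan_def)
qed

end

section \<open>Bound quiver algebras\<close>

text \<open>\<open>bound_quiver_algebra\<close> extends the quotient ring by a scalar
  multiplication; the ring laws read fields that \<open>extend\<close> keeps.\<close>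

lemma ring_extend: 
  assumes "ring R"
  shows "ring (ring.extend R r)"
proof -
  interpret R: ring R by fact
  show ?thesis
    by (intro ringI abelian_groupI monoidI)
      (auto simp: ring.defs R.m_assoc R.a_ac R.l_distr R.r_distr intro: R.l_neg R.a_inv_closed)
qed

lemma bound_quiver_algebra_simps:
  "carrier (bound_quiver_algebra Q I) = carrier (path_algebra Q Quot I)"
  "mult (bound_quiver_algebra Q I) = mult (path_algebra Q Quot I)"
  by (simp_all add: bound_quiver_algebra_def ring.defs)

lemma path_elem_trivial:
  fixes Q :: "('v, 'e) pre_digraph" and u :: 'v
  assumes "u \<in> verts Q"
  defines "p \<equiv> path_elem (u, []) :: ('v, 'e) qpath \<Rightarrow> 'k::field"
  shows "p \<in> carrier (path_algebra Q)" "p \<otimes>\<^bsub>path_algebra Q\<^esub> p = p"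
proof -
  have supp: "{w. p w \<noteq> 0} = {(u, [])}" by (auto simp: p_def path_elem_def)
  have "pre_digraph.awalk Q u [] u"
    using assms(1) by (simp add: pre_digraph.awalk_def pre_digraph.cas.simps)
  then show "p \<in> carrier (path_algebra Q)"
    using supp by (auto simp: path_algebra_def qpaths_def)
  have "(\<Sum>m\<le>length q. p (v, take m q) * p (pre_digraph.awlast Q v (take m q), drop m q)) = p (v, q)" for v q
  proof (cases "q = []")
    case True
    then show ?thesis by (simp add: p_def path_elem_def pre_digraph.awalk_verts.simps)
  next
    case False
    \<comment> \<open>However a nonempty path is cut, one of the two pieces is nonempty, and
      \<open>p\<close> is zero on it.\<close>
    have "p (v, take m q) * p (pre_digraph.awlast Q v (take m q), drop m q) = 0" for m
      using False by (cases m) (auto simp: p_def path_elem_def)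
    then have "(\<Sum>m\<le>length q. p (v, take m q) * p (pre_digraph.awlast Q v (take m q), drop m q)) = 0"
      by (intro sum.neutral) blast
    also have "0 = p (v, q)" using False by (simp add: p_def path_elem_def)
    finally show ?thesis .
  qed
  then show "p \<otimes>\<^bsub>path_algebra Q\<^esub> p = p"
    by (auto simp: path_algebra_def fun_eq_iff)
qed

locale bound_quiver = fin_digraph Q
  for Q :: "('v::finite, 'e) pre_digraph" +
  fixes I :: "(('v, 'e) qpath \<Rightarrow> 'k::field) set"
  assumes all_verts: "verts Q = UNIV" and admissible: "admissible_ideal Q I"
begin

abbreviation A where "A \<equiv> bound_quiver_algebra Q I"
abbreviation e where "e u \<equiv> path_class Q I (u, [])"

lemma ideal_I: "ideal I (path_algebra Q)"
  using admissible by (simp add: admissible_ideal_def)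

lemma ring_A: "ring A"
  unfolding bound_quiver_algebra_def by (rule ring_extend[OF ideal.quotient_is_ring[OF ideal_I]])

lemma e_closed: "e u \<in> carrier A" and e_idem: "e u \<otimes>\<^bsub>A\<^esub> e u = e u"
proof -
  let ?p = "path_elem (u, []) :: ('v, 'e) qpath \<Rightarrow> 'k"
  note p = path_elem_trivial[of u Q, where ?'k = 'k]
  have h: "(+>\<^bsub>path_algebra Q\<^esub>) I \<in> ring_hom (path_algebra Q) (path_algebra Q Quot I)"
    by (rule ideal.rcos_ring_hom[OF ideal_I])
  show "e u \<in> carrier A"
    using ring_hom_closed[OF h p(1)] all_verts by (simp add: path_class_def bound_quiver_algebra_simps)
  show "e u \<otimes>\<^bsub>A\<^esub> e u = e u"
    using ring_hom_mult[OF h p(1) p(1)] p(2) all_verts by (simp add: path_class_def bound_quiver_algebra_simps)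
qed

text \<open>Passage from the tilting hypothesis to the abstract setting: perfectness supplies the
  bounded complex, and the condition on shifts supplies \<open>vanishing\<close>.\<close>

lemma mutation_two_term_sum:
  assumes tilting: "tilting_complex A (dsum_complex X)"
    and mods: "\<And>i d. cmod (X i) d = dsum_module (S i d) (\<lambda>x. quiver_proj Q I (a i d x))"
    and "\<And>i d. finite (S i d)" "\<And>i d. d \<noteq> m \<Longrightarrow> d \<noteq> m + 1 \<Longrightarrow> S i d = {}"
    and "\<And>u. \<exists>i d. \<exists>x\<in>S i d. a i d x = u"
  shows "two_term_sum A e X S a m"
proof -
  interpret ring A by (rule ring_A)
  show ?thesis
  proof
    show "cmod (X i) d = dsum_module (S i d) (\<lambda>x. idem_module A (e (a i d x)))" for i d
      using mods by (simp add: quiver_proj_def)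
  qed (use assms e_closed e_idem in \<open>auto simp: tilting_complex_def perfect_def\<close>)
qed

section \<open>The negative and the positive mutation\<close>

lemma quiver_proj_eq: "quiver_proj Q I = (\<lambda>u. idem_module A (e u))"
  by (auto simp: quiver_proj_def)

lemma finite_in_arcs: "finite (in_arcs Q k)" and finite_out_arcs: "finite (out_arcs Q k)"
  by (simp_all add: in_arcs_def out_arcs_def)

lemma card_Some_image: "card {x \<in> Some ` M. f (the x) = u} = card {\<alpha> \<in> M. f \<alpha> = u}"
proof -
  have "{x \<in> Some ` M. f (the x) = u} = Some ` {\<alpha> \<in> M. f \<alpha> = u}" by auto
  then show ?thesis by (simp add: card_image)
qed

lemma neg_mutation_cartan:
  assumes "neg_mutation_defined Q I k"
  shows "cartan_matrix (neg_mutation Q I k) (neg_mutation_proj Q I k) =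
    r_minus Q k ** cartan_matrix A (quiver_proj Q I) ** Finite_Cartesian_Product.transpose (r_minus Q k)"
proof -
  let ?S = "\<lambda>i d. if i = k then (if d = -1 then {None} else if d = 0 then Some ` in_arcs Q k else {})
    else (if d = (0::int) then {None} else {})"
  \<comment> \<open>For \<open>i = k\<close> the value outside degree 0 is the vertex of the term
    \<open>P_k\<close> of \<open>L_k\<close> in degree -1.\<close>
  let ?a = "\<lambda>i d x. if i = k then (if d = 0 then tail Q (the x) else k) else i"
  \<comment> \<open>The degrees -1 and 0 hold \<open>L_k\<close>, and the stalk complexes sit in the
    upper one, so \<open>m = -1\<close>.\<close>
  interpret M: two_term_sum A e "T_minus_summand Q I k" ?S ?a "-1"
  proof (rule mutation_two_term_sum)
    show "tilting_complex A (dsum_complex (T_minus_summand Q I k))"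
      using assms by (simp add: neg_mutation_defined_def T_minus_def)
    show "cmod (T_minus_summand Q I k i) d = dsum_module (?S i d) (\<lambda>x. quiver_proj Q I (?a i d x))" for i d
      by (simp add: T_minus_summand_def L_complex_def L_module_def stalk_complex_def stalk_module_def)
    show "\<exists>i d. \<exists>x\<in>?S i d. ?a i d x = u" for u
    proof (cases "u = k")
      case True
      then show ?thesis by (intro exI[of _ k] exI[of _ "-1"]) simp
    next
      case False
      then show ?thesis by (intro exI[of _ u] exI[of _ 0]) simp
    qed
  qed (simp_all add: finite_in_arcs)
  have "card {x \<in> Some ` in_arcs Q k. tail Q (the x) = u} = card {\<alpha> \<in> arcs Q. tail Q \<alpha> = u \<and> head Q \<alpha> = k}" for u
    unfolding card_Some_image by (rule arg_cong[where f = card]) auto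
  \<comment> \<open>For \<open>m = -1\<close> the sign in \<open>euler\<close> makes degree 0
    positive: row \<open>k\<close> counts the arrows into \<open>k\<close>, with -1 coming from
    \<open>P_k\<close> in degree -1.\<close>
  then have "(\<chi> i u. M.euler i u) = r_minus Q k"
    by (auto simp: vec_eq_iff M.euler_def r_minus_def)
  then show ?thesis using M.cartan_matrix_End by (simp add: quiver_proj_eq)
qed

lemma pos_mutation_cartan:
  assumes "pos_mutation_defined Q I k"
  shows "cartan_matrix (pos_mutation Q I k) (pos_mutation_proj Q I k) =
    r_plus Q k ** cartan_matrix A (quiver_proj Q I) ** Finite_Cartesian_Product.transpose (r_plus Q k)"
proof -
  let ?S = "\<lambda>i d. if i = k then (if d = 1 then {None} else if d = 0 then Some ` out_arcs Q k else {})
    else (if d = (0::int) then {None} else {})"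
  let ?a = "\<lambda>i d x. if i = k then (if d = 0 then head Q (the x) else k) else i"
  \<comment> \<open>Now the stalk complexes share the lower degree 0 with the sum over the arrows,
    and \<open>P_k\<close> sits in degree 1; so \<open>m = 0\<close>, and degree 0 is again the
    positive one.\<close>
  interpret M: two_term_sum A e "T_plus_summand Q I k" ?S ?a 0
  proof (rule mutation_two_term_sum)
    show "tilting_complex A (dsum_complex (T_plus_summand Q I k))"
      using assms by (simp add: pos_mutation_defined_def T_plus_def)
    show "cmod (T_plus_summand Q I k i) d = dsum_module (?S i d) (\<lambda>x. quiver_proj Q I (?a i d x))" for i d
      by (simp add: T_plus_summand_def R_complex_def R_module_def stalk_complex_def stalk_module_def)
    show "\<exists>i d. \<exists>x\<in>?S i d. ?a i d x = u" for u
    proof (cases "u = k")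
      case True
      then show ?thesis by (intro exI[of _ k] exI[of _ 1]) simp
    next
      case False
      then show ?thesis by (intro exI[of _ u] exI[of _ 0]) simp
    qed
  qed (simp_all add: finite_out_arcs)
  have "card {x \<in> Some ` out_arcs Q k. head Q (the x) = u} = card {\<beta> \<in> arcs Q. tail Q \<beta> = k \<and> head Q \<beta> = u}" for u
    unfolding card_Some_image by (rule arg_cong[where f = card]) auto
  then have "(\<chi> i u. M.euler i u) = r_plus Q k"
    by (auto simp: vec_eq_iff M.euler_def r_plus_def)
  then show ?thesis using M.cartan_matrix_End by (simp add: quiver_proj_eq)
qed

end

theorem proposition3p6:
  fixes Q :: "('v::finite, 'e) pre_digraph"
    and I :: "(('v, 'e) qpath \<Rightarrow> 'k::alg_closed_field) set"
    and k :: 'v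
  assumes "fin_digraph Q" and "verts Q = UNIV"
    and "admissible_ideal Q I"
    and no_loop: "\<not> (\<exists>\<alpha>\<in>arcs Q. tail Q \<alpha> = k \<and> head Q \<alpha> = k)"
  shows
    "(neg_mutation_defined Q I k \<longrightarrow>
        cartan_matrix (neg_mutation Q I k) (neg_mutation_proj Q I k) =
          r_minus Q k ** cartan_matrix (bound_quiver_algebra Q I) (quiver_proj Q I)
            ** Finite_Cartesian_Product.transpose (r_minus Q k)) \<and>
     (pos_mutation_defined Q I k \<longrightarrow>
        cartan_matrix (pos_mutation Q I k) (pos_mutation_proj Q I k) =
          r_plus Q k ** cartan_matrix (bound_quiver_algebra Q I) (quiver_proj Q I)
            ** Finite_Cartesian_Product.transpose (r_plus Q k))"
proof -
  interpret fin_digraph Q by fact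
  interpret bound_quiver Q I by unfold_locales (use assms in auto)
  show ?thesis using neg_mutation_cartan pos_mutation_cartan by blast
qed

end
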